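(* Let $s\in(0,1)$ and let $\Omega$ be a domain in $\mathbb{R}^n$. Let $\vec b:\Omega\to\mathbb{R}^n$ and $c:\Omega\to\mathbb{R}$ satisfy $\|\vec b\|_{C^1(\Omega)}+\|c\|_{L^\infty(\Omega)}<\infty$. Let $u,v\in\mathcal{L}_{2s}$ and $f,g\in L^1_{\rm loc}(\Omega)$ satisfy $$(-\Delta)^su+\vec b\cdot\nabla u+c\,u\le f\quad\text{in }\mathcal{D}'(\Omega),\qquad (-\Delta)^sv+\vec b\cdot\nabla v+c\,v\le g\quad\text{in }\mathcal{D}'(\Omega).$$ Then $w(x)=\max\{u(x),v(x)\}$ satisfies $$(-\Delta)^sw+\vec b\cdot\nabla w+c\,w\le f\,\chi_{\{u>v\}}+g\,\chi_{\{u<v\}}+\max\{f,g\}\,\chi_{\{u=v\}}\quad\text{in }\mathcal{D}'(\Omega).$$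
   Context: $\chi_A$ is the indicator function of $A$. $\mathcal{L}_{\alpha}=\{u:\mathbb{R}^n\to\mathbb{R}\ :\ \int_{\mathbb{R}^n}\frac{|u(y)|}{1+|y|^{n+\alpha}}\,dy<\infty\}$. For $\varphi\in C_c^\infty(\mathbb{R}^n)$, $(-\Delta)^s\varphi(x)=C_{n,s}\,\mathrm{P.V.}\int_{\mathbb{R}^n}\frac{\varphi(x)-\varphi(y)}{|x-y|^{n+2s}}\,dy$, where $C_{n,s}>0$ is the usual normalization constant. For $u\in\mathcal{L}_{2s}$ and $F\in L^1_{\rm loc}(\Omega)$, $(-\Delta)^su+\vec b\cdot\nabla u+cu\le F$ in $\mathcal{D}'(\Omega)$ means $\int_{\mathbb{R}^n}u\,(-\Delta)^s\varphi\,dx+\int_\Omega u\,[-\mathrm{div}(\vec b\,\varphi)+c\,\varphi]\,dx\le\int_\Omega F\varphi\,dx$ for every nonnegative $\varphi\in C_c^\infty(\Omega)$. *)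

theory Defs
  imports "HOL-Analysis.Analysis" "HOL-Probability.Essential_Supremum"
begin

text \<open>
  Functions given only on an open set \<open>\<Omega>\<close> (the coefficients and right-hand sides) are represented
  by total functions whose values off \<open>\<Omega>\<close> are irrelevant.  Measurability and integration are with
  respect to Lebesgue measure.
\<close>

definition partial :: "'n \<Rightarrow> (real ^ 'n::finite \<Rightarrow> 'b::real_normed_vector) \<Rightarrow> real ^ 'n \<Rightarrow> 'b"
  where "partial i f x = frechet_derivative f (at x) (axis i 1)"

text \<open>Meant for open sets only: the derivatives are taken in the whole space.\<close>

fun Ck_on :: "nat \<Rightarrow> (real ^ 'n::finite) set \<Rightarrow> (real ^ 'n \<Rightarrow> 'b::real_normed_vector) \<Rightarrow> bool"
  where
    "Ck_on 0 S f \<longleftrightarrow> continuous_on S f"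
  | "Ck_on (Suc k) S f \<longleftrightarrow>
       (\<forall>x\<in>S. f differentiable (at x)) \<and> (\<forall>i. Ck_on k S (partial i f))"

text \<open>Test functions on \<open>\<Omega>\<close>, extended by zero to the whole space.\<close>

definition test_functions :: "(real ^ 'n::finite) set \<Rightarrow> (real ^ 'n \<Rightarrow> real) set"
  where "test_functions \<Omega> =
    {\<phi>. (\<forall>k. Ck_on k UNIV \<phi>) \<and> compact (closure {x. \<phi> x \<noteq> 0}) \<and> closure {x. \<phi> x \<noteq> 0} \<subseteq> \<Omega>}"

text \<open>\<open>sup |b| + \<Sum>\<^sub>i sup |\<partial>\<^sub>i b|\<close>, to be used together with \<^term>\<open>Ck_on 1 \<Omega> b\<close>: by itself it does not
  force differentiability.\<close>

definition C1_norm :: "(real ^ 'n::finite) set \<Rightarrow> (real ^ 'n \<Rightarrow> 'b::real_normed_vector) \<Rightarrow> ennreal"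
  where "C1_norm \<Omega> b =
    (SUP x\<in>\<Omega>. ennreal (norm (b x))) + (\<Sum>i\<in>UNIV. SUP x\<in>\<Omega>. ennreal (norm (partial i b x)))"

definition Linfty_norm :: "(real ^ 'n::finite) set \<Rightarrow> (real ^ 'n \<Rightarrow> real) \<Rightarrow> ennreal"
  where "Linfty_norm \<Omega> c = esssup (lebesgue_on \<Omega>) (\<lambda>x. ennreal \<bar>c x\<bar>)"

definition weighted_L1 :: "real \<Rightarrow> (real ^ 'n::finite \<Rightarrow> real) set"
  where "weighted_L1 \<alpha> =
    {u. u \<in> borel_measurable lebesgue \<and>
        integrable lebesgue (\<lambda>y. \<bar>u y\<bar> / (1 + norm y powr (real CARD('n) + \<alpha>)))}"

definition L1_loc :: "(real ^ 'n::finite) set \<Rightarrow> (real ^ 'n \<Rightarrow> real) set"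
  where "L1_loc \<Omega> = {f. \<forall>K. compact K \<longrightarrow> K \<subseteq> \<Omega> \<longrightarrow> set_integrable lebesgue K f}"

text \<open>The constant for which the operator below has Fourier symbol \<open>|\<xi>|\<^bsup>2s\<^esup>\<close>; here \<open>d\<close> is the
  dimension, and \<open>s / \<Gamma>(1 - s) = 1 / |\<Gamma>(-s)|\<close>.\<close>

definition frac_const :: "nat \<Rightarrow> real \<Rightarrow> real"
  where "frac_const d s =
    4 powr s * s * Gamma (real d / 2 + s) / (pi powr (real d / 2) * Gamma (1 - s))"

definition frac_laplacian :: "real \<Rightarrow> (real ^ 'n::finite \<Rightarrow> real) \<Rightarrow> real ^ 'n \<Rightarrow> real"
  where "frac_laplacian s \<phi> x =
    frac_const CARD('n) s *
    Lim (at_right 0) (\<lambda>\<epsilon>. set_lebesgue_integral lebesgue {y. \<epsilon> < norm (x - y)}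
      (\<lambda>y. (\<phi> x - \<phi> y) / norm (x - y) powr (real CARD('n) + 2 * s)))"

definition divergence :: "(real ^ 'n::finite \<Rightarrow> real ^ 'n) \<Rightarrow> real ^ 'n \<Rightarrow> real"
  where "divergence F x = (\<Sum>i\<in>UNIV. partial i (\<lambda>y. F y $ i) x)"

text \<open>\<open>(-\<Delta>)\<^sup>s u + b \<cdot> \<nabla>u + c u \<le> F\<close> in the distributional sense on \<open>\<Omega>\<close>.  The first two conjuncts
  are the conditions under which the integrals are meaningful (Bochner integrals of
  non-integrable functions are 0 by convention).\<close>

definition distr_le ::
    "(real ^ 'n::finite) set \<Rightarrow> real \<Rightarrow> (real ^ 'n \<Rightarrow> real ^ 'n) \<Rightarrow> (real ^ 'n \<Rightarrow> real) \<Rightarrow>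
     (real ^ 'n \<Rightarrow> real) \<Rightarrow> (real ^ 'n \<Rightarrow> real) \<Rightarrow> bool"
  where "distr_le \<Omega> s b c u F \<longleftrightarrow>
    u \<in> weighted_L1 (2 * s) \<and> F \<in> L1_loc \<Omega> \<and>
    (\<forall>\<phi>\<in>test_functions \<Omega>. (\<forall>x. 0 \<le> \<phi> x) \<longrightarrow>
       integral\<^sup>L lebesgue (\<lambda>x. u x * frac_laplacian s \<phi> x)
       + set_lebesgue_integral lebesgue \<Omega>
           (\<lambda>x. u x * (- divergence (\<lambda>y. \<phi> y *\<^sub>R b y) x + c x * \<phi> x))
       \<le> set_lebesgue_integral lebesgue \<Omega> (\<lambda>x. F x * \<phi> x))"

end

theory Submission
  imports Defs
begin

text \<open>
  The theorem is Kato's inequality for the maximum.  At a point where \<open>u \<ge> v\<close> the difference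
  \<open>w(x) - w(y)\<close>, where \<open>w = max u v\<close>, is at most \<open>u(x) - u(y)\<close>.  Hence a nonlocal operator with a
  non-negative kernel, applied to \<open>w\<close>, is at most its value on whichever of the two functions is the larger
  one, and at most any convex combination of the two values where the functions agree.  First-order
  terms are exact under the maximum by the chain rule, and zeroth-order terms trivially.  The work
  lies in making this rigorous for functions that are merely in the weighted space, with the
  inequalities known only in the sense of distributions.

  Regularization.  Testing the inequality for \<open>u\<close> with \<open>\<rho>\<^sub>r(x - \<cdot>)\<close> gives a pointwise inequality for the
  mollification \<open>u\<^sub>r\<close> at \<open>x\<close> (\<open>mollified_inequality\<close>).  The drift and the potential do not commute with
  mollification, but the errors are integrals of \<open>u(y) - u(x)\<close>, \<open>(c u)(y) - (c u)(x)\<close> and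
  \<open>f(y) - f(x)\<close> against kernels of size \<open>r\<^sup>-\<^sup>n\<close> on the ball of radius \<open>r\<close> around \<open>x\<close>; for the drift
  this is Friedrichs' commutator estimate (\<open>commutator_estimate\<close>), which uses that \<open>b\<close> is Lipschitz.  All of
  them are bounded by the local oscillation at scale \<open>r\<close>, whose weighted integral tends to \<open>0\<close> by
  the continuity of translations in \<open>L\<^sup>1\<close> (\<open>oscillation_weighted_small\<close>).

  The nonlocal part.  The truncation of the operator to \<open>|x - y| > e\<close> is defined on all functions of the
  weighted space and is symmetric (\<open>trunc_op_self_adjoint\<close>).  For it the pointwise inequality
  \<open>T max(u\<^sub>r, v\<^sub>r) \<le> \<theta> T u\<^sub>r + (1 - \<theta>) T v\<^sub>r\<close> holds with every measurable \<open>\<theta>\<close> between \<open>0\<close> and \<open>1\<close> such that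
  \<open>max(u\<^sub>r, v\<^sub>r) = \<theta> u\<^sub>r + (1 - \<theta>) v\<^sub>r\<close>.  Integrate it against a test function, put the operator on the
  test function on the left and on the mollifiers on the right, and let \<open>e \<rightarrow> 0\<close>
  (\<open>nonlocal_Kato\<close>).

  The drift part.  For \<open>\<theta> = (1 + sgn (u\<^sub>r - v\<^sub>r)) / 2\<close> one has \<open>\<nabla> max(u\<^sub>r, v\<^sub>r) = \<theta> \<nabla>u\<^sub>r + (1 - \<theta>) \<nabla>v\<^sub>r\<close>
  weakly (\<open>integration_by_parts_max\<close>).

  Conclusion.  Together these give the inequality for \<open>max(u\<^sub>r, v\<^sub>r)\<close> with right-hand side
  \<open>\<theta> f + (1 - \<theta>) g\<close> up to errors that vanish with \<open>r\<close> (\<open>mollified_Kato\<close>).  Along a sequence of radii,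
  \<open>\<theta>\<close> tends to \<open>1\<close> almost everywhere on \<open>{u > v}\<close> and to \<open>0\<close> on \<open>{u < v}\<close>, while on \<open>{u = v}\<close> the
  right-hand side is at most \<open>max f g\<close> whatever \<open>\<theta>\<close> is (\<open>subsolution_max\<close>).  All this is done for Borel
  functions; Lebesgue measurable data are replaced by Borel representatives at the end.
\<close>

section \<open>Partial derivatives and the classes \<open>C\<^sup>k\<close>\<close>

lemma partial_has_derivative:
  "(f has_derivative f') (at x) \<Longrightarrow> partial i f x = f' (axis i 1)"
  unfolding partial_def by (simp flip: frechet_derivative_at)

lemma linear_axis_expansion:
  fixes f :: "real ^ 'n::finite \<Rightarrow> 'b::real_vector"
  assumes "linear f"
  shows "f h = (\<Sum>i\<in>UNIV. h $ i *\<^sub>R f (axis i 1))"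
proof -
  have "f h = f (\<Sum>i\<in>UNIV. (h $ i) *s axis i 1)" by (simp add: basis_expansion)
  also have "\<dots> = (\<Sum>i\<in>UNIV. h $ i *\<^sub>R f (axis i 1))"
    using assms by (simp add: linear_sum linear_cmul scalar_mult_eq_scaleR)
  finally show ?thesis .
qed

lemma has_derivative_partial:
  fixes f :: "real ^ 'n::finite \<Rightarrow> 'b::real_normed_vector"
  assumes "f differentiable (at x)"
  shows "(f has_derivative (\<lambda>h. \<Sum>i\<in>UNIV. h $ i *\<^sub>R partial i f x)) (at x)"
proof -
  obtain f' where f': "(f has_derivative f') (at x)" using assms by (auto simp: differentiable_def)
  have "f' h = (\<Sum>i\<in>UNIV. h $ i *\<^sub>R partial i f x)" for h
    unfolding partial_has_derivative[OF f'] by (rule linear_axis_expansion[OF has_derivative_linear[OF f']])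
  then have "f' = (\<lambda>h. \<Sum>i\<in>UNIV. h $ i *\<^sub>R partial i f x)" by (rule ext)
  with f' show ?thesis by (rule back_subst)
qed

lemma partial_add:
  assumes "f differentiable (at x)" "g differentiable (at x)"
  shows "partial i (\<lambda>x. f x + g x) x = partial i f x + partial i g x"
proof -
  obtain f' g' where d: "(f has_derivative f') (at x)" "(g has_derivative g') (at x)"
    using assms by (auto simp: differentiable_def)
  show ?thesis
    using partial_has_derivative[OF has_derivative_add[OF d]] partial_has_derivative[OF d(1)]
      partial_has_derivative[OF d(2)] by simp
qed

lemma partial_mult:
  fixes f g :: "real ^ 'n::finite \<Rightarrow> real"
  assumes "f differentiable (at x)" "g differentiable (at x)"
  shows "partial i (\<lambda>x. f x * g x) x = partial i f x * g x + f x * partial i g x"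
proof -
  obtain f' g' where d: "(f has_derivative f') (at x)" "(g has_derivative g') (at x)"
    using assms by (auto simp: differentiable_def)
  show ?thesis
    using partial_has_derivative[OF has_derivative_mult[OF d]] partial_has_derivative[OF d(1)]
      partial_has_derivative[OF d(2)] by (simp add: algebra_simps)
qed

lemma partial_real_comp:
  fixes q :: "real ^ 'n::finite \<Rightarrow> real"
  assumes "q differentiable (at x)" "(h has_real_derivative h') (at (q x))"
  shows "partial i (\<lambda>x. h (q x)) x = h' * partial i q x"
proof -
  obtain q' where d: "(q has_derivative q') (at x)"
    using assms by (auto simp: differentiable_def)
  have "((\<lambda>x. h (q x)) has_derivative (\<lambda>v. h' * q' v)) (at x)"
    using diff_chain_at[OF d, of h "(*) h'"] assms(2) by (simp add: has_field_derivative_def o_def)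
  from partial_has_derivative[OF this] partial_has_derivative[OF d] show ?thesis by simp
qed

lemma differentiable_real_comp:
  fixes q :: "real ^ 'n::finite \<Rightarrow> real"
  assumes "q differentiable (at x)" "(h has_real_derivative h') (at (q x))"
  shows "(\<lambda>x. h (q x)) differentiable (at x)"
  using differentiable_chain_at[OF assms(1), of h] assms(2)
  by (auto simp: o_def has_field_derivative_def differentiable_def)

lemma partial_reflect:
  assumes "f differentiable (at (x - y))"
  shows "partial i (\<lambda>y. f (x - y)) y = - partial i f (x - y)"
    and "(\<lambda>y. f (x - y)) differentiable (at y)"
proof -
  obtain f' where d: "(f has_derivative f') (at (x - y))"
    using assms by (auto simp: differentiable_def)
  have "((\<lambda>y. x - y) has_derivative (\<lambda>v. - v)) (at y)" by (auto intro!: derivative_eq_intros)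
  from diff_chain_at[OF this d] have d2: "((\<lambda>y. f (x - y)) has_derivative (\<lambda>v. f' (- v))) (at y)"
    by (simp add: o_def)
  then show "(\<lambda>y. f (x - y)) differentiable (at y)" by (auto simp: differentiable_def)
  show "partial i (\<lambda>y. f (x - y)) y = - partial i f (x - y)"
    using partial_has_derivative[OF d2] partial_has_derivative[OF d]
      linear_neg[OF has_derivative_linear[OF d]] by simp
qed

lemma Ck_on_const: "Ck_on k UNIV (\<lambda>x::real ^ 'n::finite. c)"
proof (induction k arbitrary: c)
  case (Suc k)
  have "partial i (\<lambda>x::real ^ 'n. c) = (\<lambda>x. 0)" for i
    using partial_has_derivative[OF has_derivative_const] by (auto simp: fun_eq_iff)
  with Suc show ?case by simp
qed simp

lemma Ck_on_SucD: "Ck_on (Suc k) S f \<Longrightarrow> Ck_on k S f"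
proof (induction k arbitrary: f)
  case 0
  then show ?case
    by (auto intro!: continuous_at_imp_continuous_on differentiable_imp_continuous_within)
next
  case (Suc k)
  from Suc.prems have "Ck_on (Suc k) S (partial i f)" for i by simp
  from Suc.IH[OF this] Suc.prems show ?case by simp
qed

lemma Ck_on_add:
  assumes "Ck_on k UNIV f" "Ck_on k UNIV g"
  shows "Ck_on k UNIV (\<lambda>x. f x + g x)"
  using assms
proof (induction k arbitrary: f g)
  case 0
  then show ?case by (auto intro: continuous_on_add)
next
  case (Suc k)
  have "partial i (\<lambda>x. f x + g x) = (\<lambda>x. partial i f x + partial i g x)" for i
    using Suc.prems by (auto simp: fun_eq_iff partial_add)
  with Suc show ?case by (auto intro!: derivative_intros)
qed

lemma Ck_on_mult:
  fixes f g :: "real ^ 'n::finite \<Rightarrow> real"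
  assumes "Ck_on k UNIV f" "Ck_on k UNIV g"
  shows "Ck_on k UNIV (\<lambda>x. f x * g x)"
  using assms
proof (induction k arbitrary: f g)
  case 0
  then show ?case by (auto intro: continuous_on_mult)
next
  case (Suc k)
  have "partial i (\<lambda>x. f x * g x) = (\<lambda>x. partial i f x * g x + f x * partial i g x)" for i
    using Suc.prems by (auto simp: fun_eq_iff partial_mult)
  moreover have "Ck_on k UNIV (\<lambda>x. partial i f x * g x + f x * partial i g x)" for i
    using Suc.prems Suc.IH Ck_on_SucD by (intro Ck_on_add) (auto simp: Ck_on_SucD)
  ultimately show ?case using Suc.prems by (auto intro!: derivative_intros)
qed

section \<open>A family of mollifiers\<close>

text \<open>The factors \<open>t\<^sup>-\<^sup>m\<close> are those that differentiation of \<open>exp (- 1 / t)\<close> produces, so the family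
  is closed under differentiation up to linear combinations; this is what makes induction on the order
  of smoothness work.\<close>

definition bump_profile :: "nat \<Rightarrow> real \<Rightarrow> real"
  where "bump_profile m t = (if 0 < t then exp (- 1 / t) / t ^ m else 0)"

text \<open>The power series of \<open>exp (1 / t)\<close> dominates each of its terms.\<close>

lemma exp_reciprocal_bound:
  fixes t :: real
  assumes "0 < t"
  shows "exp (- 1 / t) / t ^ m \<le> fact (m + j) * t ^ j"
proof -
  have "(1 / t) ^ (m + j) / fact (m + j) \<le> exp (1 / t)"
  proof -
    have "(\<Sum>n\<in>{m + j}. (1 / t) ^ n /\<^sub>R fact n) \<le> exp (1 / t)"
      unfolding sums_unique[OF exp_converges] using assms
      by (intro sum_le_suminf sums_summable[OF exp_converges]) auto
    then show ?thesis by (simp add: divide_inverse mult.commute)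
  qed
  then have "(1 / t) ^ m * ((1 / t) ^ j / fact (m + j)) * exp (- 1 / t) \<le> 1"
    using assms by (simp add: exp_minus power_add divide_simps mult_ac)
  then show ?thesis using assms by (simp add: power_one_over divide_simps mult.commute)
qed

lemma bump_profile_bound: "0 \<le> bump_profile m t" "bump_profile m t \<le> fact (m + j) * \<bar>t\<bar> ^ j"
  using exp_reciprocal_bound[of t m j] by (auto simp: bump_profile_def)

text \<open>At \<open>0\<close> the function is \<open>O(t\<^sup>2)\<close>, by the bound above with \<open>j = 2\<close>.\<close>

lemma DERIV_bump_profile:
  "(bump_profile m has_real_derivative
     bump_profile (m + 2) t - real m * bump_profile (m + 1) t) (at t)"
proof -
  consider "t > 0" | "t < 0" | "t = 0" by linarith
  then show ?thesis
  proof cases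
    case 1
    have e: "((\<lambda>t. exp (- 1 / t)) has_real_derivative exp (- 1 / t) * (1 / t\<^sup>2)) (at t)"
      using 1 by (auto intro!: derivative_eq_intros simp: power2_eq_square)
    have "((\<lambda>t. exp (- 1 / t) / t ^ m) has_real_derivative
       (exp (- 1 / t) * (1 / t\<^sup>2) * t ^ m - exp (- 1 / t) * (real m * t ^ (m - 1))) / (t ^ m * t ^ m)) (at t)"
      using 1 by (intro DERIV_divide e DERIV_pow) auto
    also have "(exp (- 1 / t) * (1 / t\<^sup>2) * t ^ m - exp (- 1 / t) * (real m * t ^ (m - 1))) / (t ^ m * t ^ m)
      = bump_profile (m + 2) t - real m * bump_profile (m + 1) t"
      using 1 by (cases m) (simp_all add: bump_profile_def power2_eq_square power_add diff_divide_distrib)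
    finally have "((\<lambda>t. exp (- 1 / t) / t ^ m) has_real_derivative
       bump_profile (m + 2) t - real m * bump_profile (m + 1) t) (at t)" .
    then show ?thesis
      by (rule DERIV_cong_ev[THEN iffD1, rotated -1])
        (use 1 eventually_nhds_in_open[of "{0<..}" t] in \<open>auto elim!: eventually_mono simp: bump_profile_def\<close>)
  next
    case 2
    have "((\<lambda>t. 0) has_real_derivative
       bump_profile (m + 2) t - real m * bump_profile (m + 1) t) (at t)"
      using 2 by (auto simp: bump_profile_def)
    then show ?thesis
      by (rule DERIV_cong_ev[THEN iffD1, rotated -1])
        (use 2 eventually_nhds_in_open[of "{..<0}" t] in \<open>auto elim!: eventually_mono simp: bump_profile_def\<close>)
  next
    case 3
    have "((\<lambda>h. bump_profile m h / h) \<longlongrightarrow> 0) (at 0)"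
    proof (rule Lim_null_comparison)
      have "norm (bump_profile m h / h) \<le> fact (m + 2) * \<bar>h\<bar>" if "h \<noteq> 0" for h
      proof -
        have "bump_profile m h \<le> (fact (m + 2) * \<bar>h\<bar>) * \<bar>h\<bar>"
          using bump_profile_bound(2)[of m h 2] by (simp only: power2_eq_square mult.assoc)
        then show ?thesis
          using that bump_profile_bound(1)[of m h] by (simp only: real_norm_def abs_divide abs_of_nonneg divide_le_eq) simp
      qed
      then show "\<forall>\<^sub>F h in at 0. norm (bump_profile m h / h) \<le> fact (m + 2) * \<bar>h\<bar>"
        by (auto simp: eventually_at intro: exI[of _ 1])
      show "((\<lambda>h::real. fact (m + 2) * \<bar>h\<bar>) \<longlongrightarrow> 0) (at 0)"
        by (auto intro!: tendsto_eq_intros)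
    qed
    then show ?thesis using 3 by (simp add: DERIV_def bump_profile_def)
  qed
qed

definition bump :: "real \<Rightarrow> nat \<Rightarrow> real ^ 'n::finite \<Rightarrow> real"
  where "bump r m z = bump_profile m (1 - (z \<bullet> z) / r\<^sup>2)"

lemma quadratic_partial:
  fixes x y :: "real ^ 'n::finite"
  shows "((\<lambda>y. 1 - ((x - y) \<bullet> (x - y)) / r\<^sup>2) has_derivative
     (\<lambda>v. 2 * ((x - y) \<bullet> v) / r\<^sup>2)) (at y)"
    and "partial i (\<lambda>y. 1 - ((x - y) \<bullet> (x - y)) / r\<^sup>2) y = 2 * (x $ i - y $ i) / r\<^sup>2"
proof -
  show d: "((\<lambda>y. 1 - ((x - y) \<bullet> (x - y)) / r\<^sup>2) has_derivative
     (\<lambda>v. 2 * ((x - y) \<bullet> v) / r\<^sup>2)) (at y)"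
    by (auto intro!: derivative_eq_intros simp: inner_commute divide_inverse algebra_simps fun_eq_iff)
  show "partial i (\<lambda>y. 1 - ((x - y) \<bullet> (x - y)) / r\<^sup>2) y = 2 * (x $ i - y $ i) / r\<^sup>2"
    using partial_has_derivative[OF d] by (simp add: inner_axis)
qed

lemma Ck_on_linear:
  fixes x :: "real ^ 'n::finite"
  shows "Ck_on k UNIV (\<lambda>y. a * (x $ i - y $ i))"
proof (cases k)
  case 0
  then show ?thesis by (auto intro!: continuous_intros)
next
  case (Suc k')
  have d: "((\<lambda>y. a * (x $ i - y $ i)) has_derivative (\<lambda>v. - a * v $ i)) (at y)" for y
    using bounded_linear.has_derivative[OF bounded_linear_vec_nth has_derivative_ident]
    by (auto intro!: derivative_eq_intros simp: algebra_simps)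
  have "partial j (\<lambda>y. a * (x $ i - y $ i)) = (\<lambda>y. - a * axis j 1 $ i)" for j
    using partial_has_derivative[OF d] by (auto simp: fun_eq_iff)
  moreover have "\<forall>y. (\<lambda>y. a * (x $ i - y $ i)) differentiable (at y)"
    using d by (auto simp: differentiable_def)
  ultimately show ?thesis unfolding Suc by (simp only: Ck_on.simps Ck_on_const) simp
qed

lemma Ck_on_bump:
  fixes x :: "real ^ 'n::finite"
  shows "Ck_on k UNIV (\<lambda>y. bump r m (x - y))"
proof (induction k arbitrary: m)
  case 0
  have "continuous_on UNIV (bump_profile m)"
    using DERIV_bump_profile by (meson DERIV_isCont continuous_at_imp_continuous_on)
  then have "continuous_on UNIV (\<lambda>y. bump_profile m (1 - ((x - y) \<bullet> (x - y)) / r\<^sup>2))"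
    by (rule continuous_on_compose2) (auto simp: divide_inverse intro!: continuous_intros)
  then show ?case by (simp add: bump_def)
next
  case (Suc k)
  let ?q = "\<lambda>y. 1 - ((x - y) \<bullet> (x - y)) / r\<^sup>2"
  have q: "?q differentiable (at y)" for y
    using quadratic_partial(1) by (auto simp: differentiable_def)
  have p: "partial i (\<lambda>y. bump r m (x - y)) =
      (\<lambda>y. (bump r (m + 2) (x - y) + (- real m) * bump r (m + 1) (x - y)) * (2 / r\<^sup>2 * (x $ i - y $ i)))" for i
    unfolding bump_def
    by (rule ext, subst partial_real_comp[OF q DERIV_bump_profile]) (simp add: quadratic_partial(2))
  have "Ck_on k UNIV (partial i (\<lambda>y. bump r m (x - y)))" for i
    unfolding p by (intro Ck_on_mult Ck_on_add Ck_on_linear Ck_on_const Suc.IH)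
  moreover have "(\<lambda>y. bump r m (x - y)) differentiable (at y)" for y
    unfolding bump_def by (rule differentiable_real_comp[OF q DERIV_bump_profile])
  ultimately show ?case by simp
qed

definition mollifier :: "real \<Rightarrow> real ^ 'n::finite \<Rightarrow> real"
  where "mollifier r z = bump r 0 z / integral\<^sup>L lborel (bump r 0 :: real ^ 'n \<Rightarrow> real)"

lemma bump_eq_0:
  assumes "0 < r" "r \<le> norm z" shows "bump r m z = 0"
proof -
  have "r\<^sup>2 \<le> z \<bullet> z" using assms power_mono[of r "norm z" 2] by (simp add: dot_square_norm)
  then show ?thesis using assms(1) by (simp add: bump_def bump_profile_def divide_simps)
qed

lemma continuous_bump: "continuous_on UNIV (bump r m :: real ^ 'n::finite \<Rightarrow> real)"
proof -
  have "continuous_on UNIV (\<lambda>y :: real ^ 'n. bump r m (0 - (0 - y)))"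
    by (rule continuous_on_compose2[of UNIV "\<lambda>y. bump r m (0 - y)"])
      (use Ck_on_bump[of 0 r m 0] in \<open>auto intro!: continuous_intros\<close>)
  then show ?thesis by simp
qed

lemma borel_measurable_bump [measurable]: "bump r m \<in> borel_measurable borel"
  by (rule borel_measurable_continuous_onI[OF continuous_bump])

lemma bump_0_bounds: "0 \<le> bump r 0 z" "bump r 0 z \<le> 1"
  using bump_profile_bound(1)[of 0 "1 - (z \<bullet> z) / r\<^sup>2"] bump_profile_bound(2)[of 0 "1 - (z \<bullet> z) / r\<^sup>2" 0]
  by (simp_all add: bump_def)

lemma integrable_bounded_support:
  fixes f :: "'a::euclidean_space \<Rightarrow> real"
  assumes "f \<in> borel_measurable borel" "\<And>x. \<bar>f x\<bar> \<le> B" "\<And>x. R < norm x \<Longrightarrow> f x = 0"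
  shows "integrable lborel f"
proof (rule Bochner_Integration.integrable_bound)
  show "integrable lborel (\<lambda>x. B * indicator (cball 0 R) x :: real)"
    using emeasure_lborel_cball_finite[of 0 R] by (intro integrable_mult_right integrable_real_indicator) auto
  show "AE x in lborel. norm (f x) \<le> norm (B * indicator (cball 0 R) x :: real)"
    using assms(2,3) by (auto simp: indicator_def intro: order_trans[OF _ abs_ge_self] simp: not_le)
qed (use assms in simp)

lemma integrable_bump:
  assumes "0 < r" shows "integrable lborel (bump r 0 :: real ^ 'n::finite \<Rightarrow> real)"
proof (rule integrable_bounded_support[where B = 1 and R = r])
  show "\<bar>bump r 0 x\<bar> \<le> 1" for x :: "real ^ 'n" using bump_0_bounds[of r x] by auto
qed (auto intro!: bump_eq_0[OF assms])

text \<open>The bump is bounded below on the ball of half the radius.  This bound on the mass, of the order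
  \<open>r\<^sup>n\<close> of the volume, replaces the change of variables that would compute it.\<close>

lemma integral_bump_lower_bound:
  assumes "0 < r"
  shows "exp (- 4 / 3) * unit_ball_vol (real CARD('n)) * (r / 2) ^ CARD('n)
    \<le> integral\<^sup>L lborel (bump r 0 :: real ^ 'n::finite \<Rightarrow> real)"
proof -
  have "exp (- 4 / 3) * unit_ball_vol (real CARD('n)) * (r / 2) ^ CARD('n)
      = (\<integral>z. exp (- 4 / 3) * indicator (cball (0 :: real ^ 'n) (r / 2)) z \<partial>lborel)"
    using assms content_cball[of "r / 2" "0 :: real ^ 'n"] by (simp add: emeasure_lborel_cball_finite)
  also have "\<dots> \<le> integral\<^sup>L lborel (bump r 0 :: real ^ 'n \<Rightarrow> real)"
  proof (rule integral_mono)
    show "integrable lborel (\<lambda>x. exp (- 4 / 3) * indicator (cball (0 :: real ^ 'n) (r / 2)) x :: real)"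
      using emeasure_lborel_cball_finite[of 0 "r / 2"] by (intro integrable_mult_right integrable_real_indicator) auto
    show "exp (- 4 / 3) * indicator (cball 0 (r / 2)) z \<le> bump r 0 z" for z :: "real ^ 'n"
    proof (cases "norm z \<le> r / 2")
      case True
      let ?t = "1 - (z \<bullet> z) / r\<^sup>2"
      have "(norm z)\<^sup>2 \<le> (r / 2)\<^sup>2" using True by (intro power_mono) auto
      then have "3 / 4 \<le> ?t" using assms by (simp add: dot_square_norm field_simps)
      then have "1 / ?t \<le> 1 / (3 / 4)" by (intro divide_left_mono) auto
      then have "exp (- (4 / 3)) \<le> exp (- 1 / ?t)" by simp
      moreover have "0 < ?t" using \<open>3 / 4 \<le> ?t\<close> by linarith
      ultimately show ?thesis using True unfolding bump_def bump_profile_def by simp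
    next
      case False
      then show ?thesis using bump_0_bounds(1)[of r z] by simp
    qed
  qed (rule integrable_bump[OF assms])
  finally show ?thesis .
qed

lemma partial_bump:
  fixes z :: "real ^ 'n::finite"
  shows "partial i (bump r 0) z = - 2 * z $ i / r\<^sup>2 * bump r 2 z"
    and "bump r 0 differentiable (at z)"
proof -
  have d: "((\<lambda>y::real^'n. bump r 0 y) has_derivative (\<lambda>v. bump r 2 z * (- 2 * (z \<bullet> v) / r\<^sup>2))) (at z)"
  proof -
    have q: "((\<lambda>y. 1 - (y \<bullet> y) / r\<^sup>2) has_derivative (\<lambda>v. - 2 * (z \<bullet> v) / r\<^sup>2)) (at z)"
      by (auto intro!: derivative_eq_intros simp: inner_commute divide_inverse algebra_simps fun_eq_iff)
    show ?thesis
      using diff_chain_at[OF q, of "bump_profile 0" "(*) (bump r 2 z)"] DERIV_bump_profile[of 0 "1 - (z \<bullet> z) / r\<^sup>2"]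
      by (simp add: has_field_derivative_def o_def bump_def numeral_2_eq_2)
  qed
  show "partial i (bump r 0) z = - 2 * z $ i / r\<^sup>2 * bump r 2 z"
    using partial_has_derivative[OF d] by (simp add: inner_axis)
  show "bump r 0 differentiable (at z)" using d by (auto simp: differentiable_def)
qed

context
  fixes r :: real assumes r: "0 < r"
begin

lemma integral_bump_pos: "0 < integral\<^sup>L lborel (bump r 0 :: real ^ 'n::finite \<Rightarrow> real)"
  by (rule less_le_trans[OF _ integral_bump_lower_bound[OF r]]) (use r in simp)

lemma mollifier_nonneg: "0 \<le> mollifier r z"
  using integral_bump_pos bump_0_bounds(1) by (auto simp: mollifier_def intro!: divide_nonneg_pos)

lemma mollifier_eq_0: "r \<le> norm z \<Longrightarrow> mollifier r z = 0"
  by (simp add: mollifier_def bump_eq_0[OF r])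

lemma integral_mollifier: "integral\<^sup>L lborel (mollifier r :: real ^ 'n::finite \<Rightarrow> real) = 1"
  using integral_bump_pos[where 'n = 'n] by (simp add: mollifier_def[abs_def])

lemma Ck_on_mollifier: "Ck_on k UNIV (\<lambda>y. mollifier r (x - y))"
  using Ck_on_mult[OF Ck_on_bump[of k r 0 x] Ck_on_const[of k "1 / integral\<^sup>L lborel (bump r 0 :: real ^ 'n \<Rightarrow> real)"]]
  by (simp add: mollifier_def)

lemma differentiable_mollifier: "mollifier r differentiable (at z)"
  unfolding mollifier_def[abs_def] divide_inverse by (intro differentiable_mult partial_bump) simp

lemma partial_mollifier:
  fixes z :: "real ^ 'n::finite"
  shows "partial i (mollifier r) z
    = - 2 * z $ i / r\<^sup>2 * bump r 2 z / integral\<^sup>L lborel (bump r 0 :: real ^ 'n \<Rightarrow> real)"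
proof -
  let ?c = "inverse (integral\<^sup>L lborel (bump r 0 :: real ^ 'n \<Rightarrow> real))"
  have "partial i (\<lambda>z :: real ^ 'n. ?c) z = 0"
    by (rule partial_has_derivative[OF has_derivative_const, THEN trans]) simp
  then show ?thesis
    using partial_mult[OF partial_bump(2)[of r z] differentiable_const[of ?c], of i]
    by (simp add: mollifier_def[abs_def] divide_inverse partial_bump(1))
qed

lemma test_function_mollifier:
  assumes "cball x r \<subseteq> \<Omega>"
  shows "(\<lambda>y. mollifier r (x - y)) \<in> test_functions \<Omega>"
proof -
  have "mollifier r (x - y) \<noteq> 0 \<Longrightarrow> y \<in> cball x r" for y
    using mollifier_eq_0[of "x - y"] by (force simp: dist_norm)
  then have *: "closure {y. mollifier r (x - y) \<noteq> 0} \<subseteq> cball x r"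
    by (intro closure_minimal) auto
  then have "compact (closure {y. mollifier r (x - y) \<noteq> 0})"
    by (meson bounded_cball bounded_subset closed_closure compact_eq_bounded_closed)
  with * assms show ?thesis by (auto simp: test_functions_def Ck_on_mollifier)
qed

end

text \<open>The powers of \<open>r\<close> are those of a scaled unit mollifier; what matters is that \<open>C\<close> does not depend on
  \<open>r\<close>.\<close>

lemma mollifier_bounds:
  obtains C where "0 < C"
    "\<And>r z. 0 < r \<Longrightarrow> mollifier r (z :: real ^ 'n::finite) \<le> C / r ^ CARD('n)"
    "\<And>r z i. 0 < r \<Longrightarrow> \<bar>partial i (mollifier r) (z :: real ^ 'n)\<bar> \<le> C / r ^ (CARD('n) + 1)"
proof -
  let ?c = "exp (- 4 / 3) * unit_ball_vol (real CARD('n)) / 2 ^ CARD('n)"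
  let ?N = "\<lambda>r. integral\<^sup>L lborel (bump r 0 :: real ^ 'n::finite \<Rightarrow> real)"
  have c: "0 < ?c" by simp
  have N: "?c * r ^ CARD('n) \<le> ?N r" if "0 < r" for r
    using integral_bump_lower_bound[OF that, where 'n = 'n] by (simp add: power_divide)
  have inv: "1 / ?N r \<le> 1 / (?c * r ^ CARD('n))" if "0 < r" for r
    using N[OF that] c that integral_bump_pos[OF that, where 'n = 'n]
    by (intro divide_left_mono mult_pos_pos) auto
  show ?thesis
  proof (rule that[of "4 / ?c"])
    show "0 < 4 / ?c" by simp
    fix r :: real and z :: "real ^ 'n" and i :: 'n
    assume r: "0 < r"
    have p: "0 < ?N r" using integral_bump_pos[OF r] .
    have "mollifier r z \<le> 1 / ?N r"
      using bump_0_bounds[of r z] p by (auto simp: mollifier_def intro!: divide_right_mono)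
    also have "\<dots> \<le> 1 / (?c * r ^ CARD('n))" by (rule inv[OF r])
    also have "\<dots> \<le> 4 / (?c * r ^ CARD('n))" using r by (intro divide_right_mono) auto
    also have "\<dots> = 4 / ?c / r ^ CARD('n)" by (simp only: divide_divide_eq_left)
    finally show "mollifier r z \<le> 4 / ?c / r ^ CARD('n)" .
    have "\<bar>2 * z $ i / r\<^sup>2 * bump r 2 z\<bar> \<le> 4 / r"
    proof (cases "norm z < r")
      case True
      have b: "0 \<le> bump r 2 z" "bump r 2 z \<le> 2"
        using bump_profile_bound(1)[of 2 "1 - (z \<bullet> z) / r\<^sup>2"] bump_profile_bound(2)[of 2 "1 - (z \<bullet> z) / r\<^sup>2" 0] by (simp_all add: bump_def)
      have "\<bar>z $ i\<bar> \<le> r" using component_le_norm_cart[of z i] True by linarith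
      then have "\<bar>z $ i\<bar> * bump r 2 z \<le> r * 2" using b r by (intro mult_mono) auto
      then show ?thesis using r b by (simp add: abs_mult field_simps power2_eq_square)
    next
      case False
      then have "bump r 2 z = 0" by (intro bump_eq_0[OF r]) simp
      then show ?thesis using r by simp
    qed
    then have "\<bar>partial i (mollifier r) z\<bar> \<le> 4 / r / ?N r"
      unfolding partial_mollifier[OF r] using divide_right_mono[OF _ less_imp_le[OF p], of "\<bar>2 * z $ i / r\<^sup>2 * bump r 2 z\<bar>" "4 / r"] p
      by (simp add: abs_mult)
    also have "\<dots> = (4 / r) * (1 / ?N r)" by simp
    also have "\<dots> \<le> (4 / r) * (1 / (?c * r ^ CARD('n)))"
      using inv[OF r] r by (intro mult_left_mono) auto
    also have "\<dots> = 4 / ?c / r ^ (CARD('n) + 1)" using r by simp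
    finally show "\<bar>partial i (mollifier r) z\<bar> \<le> 4 / ?c / r ^ (CARD('n) + 1)" .
  qed
qed

section \<open>Bounds from derivatives\<close>

lemma bounded_partials_Lipschitz:
  fixes f :: "real ^ 'n::finite \<Rightarrow> 'b::real_normed_vector"
  assumes "convex S" "\<And>x. x \<in> S \<Longrightarrow> f differentiable (at x)"
    and "\<And>x i. x \<in> S \<Longrightarrow> norm (partial i f x) \<le> B" and "x \<in> S" "y \<in> S"
  shows "norm (f x - f y) \<le> real CARD('n) * B * norm (x - y)"
proof (rule differentiable_bound[OF assms(1) _ _ assms(4,5)])
  fix x assume x: "x \<in> S"
  let ?f' = "\<lambda>h. \<Sum>i\<in>UNIV. h $ i *\<^sub>R partial i f x"
  show "(f has_derivative ?f') (at x within S)"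
    using has_derivative_partial[OF assms(2)[OF x]] by (rule has_derivative_at_withinI)
  show "onorm ?f' \<le> real CARD('n) * B"
  proof (rule onorm_bound)
    have "0 \<le> B" using assms(3)[OF x] norm_ge_zero order_trans by blast
    then show "0 \<le> real CARD('n) * B" by simp
    fix h
    have "norm (?f' h) \<le> (\<Sum>i\<in>(UNIV :: 'n set). norm h * B)"
      by (intro order_trans[OF norm_sum] sum_mono) (auto intro!: mult_mono component_le_norm_cart assms(3)[OF x])
    then show "norm (?f' h) \<le> real CARD('n) * B * norm h" by (simp add: mult_ac)
  qed
qed

lemma Ck_on_2_continuous: "Ck_on 2 UNIV f \<Longrightarrow> continuous_on UNIV f"
  by (auto intro!: continuous_at_imp_continuous_on differentiable_imp_continuous_within simp: numeral_2_eq_2)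

lemma continuous_compact_support_bounded:
  fixes f :: "'a::euclidean_space \<Rightarrow> 'b::real_normed_vector"
  assumes "continuous_on UNIV f" "\<And>x. R < norm x \<Longrightarrow> f x = 0"
  obtains B where "0 < B" "\<And>x. norm (f x) \<le> B"
proof -
  have "compact (f ` cball 0 R)"
    using assms(1) by (intro compact_continuous_image) (auto intro: continuous_on_subset)
  then obtain B where B: "0 < B" "\<And>y. y \<in> f ` cball 0 R \<Longrightarrow> norm y \<le> B"
    by (metis bounded_pos compact_imp_bounded)
  have "norm (f x) \<le> B" for x
    using B(2)[of "f x"] B(1) assms(2)[of x] by (cases "norm x \<le> R") (auto simp: not_le)
  with B(1) that show thesis by blast
qed

lemma partial_eq_0_open:
  assumes "open S" "x \<in> S" "\<And>y. y \<in> S \<Longrightarrow> f y = 0"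
  shows "partial i f x = 0" and "f differentiable (at x)"
proof -
  have "((\<lambda>_. 0) has_derivative (\<lambda>_. 0)) (at x)" by simp
  then have d: "(f has_derivative (\<lambda>_. 0)) (at x)"
    by (rule has_derivative_transform_within_open[OF _ assms(1,2)]) (use assms(3) in auto)
  show "partial i f x = 0" using partial_has_derivative[OF d] .
  show "f differentiable (at x)" using d by (auto simp: differentiable_def)
qed

lemma partial_eq_0_outside:
  assumes "\<And>x. R < norm x \<Longrightarrow> f x = 0" "R < norm x"
  shows "partial i f x = 0"
proof (rule partial_eq_0_open(1))
  show "open {x. R < norm x}" by (intro open_Collect_less continuous_intros)
qed (use assms in auto)

text \<open>The second-order remainder serves twice: it makes the symmetrized difference quotients of a test
  function integrable at the singularity of the kernel, and it differentiates mollifications.\<close>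

lemma Taylor_quadratic_bound:
  fixes \<phi> :: "real ^ 'n::finite \<Rightarrow> real"
  assumes C2: "Ck_on 2 UNIV \<phi>" and supp: "\<And>x. R < norm x \<Longrightarrow> \<phi> x = 0"
  obtains C where "0 < C"
    "\<And>x y i. \<bar>partial i \<phi> x - partial i \<phi> y\<bar> \<le> C * norm (x - y)"
    "\<And>x h. \<bar>\<phi> (x + h) - \<phi> x - (\<Sum>i\<in>UNIV. h $ i * partial i \<phi> x)\<bar> \<le> C * (norm h)\<^sup>2"
proof -
  have C2': "\<phi> differentiable (at x)" "partial i \<phi> differentiable (at x)"
    "continuous_on UNIV (partial j (partial i \<phi>))" for i j x
    using C2 by (simp_all add: numeral_2_eq_2)
  have "\<exists>B>0. \<forall>x. \<bar>partial j (partial i \<phi>) x\<bar> \<le> B" for i j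
  proof -
    have "partial j (partial i \<phi>) x = 0" if "R < norm x" for x
      by (intro partial_eq_0_outside[of R]) (use supp that in auto)
    then obtain B where "0 < B" "\<And>x. norm (partial j (partial i \<phi>) x) \<le> B"
      using continuous_compact_support_bounded[OF C2'(3)] by blast
    then show ?thesis by auto
  qed
  then have "\<exists>B'. \<forall>i j. 0 < B' i j \<and> (\<forall>x. \<bar>partial j (partial i \<phi>) x\<bar> \<le> B' i j)"
    by (intro choice allI) blast
  then obtain B' where B': "\<And>i j. 0 < B' i j" "\<And>i j x. \<bar>partial j (partial i \<phi>) x\<bar> \<le> B' i j"
    by blast
  define B where "B = (\<Sum>i\<in>UNIV. \<Sum>j\<in>UNIV. B' i j)"
  have B: "\<bar>partial j (partial i \<phi>) x\<bar> \<le> B" for i j x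
  proof -
    have "B' i j \<le> (\<Sum>j\<in>UNIV. B' i j)" using B'(1) by (intro member_le_sum) (auto intro: less_imp_le)
    also have "\<dots> \<le> B" unfolding B_def
      using less_imp_le[OF B'(1)] by (intro member_le_sum[of i UNIV "\<lambda>i. \<Sum>j\<in>UNIV. B' i j"]) (auto intro!: sum_nonneg)
    finally show ?thesis using B'(2)[of j i x] by linarith
  qed
  have "0 < (\<Sum>j\<in>UNIV. B' i j)" for i by (rule sum_pos) (use B'(1) in auto)
  then have "0 < B" unfolding B_def using B'(1) by (intro sum_pos) auto
  let ?d = "real CARD('n)"
  define C where "C = ?d * B + ?d * (?d * B)"
  have lip: "\<bar>partial i \<phi> x - partial i \<phi> y\<bar> \<le> ?d * B * norm (x - y)" for i x y
    using bounded_partials_Lipschitz[of UNIV "partial i \<phi>" B x y] C2'(2) B by simp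
  have "\<bar>\<phi> (x + h) - \<phi> x - (\<Sum>i\<in>UNIV. h $ i * partial i \<phi> x)\<bar> \<le> ?d * (?d * B) * (norm h)\<^sup>2" for x h
  proof -
    \<comment> \<open>the mean value inequality for \<open>\<phi>\<close> minus its linear part, on the ball of radius \<open>|h|\<close>\<close>
    let ?g = "\<lambda>y. \<phi> y - (\<Sum>i\<in>UNIV. y $ i * partial i \<phi> x)"
    have d: "(?g has_derivative (\<lambda>v. (\<Sum>i\<in>UNIV. v $ i * partial i \<phi> y) - (\<Sum>i\<in>UNIV. v $ i * partial i \<phi> x))) (at y)" for y
      using has_derivative_partial[OF C2'(1), of y]
        bounded_linear.has_derivative[OF bounded_linear_vec_nth has_derivative_ident]
      by (auto intro!: derivative_eq_intros)
    have p: "partial i ?g y = partial i \<phi> y - partial i \<phi> x" for i y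
      using partial_has_derivative[OF d] by (simp add: axis_def if_distrib[of "\<lambda>a. a * _"] cong: if_cong)
    have "norm (?g (x + h) - ?g x) \<le> ?d * (?d * B * norm h) * norm ((x + h) - x)"
    proof (rule bounded_partials_Lipschitz[of "cball x (norm h)"])
      fix y i assume "y \<in> cball x (norm h)"
      then have "?d * B * norm (y - x) \<le> ?d * B * norm h"
        using \<open>0 < B\<close> by (intro mult_left_mono) (auto simp: dist_norm norm_minus_commute)
      then show "norm (partial i ?g y) \<le> ?d * B * norm h" using order_trans[OF lip[of i y x]] by (simp add: p)
    qed (use d in \<open>auto simp: differentiable_def dist_norm\<close>)
    moreover have "?g (x + h) - ?g x = \<phi> (x + h) - \<phi> x - (\<Sum>i\<in>UNIV. h $ i * partial i \<phi> x)"
      by (simp add: algebra_simps sum.distrib)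
    ultimately show ?thesis by (simp add: power2_eq_square mult_ac)
  qed
  note T = this
  show thesis
  proof (rule that[of C])
    show "0 < C" using \<open>0 < B\<close> by (simp add: C_def add_pos_pos)
    show "\<bar>partial i \<phi> x - partial i \<phi> y\<bar> \<le> C * norm (x - y)" for x y i
      by (rule order_trans[OF lip]) (use \<open>0 < B\<close> in \<open>auto simp: C_def intro!: mult_right_mono\<close>)
    show "\<bar>\<phi> (x + h) - \<phi> x - (\<Sum>i\<in>UNIV. h $ i * partial i \<phi> x)\<bar> \<le> C * (norm h)\<^sup>2" for x h
      by (rule order_trans[OF T]) (use \<open>0 < B\<close> in \<open>auto simp: C_def intro!: mult_right_mono\<close>)
  qed
qed

section \<open>Translations and reflections\<close>

lemma lborel_distr_isometry:
  fixes t :: "'a::euclidean_space"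
  assumes "c = 1 \<or> c = - 1"
  shows "distr lborel borel (\<lambda>x. t + c *\<^sub>R x) = lborel"
proof -
  have "c \<noteq> 0" "\<bar>c\<bar> = 1" using assms by auto
  then show ?thesis using lborel_affine[of c t] by (simp add: density_1)
qed

lemma
  fixes f :: "'a::euclidean_space \<Rightarrow> real"
  assumes f: "f \<in> borel_measurable borel"
  shows integral_translate: "(\<integral>x. f (t + x) \<partial>lborel) = integral\<^sup>L lborel f"
    and integral_reflect: "(\<integral>x. f (t - x) \<partial>lborel) = integral\<^sup>L lborel f"
    and integrable_translate: "integrable lborel (\<lambda>x. f (t + x)) \<longleftrightarrow> integrable lborel f"
    and integrable_reflect: "integrable lborel (\<lambda>x. f (t - x)) \<longleftrightarrow> integrable lborel f"
proof -
  have *: "(\<lambda>x. t + c *\<^sub>R x) \<in> lborel \<rightarrow>\<^sub>M borel" for c by simp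
  note 1 = lborel_distr_isometry[of 1 t] and 2 = lborel_distr_isometry[of "- 1" t]
  show "(\<integral>x. f (t + x) \<partial>lborel) = integral\<^sup>L lborel f"
    using integral_distr[OF * f, of 1] 1 by simp
  show "(\<integral>x. f (t - x) \<partial>lborel) = integral\<^sup>L lborel f"
    using integral_distr[OF * f, of "- 1"] 2 by simp
  show "integrable lborel (\<lambda>x. f (t + x)) \<longleftrightarrow> integrable lborel f"
    using integrable_distr_eq[OF * f, of 1] 1 by simp
  show "integrable lborel (\<lambda>x. f (t - x)) \<longleftrightarrow> integrable lborel f"
    using integrable_distr_eq[OF * f, of "- 1"] 2 by simp
qed

section \<open>Integrability of powers of the norm\<close>

text \<open>Comparison with multiples of indicators of balls, summed over dyadic radii, replaces polar
  coordinates.\<close>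

lemma integrable_dyadic:
  fixes g :: "'a::euclidean_space \<Rightarrow> real"
  assumes g: "g \<in> borel_measurable borel" and nn: "\<And>k. 0 \<le> m k" "\<And>k. 0 \<le> r k"
    and sm: "summable (\<lambda>k. m k * r k ^ DIM('a))"
    and cover: "\<And>h. g h \<noteq> 0 \<Longrightarrow> \<exists>k::nat. norm h \<le> r k \<and> \<bar>g h\<bar> \<le> m k"
  shows "integrable lborel g"
proof (rule integrableI_bounded)
  let ?w = "unit_ball_vol (real DIM('a))"
  have "(\<integral>\<^sup>+ h. ennreal (norm (g h)) \<partial>lborel)
      \<le> (\<integral>\<^sup>+ h. (\<Sum>k. ennreal (m k) * indicator (cball (0::'a) (r k)) h) \<partial>lborel)"
  proof (rule nn_integral_mono)
    fix h
    show "ennreal (norm (g h)) \<le> (\<Sum>k. ennreal (m k) * indicator (cball 0 (r k)) h)"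
    proof (cases "g h = 0")
      case False
      then obtain k where k: "norm h \<le> r k" "\<bar>g h\<bar> \<le> m k" using cover by blast
      have "ennreal (norm (g h)) \<le> (\<Sum>k\<in>{k}. ennreal (m k) * indicator (cball 0 (r k)) h)"
        using k by (simp add: ennreal_leI)
      also have "\<dots> \<le> (\<Sum>k. ennreal (m k) * indicator (cball 0 (r k)) h)"
        by (rule sum_le_suminf) auto
      finally show ?thesis .
    qed simp
  qed
  also have "\<dots> = (\<Sum>k. \<integral>\<^sup>+ h. ennreal (m k) * indicator (cball (0::'a) (r k)) h \<partial>lborel)"
    by (rule nn_integral_suminf)
      (auto intro!: borel_measurable_times_ennreal borel_measurable_indicator borel_closed)
  also have "\<dots> = (\<Sum>k. ennreal (?w * (m k * r k ^ DIM('a))))"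
    using nn by (simp add: nn_integral_cmult_indicator emeasure_cball ennreal_mult' [symmetric] mult_ac)
  also have "\<dots> = ennreal (\<Sum>k. ?w * (m k * r k ^ DIM('a)))"
    using nn by (intro suminf_ennreal2 summable_mult sm) auto
  finally show "(\<integral>\<^sup>+ h. ennreal (norm (g h)) \<partial>lborel) < \<infinity>"
    by (rule le_less_trans) simp
qed (use g in simp)

lemma dyadic_interval_above:
  fixes t e :: real assumes "0 < e" "e < t"
  obtains k :: nat where "2 ^ k * e < t" "t \<le> 2 ^ Suc k * e"
proof -
  obtain n where n: "t / e < 2 ^ n" using real_arch_pow[of 2 "t / e"] by auto
  define k where "k = (LEAST k. t \<le> 2 ^ Suc k * e)"
  have ex: "t \<le> 2 ^ Suc n * e"
  proof -
    have "t \<le> 2 ^ n * e" using n assms by (simp add: divide_less_eq)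
    also have "\<dots> \<le> 2 ^ Suc n * e" using assms by simp
    finally show ?thesis .
  qed
  have k: "t \<le> 2 ^ Suc k * e" unfolding k_def by (rule LeastI[of "\<lambda>k. t \<le> 2 ^ Suc k * e", OF ex])
  have "2 ^ k * e < t"
  proof (cases k)
    case (Suc j)
    then have "\<not> t \<le> 2 ^ Suc j * e" using not_less_Least[of j "\<lambda>k. t \<le> 2 ^ Suc k * e"] by (simp add: k_def)
    then show ?thesis using Suc by simp
  qed (use assms in simp)
  with k that show thesis by blast
qed

lemma dyadic_interval_below:
  fixes t :: real assumes "0 < t" "t \<le> 1"
  obtains k :: nat where "(1 / 2) ^ Suc k < t" "t \<le> (1 / 2) ^ k"
proof -
  obtain n where n: "(1 / 2) ^ n < t" using real_arch_pow_inv[of t "1 / 2"] assms by auto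
  define k where "k = (LEAST k. (1 / 2) ^ Suc k < t)"
  have "(1 / 2 :: real) ^ Suc n = (1 / 2) ^ n / 2" by simp
  then have ex: "(1 / 2) ^ Suc n < t" using n zero_less_power[of "1 / 2 :: real" n] by linarith
  have k: "(1 / 2) ^ Suc k < t" unfolding k_def by (rule LeastI[of "\<lambda>k. (1 / 2) ^ Suc k < t", OF ex])
  have "t \<le> (1 / 2) ^ k"
  proof (cases k)
    case (Suc j)
    then have "\<not> (1 / 2) ^ Suc j < t" using not_less_Least[of j "\<lambda>k. (1 / 2) ^ Suc k < t"] by (simp add: k_def)
    then show ?thesis using Suc by simp
  qed (use assms in simp)
  with k that show thesis by blast
qed

lemma integrable_norm_powr_outside:
  assumes "0 < e" "real DIM('a::euclidean_space) < p"
  shows "integrable lborel (\<lambda>h :: 'a. indicator {h. e < norm h} h / norm h powr p)"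
proof (rule integrable_dyadic[where m = "\<lambda>k. 1 / (2 ^ k * e) powr p" and r = "\<lambda>k. 2 ^ Suc k * e"])
  let ?d = "real DIM('a)"
  have eq: "1 / (2 ^ k * e) powr p * (2 ^ Suc k * e) ^ DIM('a)
      = (2 * e) powr ?d / e powr p * (2 powr (?d - p)) ^ k" for k
    using assms
    by (simp add: powr_realpow[symmetric] powr_mult powr_powr powr_diff field_simps powr_add[symmetric])
  have "2 powr (?d - p) < 2 powr 0" using assms by (intro powr_less_mono) auto
  then have "2 powr (?d - p) < 1" by simp
  then show "summable (\<lambda>k. 1 / (2 ^ k * e) powr p * (2 ^ Suc k * e) ^ DIM('a))"
    unfolding eq by (intro summable_mult summable_geometric) simp
  fix h :: 'a assume "indicator {h. e < norm h} h / norm h powr p \<noteq> 0"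
  then have h: "e < norm h" by (auto simp: indicator_def split: if_splits)
  then obtain k where k: "2 ^ k * e < norm h" "norm h \<le> 2 ^ Suc k * e"
    using dyadic_interval_above assms by metis
  have "1 / norm h powr p \<le> 1 / (2 ^ k * e) powr p"
    using k assms h by (intro divide_left_mono powr_mono2 mult_pos_pos) auto
  with k h show "\<exists>k. norm h \<le> 2 ^ Suc k * e \<and>
      \<bar>indicator {h. e < norm h} h / norm h powr p\<bar> \<le> 1 / (2 ^ k * e) powr p" by auto
qed (use assms in auto)

lemma integrable_norm_powr_inside:
  assumes "0 \<le> p" "p < real DIM('a::euclidean_space) + 2"
  shows "integrable lborel (\<lambda>h :: 'a. indicator (cball 0 1) h * (norm h)\<^sup>2 / norm h powr p)"
proof (rule integrable_dyadic[where m = "\<lambda>k. ((1 / 2) ^ k)\<^sup>2 / ((1 / 2) ^ Suc k) powr p" and r = "\<lambda>k. (1 / 2) ^ k"])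
  let ?d = "real DIM('a)"
  have half: "(1 / 2) ^ j = 2 powr (- real j)" for j
    by (simp add: powr_minus powr_realpow power_one_over inverse_eq_divide)
  have eq: "((1 / 2) ^ k)\<^sup>2 / ((1 / 2) ^ Suc k) powr p * ((1 / 2) ^ k) ^ DIM('a)
      = 2 powr p * (2 powr (p - ?d - 2)) ^ k" for k
    unfolding half by (simp add: powr_power powr_powr algebra_simps flip: powr_add powr_diff)
  have "2 powr (p - ?d - 2) < 2 powr 0" using assms by (intro powr_less_mono) auto
  then have "2 powr (p - ?d - 2) < 1" by simp
  then show "summable (\<lambda>k. ((1 / 2) ^ k)\<^sup>2 / ((1 / 2) ^ Suc k) powr p * ((1 / 2) ^ k) ^ DIM('a))"
    unfolding eq by (intro summable_mult summable_geometric) simp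
  show "(\<lambda>h :: 'a. indicator (cball 0 1) h * (norm h)\<^sup>2 / norm h powr p) \<in> borel_measurable borel"
    by (intro borel_measurable_divide borel_measurable_times borel_measurable_indicator borel_closed) auto
  fix h :: 'a assume "indicator (cball 0 1) h * (norm h)\<^sup>2 / norm h powr p \<noteq> 0"
  then have h: "0 < norm h" "norm h \<le> 1" by (auto simp: indicator_def split: if_splits)
  then obtain k where k: "(1 / 2) ^ Suc k < norm h" "norm h \<le> (1 / 2) ^ k"
    using dyadic_interval_below by metis
  have "(norm h)\<^sup>2 / norm h powr p \<le> ((1 / 2) ^ k)\<^sup>2 / ((1 / 2) ^ Suc k) powr p"
    using k assms h by (intro frac_le powr_mono2 power_mono) auto
  with k h show "\<exists>k. norm h \<le> (1 / 2) ^ k \<and>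
      \<bar>indicator (cball 0 1) h * (norm h)\<^sup>2 / norm h powr p\<bar> \<le> ((1 / 2) ^ k)\<^sup>2 / ((1 / 2) ^ Suc k) powr p"
    by auto
qed auto

section \<open>Weighted integrability and continuity of translations\<close>

text \<open>With \<open>p = n + \<alpha>\<close> this weight is comparable to \<open>1 / (1 + |x|\<^sup>p)\<close>, but unlike the latter it changes at
  most by the factor \<open>(1 + |z|)\<^sup>p\<close> under translation by \<open>z\<close>, which tends to \<open>1\<close> with \<open>z \<rightarrow> 0\<close>.\<close>

definition weight :: "real \<Rightarrow> 'a::real_normed_vector \<Rightarrow> real"
  where "weight p x = (1 + norm x) powr (- p)"

definition weighted_integrable :: "real \<Rightarrow> ('a::euclidean_space \<Rightarrow> real) \<Rightarrow> bool"
  where "weighted_integrable p u \<longleftrightarrow> u \<in> borel_measurable borel \<and> integrable lborel (\<lambda>x. u x * weight p x)"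

lemma weight_pos: "0 < weight p x"
proof -
  have "1 + norm x \<noteq> 0" by (smt (verit) norm_ge_zero)
  then show ?thesis by (simp add: weight_def)
qed

lemma weight_measurable [measurable]: "weight p \<in> borel_measurable borel"
  unfolding weight_def[abs_def] by measurable

lemma weight_translate:
  assumes "0 \<le> p" shows "weight p x \<le> (1 + norm z) powr p * weight p (x + z)"
proof -
  have "norm (x + z) \<le> norm x + norm z" by (rule norm_triangle_ineq)
  then have "1 + norm (x + z) \<le> (1 + norm z) * (1 + norm x)"
  proof -
    have "(1 + norm z) * (1 + norm x) = 1 + norm z + norm x + norm z * norm x" by algebra
    moreover have "0 \<le> norm z * norm x" by simp
    ultimately show ?thesis using \<open>norm (x + z) \<le> _\<close> by linarith
  qed
  then have "(1 + norm (x + z)) powr p \<le> (1 + norm z) powr p * (1 + norm x) powr p"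
    using powr_mono2[OF assms, of "1 + norm (x + z)" "(1 + norm z) * (1 + norm x)"] by (simp add: powr_mult)
  moreover have "0 < (1 + norm x) powr p" "0 < (1 + norm (x + z)) powr p" by (smt (verit) norm_ge_zero powr_gt_zero)+
  ultimately show ?thesis by (simp add: weight_def powr_minus field_simps)
qed

lemma weight_lower_bound:
  assumes "0 \<le> p" "norm x \<le> R" shows "1 \<le> (1 + R) powr p * weight p x"
proof -
  have "1 = weight p (0 :: 'a)" by (simp add: weight_def)
  also have "\<dots> \<le> (1 + norm x) powr p * weight p x" using weight_translate[OF assms(1), of 0 x] by simp
  also have "\<dots> \<le> (1 + R) powr p * weight p x"
    using assms weight_pos[of p x] by (intro mult_right_mono powr_mono2) auto
  finally show ?thesis .
qed

lemma weighted_integrable_mult: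
  assumes "weighted_integrable p u" "g \<in> borel_measurable borel" "\<And>x. \<bar>g x\<bar> \<le> C * weight p x"
  shows "integrable lborel (\<lambda>x. u x * g x)"
proof (rule Bochner_Integration.integrable_bound)
  show "integrable lborel (\<lambda>x. C * (u x * weight p x))"
    using assms(1) by (simp add: weighted_integrable_def)
  have "\<bar>u x * g x\<bar> \<le> \<bar>C * (u x * weight p x)\<bar>" for x
  proof -
    have "\<bar>u x\<bar> * \<bar>g x\<bar> \<le> \<bar>u x\<bar> * \<bar>C * weight p x\<bar>"
      by (rule mult_left_mono[OF order_trans[OF assms(3) abs_ge_self] abs_ge_zero])
    then show ?thesis by (simp add: abs_mult mult_ac)
  qed
  then show "AE x in lborel. norm (u x * g x) \<le> norm (C * (u x * weight p x))" by simp
qed (use assms in \<open>auto simp: weighted_integrable_def intro: borel_measurable_times\<close>)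

lemma weighted_integrable_mult_bounded_support:
  assumes "weighted_integrable p u" "0 \<le> p" "g \<in> borel_measurable borel"
    and "\<And>x. \<bar>g x\<bar> \<le> B" "\<And>x. R < norm x \<Longrightarrow> g x = 0"
  shows "integrable lborel (\<lambda>x. u x * g x)"
proof (rule weighted_integrable_mult[OF assms(1,3)])
  fix x
  have "0 \<le> B" using assms(4)[of x] by linarith
  show "\<bar>g x\<bar> \<le> (B * (1 + R) powr p) * weight p x"
  proof (cases "norm x \<le> R")
    case True
    then show ?thesis using mult_left_mono[OF weight_lower_bound[OF assms(2) True] \<open>0 \<le> B\<close>] assms(4)[of x]
      by (simp add: mult.assoc)
  next
    case False
    then show ?thesis using assms(5)[of x] \<open>0 \<le> B\<close> weight_pos[of p x] by simp
  qed
qed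

lemma weighted_integrable_bound:
  assumes "weighted_integrable p u" "v \<in> borel_measurable borel" "\<And>x. \<bar>v x\<bar> \<le> \<bar>u x\<bar>"
  shows "weighted_integrable p v"
  unfolding weighted_integrable_def
proof (intro conjI)
  show "integrable lborel (\<lambda>x. v x * weight p x)"
    by (rule Bochner_Integration.integrable_bound[of _ "\<lambda>x. u x * weight p x"])
      (use assms weight_pos[of p] in \<open>auto simp: weighted_integrable_def abs_mult intro!: mult_right_mono\<close>)
qed fact

lemma weighted_integrable_add:
  "weighted_integrable p u \<Longrightarrow> weighted_integrable p v \<Longrightarrow> weighted_integrable p (\<lambda>x. u x + v x)"
  by (auto simp: weighted_integrable_def distrib_right intro: borel_measurable_add)

lemma weighted_integrable_cmult:
  "weighted_integrable p u \<Longrightarrow> weighted_integrable p (\<lambda>x. a * u x)"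
  by (auto simp: weighted_integrable_def mult.assoc intro: borel_measurable_times)

lemma weighted_integrable_abs:
  "weighted_integrable p u \<Longrightarrow> weighted_integrable p (\<lambda>x. \<bar>u x\<bar>)"
  by (rule weighted_integrable_bound) (auto simp: weighted_integrable_def)

lemma weighted_integrable_diff:
  "weighted_integrable p u \<Longrightarrow> weighted_integrable p v \<Longrightarrow> weighted_integrable p (\<lambda>x. u x - v x)"
  by (auto simp: weighted_integrable_def left_diff_distrib intro: borel_measurable_diff)

lemma weighted_integrable_max:
  assumes "weighted_integrable p u" "weighted_integrable p v"
  shows "weighted_integrable p (\<lambda>x. max (u x) (v x))"
  by (rule weighted_integrable_bound[OF weighted_integrable_add[OF assms[THEN weighted_integrable_abs]]])
    (use assms in \<open>auto simp: weighted_integrable_def\<close>)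

lemma weighted_integrable_translate:
  assumes "weighted_integrable p u" "0 \<le> p"
  shows "weighted_integrable p (\<lambda>x. u (x + z))"
proof -
  have [measurable]: "u \<in> borel_measurable borel" using assms by (simp add: weighted_integrable_def)
  have "integrable lborel (\<lambda>x. u (x + z) * weight p (x + z))"
    using integrable_translate[of "\<lambda>x. u x * weight p x" z] assms(1)
    by (simp add: weighted_integrable_def add.commute)
  then have "integrable lborel (\<lambda>x. u (x + z) * weight p x)"
    by (rule Bochner_Integration.integrable_bound[OF integrable_mult_right[of "(1 + norm z) powr p"]])
      (auto simp: abs_mult abs_of_pos[OF weight_pos] mult.left_commute[of _ "\<bar>u _\<bar>"]
        intro!: mult_left_mono weight_translate[OF assms(2)])
  then show ?thesis by (simp add: weighted_integrable_def)
qed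

text \<open>For an open set \<open>U\<close> of finite measure the negative part of \<open>1\<^sub>U(x + z) - 1\<^sub>U(x)\<close> tends to \<open>0\<close> pointwise
  and is dominated by \<open>1\<^sub>U\<close>; the positive part has the same integral. A measurable set is an open set up to
  small measure, and integrable functions are limits of simple ones.\<close>

lemma L1_translation_continuous:
  fixes f :: "'a::euclidean_space \<Rightarrow> real"
  assumes "integrable lborel f" and z: "z \<longlonglongrightarrow> (0 :: 'a)"
  shows "(\<lambda>n. \<integral>x. \<bar>f (x + z n) - f x\<bar> \<partial>lborel) \<longlonglongrightarrow> 0"
proof -
  have int_tr: "integrable lborel (\<lambda>x. g (x + t))" "(\<integral>x. g (x + t) \<partial>lborel) = integral\<^sup>L lborel g"
    if "integrable lborel g" for g :: "'a \<Rightarrow> real" and t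
    using that integrable_translate[of g t] integral_translate[of g t] borel_measurable_integrable[OF that]
    by (auto simp: add.commute)
  have int_diff: "integrable lborel (\<lambda>x. \<bar>g (x + t) - g x\<bar>)" if "integrable lborel g" for g :: "'a \<Rightarrow> real" and t
    using int_tr[OF that] that by (intro integrable_abs Bochner_Integration.integrable_diff)
  \<comment> \<open>functions that are \<open>L\<^sup>1\<close>-close to a function with the property have it, up to the error\<close>
  have approx: "(\<lambda>n. \<integral>x. \<bar>f (x + z n) - f x\<bar> \<partial>lborel) \<longlonglongrightarrow> 0"
    if f: "integrable lborel f"
      and ap: "\<And>e. 0 < e \<Longrightarrow> \<exists>g. integrable lborel g \<and> (\<integral>x. \<bar>f x - g x\<bar> \<partial>lborel) < e
        \<and> (\<lambda>n. \<integral>x. \<bar>g (x + z n) - g x\<bar> \<partial>lborel) \<longlonglongrightarrow> 0" for f :: "'a \<Rightarrow> real"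
  proof (rule LIMSEQ_I)
    fix e :: real assume "0 < e"
    then obtain g where g: "integrable lborel g" "(\<integral>x. \<bar>f x - g x\<bar> \<partial>lborel) < e / 3"
      "(\<lambda>n. \<integral>x. \<bar>g (x + z n) - g x\<bar> \<partial>lborel) \<longlonglongrightarrow> 0"
      using ap[of "e / 3"] by auto
    from LIMSEQ_D[OF g(3), of "e / 3"] \<open>0 < e\<close>
    obtain N where N: "\<And>n. n \<ge> N \<Longrightarrow> \<bar>\<integral>x. \<bar>g (x + z n) - g x\<bar> \<partial>lborel\<bar> < e / 3" by auto
    have "norm ((\<integral>x. \<bar>f (x + z n) - f x\<bar> \<partial>lborel) - 0) < e" if "n \<ge> N" for n
    proof -
      have fg: "integrable lborel (\<lambda>x. \<bar>f x - g x\<bar>)" using f g(1) by simp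
      have "(\<integral>x. \<bar>f (x + z n) - f x\<bar> \<partial>lborel)
          \<le> (\<integral>x. \<bar>f (x + z n) - g (x + z n)\<bar> + \<bar>g (x + z n) - g x\<bar> + \<bar>f x - g x\<bar> \<partial>lborel)"
        by (intro integral_mono int_diff f Bochner_Integration.integrable_add g(1) fg int_tr(1)[OF fg]) auto
      also have "\<dots> = (\<integral>x. \<bar>f x - g x\<bar> \<partial>lborel) + (\<integral>x. \<bar>g (x + z n) - g x\<bar> \<partial>lborel) + (\<integral>x. \<bar>f x - g x\<bar> \<partial>lborel)"
        using int_tr[OF fg, of "z n"] fg int_diff[OF g(1), of "z n"] by simp
      also have "\<dots> < e" using g(2) N[OF that] by linarith
      finally show ?thesis by (simp add: integral_nonneg_AE)
    qed
    then show "\<exists>N. \<forall>n\<ge>N. norm ((\<integral>x. \<bar>f (x + z n) - f x\<bar> \<partial>lborel) - 0) < e" by blast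
  qed
  have open_case: "(\<lambda>n. \<integral>x. \<bar>indicator U (x + z n) - indicator U x\<bar> \<partial>lborel) \<longlonglongrightarrow> (0::real)"
    if U: "open U" "emeasure lborel U < \<infinity>" for U :: "'a set"
  proof -
    let ?i = "indicator U :: 'a \<Rightarrow> real"
    have i: "integrable lborel ?i" using U by (intro integrable_real_indicator) auto
    have mi: "integrable lborel (\<lambda>x. max 0 (?i x - ?i (x + z n)))" for n
      using int_tr(1)[OF i] i by (intro Bochner_Integration.integrable_max) auto
    have "(\<lambda>n. \<integral>x. max 0 (?i x - ?i (x + z n)) \<partial>lborel) \<longlonglongrightarrow> (\<integral>x. 0 \<partial>(lborel :: 'a measure))"
    proof (rule integral_dominated_convergence[where w = ?i])
      show "AE x in lborel. (\<lambda>n. max 0 (?i x - ?i (x + z n))) \<longlonglongrightarrow> 0"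
      proof (rule AE_I2)
        fix x
        show "(\<lambda>n. max 0 (?i x - ?i (x + z n))) \<longlonglongrightarrow> 0"
        proof (cases "x \<in> U")
          case True
          have "(\<lambda>n. x + z n) \<longlonglongrightarrow> x" using tendsto_add[OF tendsto_const z, of x] by simp
          then have "\<forall>\<^sub>F n in sequentially. x + z n \<in> U" using U(1) True by (rule topological_tendstoD)
          then have "\<forall>\<^sub>F n in sequentially. max 0 (?i x - ?i (x + z n)) = 0"
            by eventually_elim (use True in simp)
          then show ?thesis by (rule tendsto_eventually)
        qed simp
      qed
      show "AE x in lborel. norm (max 0 (?i x - ?i (x + z n))) \<le> ?i x" for n
        by (auto simp: indicator_def)
    qed (use i mi in \<open>auto dest: borel_measurable_integrable\<close>)
    then have lim: "(\<lambda>n. 2 * (\<integral>x. max 0 (?i x - ?i (x + z n)) \<partial>lborel)) \<longlonglongrightarrow> 0"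
      by (auto intro!: tendsto_eq_intros)
    have "(\<integral>x. \<bar>?i (x + z n) - ?i x\<bar> \<partial>lborel) = 2 * (\<integral>x. max 0 (?i x - ?i (x + z n)) \<partial>lborel)" for n
    proof -
      have "(\<integral>x. \<bar>?i (x + z n) - ?i x\<bar> \<partial>lborel)
          = (\<integral>x. (?i (x + z n) - ?i x) + 2 * max 0 (?i x - ?i (x + z n)) \<partial>lborel)"
        by (intro Bochner_Integration.integral_cong) (auto simp: indicator_def)
      also have "\<dots> = 2 * (\<integral>x. max 0 (?i x - ?i (x + z n)) \<partial>lborel)"
        using int_tr[OF i, of "z n"] i mi[of n] by simp
      finally show ?thesis .
    qed
    with lim show ?thesis by simp
  qed
  show ?thesis using assms(1)
  proof induction
    case (base A c)
    have "(\<lambda>n. \<integral>x. \<bar>indicator A (x + z n) - indicator A x\<bar> \<partial>lborel) \<longlonglongrightarrow> (0::real)"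
    proof (rule approx)
      show "integrable lborel (indicator A :: 'a \<Rightarrow> real)" using base by (intro integrable_real_indicator)
      fix e :: real assume "0 < e"
      obtain U where U: "open U" "A \<subseteq> U" "emeasure lborel (U - A) < ennreal e"
        using outer_regular_lborel[of A e] base \<open>0 < e\<close> by auto
      have fin: "emeasure lborel U < \<infinity>"
      proof -
        have "emeasure lborel U \<le> emeasure lborel (U - A) + emeasure lborel A"
          using emeasure_subadditive[of "U - A" lborel A] U base by (auto simp: Un_absorb2)
        also have "\<dots> < \<infinity>" using less_trans[OF U(3) ennreal_less_top] base by simp
        finally show ?thesis .
      qed
      have "(\<integral>x. \<bar>indicator A x - indicator U x :: real\<bar> \<partial>lborel) = (\<integral>x. indicator (U - A) x \<partial>lborel)"
        using U(2) by (intro Bochner_Integration.integral_cong) (auto simp: indicator_def)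
      also have "\<dots> = measure lborel (U - A)" by simp
      also have "\<dots> < e"
      proof -
        have "ennreal (measure lborel (U - A)) = emeasure lborel (U - A)"
          using less_trans[OF U(3) ennreal_less_top] by (intro emeasure_eq_ennreal_measure[symmetric]) auto
        then show ?thesis using U(3) ennreal_less_iff[of "measure lborel (U - A)" e] by simp
      qed
      finally show "\<exists>g :: 'a \<Rightarrow> real. integrable lborel g \<and> (\<integral>x. \<bar>indicator A x - g x\<bar> \<partial>lborel) < e
        \<and> (\<lambda>n. \<integral>x. \<bar>g (x + z n) - g x\<bar> \<partial>lborel) \<longlonglongrightarrow> 0"
        using open_case[OF U(1) fin] fin U(1)
        by (intro exI[of _ "indicator U"] conjI integrable_real_indicator) auto
    qed
    from tendsto_mult_left[OF this, of "\<bar>c\<bar>"]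
    show ?case by (simp add: right_diff_distrib[symmetric] abs_mult mult.commute)
  next
    case (add f g)
    show ?case
    proof (rule tendsto_sandwich[OF always_eventually always_eventually tendsto_const])
      show "(\<lambda>n. (\<integral>x. \<bar>f (x + z n) - f x\<bar> \<partial>lborel) + (\<integral>x. \<bar>g (x + z n) - g x\<bar> \<partial>lborel)) \<longlonglongrightarrow> 0"
        using tendsto_add[OF add.IH] by simp
      show "\<forall>n. (\<integral>x. \<bar>f (x + z n) + g (x + z n) - (f x + g x)\<bar> \<partial>lborel)
          \<le> (\<integral>x. \<bar>f (x + z n) - f x\<bar> \<partial>lborel) + (\<integral>x. \<bar>g (x + z n) - g x\<bar> \<partial>lborel)"
      proof
        fix n
        have "(\<integral>x. \<bar>f (x + z n) + g (x + z n) - (f x + g x)\<bar> \<partial>lborel)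
            \<le> (\<integral>x. \<bar>f (x + z n) - f x\<bar> + \<bar>g (x + z n) - g x\<bar> \<partial>lborel)"
          using int_diff[of "\<lambda>x. f x + g x" "z n"] add
          by (intro integral_mono Bochner_Integration.integrable_add int_diff) auto
        also have "\<dots> = (\<integral>x. \<bar>f (x + z n) - f x\<bar> \<partial>lborel) + (\<integral>x. \<bar>g (x + z n) - g x\<bar> \<partial>lborel)"
          using add int_diff by simp
        finally show "(\<integral>x. \<bar>f (x + z n) + g (x + z n) - (f x + g x)\<bar> \<partial>lborel)
          \<le> (\<integral>x. \<bar>f (x + z n) - f x\<bar> \<partial>lborel) + (\<integral>x. \<bar>g (x + z n) - g x\<bar> \<partial>lborel)" .
      qed
    qed (simp add: integral_nonneg_AE)
  next
    case (lim f s)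
    show ?case
    proof (rule approx[OF lim.hyps(4)])
      fix e :: real assume "0 < e"
      have "(\<lambda>i. \<integral>x. \<bar>f x - s i x\<bar> \<partial>lborel) \<longlonglongrightarrow> (\<integral>x. 0 \<partial>(lborel :: 'a measure))"
      proof (rule integral_dominated_convergence[where w = "\<lambda>x. 3 * \<bar>f x\<bar>"])
        show "AE x in lborel. (\<lambda>i. \<bar>f x - s i x\<bar>) \<longlonglongrightarrow> 0"
        proof (rule AE_I2)
          fix x show "(\<lambda>i. \<bar>f x - s i x\<bar>) \<longlonglongrightarrow> 0"
            using tendsto_rabs[OF tendsto_diff[OF tendsto_const lim.hyps(2)], of x "f x"] by simp
        qed
        show "AE x in lborel. norm \<bar>f x - s i x\<bar> \<le> 3 * \<bar>f x\<bar>" for i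
        proof (rule AE_I2)
          fix x show "norm \<bar>f x - s i x\<bar> \<le> 3 * \<bar>f x\<bar>" using lim.hyps(3)[of x i] by auto
        qed
      qed (use lim in \<open>auto dest: borel_measurable_integrable\<close>)
      from LIMSEQ_D[OF this \<open>0 < e\<close>] obtain i where "\<bar>\<integral>x. \<bar>f x - s i x\<bar> \<partial>lborel\<bar> < e" by auto
      then have "(\<integral>x. \<bar>f x - s i x\<bar> \<partial>lborel) < e" by linarith
      then show "\<exists>g. integrable lborel g \<and> (\<integral>x. \<bar>f x - g x\<bar> \<partial>lborel) < e
        \<and> (\<lambda>n. \<integral>x. \<bar>g (x + z n) - g x\<bar> \<partial>lborel) \<longlonglongrightarrow> 0"
        using lim.hyps(1) lim.IH by blast
    qed
  qed
qed

section \<open>Oscillation at a small scale\<close>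

lemma cball_in_borel [measurable]: "cball (a :: 'a::euclidean_space) r \<in> sets borel"
  by simp

lemma borel_measurable_integral_lborel:
  fixes f :: "'a::euclidean_space \<Rightarrow> 'b::euclidean_space \<Rightarrow> real"
  assumes "(\<lambda>(x, y). f x y) \<in> borel_measurable (borel \<Otimes>\<^sub>M borel)"
  shows "(\<lambda>x. \<integral>y. f x y \<partial>lborel) \<in> borel_measurable borel"
proof (rule lborel.borel_measurable_lebesgue_integral)
  have "sets (borel \<Otimes>\<^sub>M (lborel :: 'b measure)) = sets (borel \<Otimes>\<^sub>M (borel :: 'b measure))"
    by (intro sets_pair_measure_cong) auto
  then show "(\<lambda>(x, y). f x y) \<in> borel_measurable (borel \<Otimes>\<^sub>M lborel)"
    using assms measurable_cong_sets by blast
qed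

text \<open>Every error caused by mollification at scale \<open>r\<close> is bounded by this quantity, hence a single
  convergence result is needed for all of them.\<close>

definition oscillation :: "real \<Rightarrow> ('a::euclidean_space \<Rightarrow> real) \<Rightarrow> 'a \<Rightarrow> real"
  where "oscillation r u x =
    (\<integral>z. indicator (cball 0 r) z * \<bar>u (x + z) - u x\<bar> \<partial>lborel) / r ^ DIM('a)"

lemma integrable_oscillation_integrand:
  fixes u :: "'a::euclidean_space \<Rightarrow> real"
  assumes "weighted_integrable p u" "0 \<le> p"
  shows "integrable lborel (\<lambda>z. indicator (cball 0 r) z * \<bar>u (x + z) - u x\<bar>)"
proof -
  have "integrable lborel (\<lambda>z. u (z + x) * indicator (cball 0 r) z)"
    by (rule weighted_integrable_mult_bounded_support[OF weighted_integrable_translate[OF assms] assms(2), where B = 1 and R = r])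
      (auto simp: indicator_def intro!: borel_measurable_indicator borel_closed)
  moreover have "integrable lborel (\<lambda>z. u x * indicator (cball (0::'a) r) z)"
    using emeasure_lborel_cball_finite[of "0::'a" r]
    by (intro integrable_mult_right integrable_real_indicator) auto
  ultimately have "integrable lborel (\<lambda>z. \<bar>u (z + x) * indicator (cball 0 r) z - u x * indicator (cball 0 r) z\<bar>)"
    by (intro integrable_abs Bochner_Integration.integrable_diff)
  then show ?thesis
    by (rule Bochner_Integration.integrable_cong[THEN iffD1, rotated -1]) (auto simp: indicator_def add.commute)
qed

lemma oscillation_nonneg: "0 \<le> r \<Longrightarrow> 0 \<le> oscillation r u x"
  by (auto simp: oscillation_def intro!: divide_nonneg_nonneg integral_nonneg_AE)

lemma oscillation_measurable [measurable]:
  fixes u :: "'a::euclidean_space \<Rightarrow> real"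
  assumes [measurable]: "u \<in> borel_measurable borel"
  shows "oscillation r u \<in> borel_measurable borel"
proof -
  have "(\<lambda>x. \<integral>z. indicator (cball 0 r) z * \<bar>u (x + z) - u x\<bar> \<partial>lborel) \<in> borel_measurable borel"
    by (rule borel_measurable_integral_lborel) measurable
  then show ?thesis unfolding oscillation_def[abs_def] by (intro borel_measurable_divide) auto
qed

text \<open>The difference is the integral of \<open>u(y) - u(x)\<close> against the kernel.  The lemma is applied to the
  mollifier, to its derivatives and to the commutator kernel of the drift.\<close>

lemma kernel_oscillation_bound:
  fixes u k :: "'a::euclidean_space \<Rightarrow> real"
  assumes u: "weighted_integrable p u" "0 \<le> p" and k [measurable]: "k \<in> borel_measurable borel"
    and r: "0 < r" and k_le: "\<And>y. \<bar>k y\<bar> \<le> C / r ^ DIM('a)" and supp: "\<And>y. r < norm (x - y) \<Longrightarrow> k y = 0"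
  shows "\<bar>(\<integral>y. u y * k y \<partial>lborel) - u x * integral\<^sup>L lborel k\<bar> \<le> C * oscillation r u x"
    and "integrable lborel (\<lambda>y. u y * k y)" and "integrable lborel k"
proof -
  have [measurable]: "u \<in> borel_measurable borel" using u by (simp add: weighted_integrable_def)
  have far: "k y = 0" if "norm x + r < norm y" for y
  proof -
    have "norm y \<le> norm x + norm (x - y)" using norm_triangle_ineq4[of x "x - y"] by simp
    then show ?thesis using that by (intro supp) linarith
  qed
  show 1: "integrable lborel (\<lambda>y. u y * k y)"
    using weighted_integrable_mult_bounded_support[OF u k k_le far] .
  show 2: "integrable lborel k"
    by (rule integrable_bounded_support[OF k k_le far])
  have "(\<integral>y. u y * k y \<partial>lborel) - u x * integral\<^sup>L lborel k = (\<integral>y. (u y - u x) * k y \<partial>lborel)"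
    using 1 2 by (simp add: left_diff_distrib)
  also have "\<dots> = (\<integral>z. (u (x + z) - u x) * k (x + z) \<partial>lborel)"
    by (rule integral_translate[symmetric]) measurable
  finally have "\<bar>(\<integral>y. u y * k y \<partial>lborel) - u x * integral\<^sup>L lborel k\<bar>
      \<le> (\<integral>z. \<bar>(u (x + z) - u x) * k (x + z)\<bar> \<partial>lborel)"
    by simp
  also have "\<dots> \<le> (\<integral>z. C / r ^ DIM('a) * (indicator (cball 0 r) z * \<bar>u (x + z) - u x\<bar>) \<partial>lborel)"
  proof (rule integral_mono)
    have "integrable lborel (\<lambda>y. (u y - u x) * k y)"
      using Bochner_Integration.integrable_diff[OF 1 integrable_mult_right[OF 2, of "u x"]] by (simp add: left_diff_distrib)
    then show "integrable lborel (\<lambda>z. \<bar>(u (x + z) - u x) * k (x + z)\<bar>)"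
      by (intro integrable_abs) (subst integrable_translate[of "\<lambda>y. (u y - u x) * k y"], measurable)
    show "integrable lborel (\<lambda>z. C / r ^ DIM('a) * (indicator (cball 0 r) z * \<bar>u (x + z) - u x\<bar>))"
      by (intro integrable_mult_right integrable_oscillation_integrand[OF u])
    fix z
    show "\<bar>(u (x + z) - u x) * k (x + z)\<bar> \<le> C / r ^ DIM('a) * (indicator (cball 0 r) z * \<bar>u (x + z) - u x\<bar>)"
    proof (cases "norm z \<le> r")
      case True
      then show ?thesis using mult_left_mono[OF k_le[of "x + z"] abs_ge_zero[of "u (x + z) - u x"]]
        by (simp add: abs_mult mult.commute)
    next
      case False
      then show ?thesis using supp[of "x + z"] by simp
    qed
  qed
  also have "\<dots> = C * oscillation r u x" by (simp add: oscillation_def)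
  finally show "\<bar>(\<integral>y. u y * k y \<partial>lborel) - u x * integral\<^sup>L lborel k\<bar> \<le> C * oscillation r u x" .
qed

text \<open>Translate the product of \<open>u\<close> and the weight, to which the unweighted result applies, and
  compare the weights at \<open>x\<close> and \<open>x + z\<close>.\<close>

lemma weighted_L1_translation_continuous:
  fixes u :: "'a::euclidean_space \<Rightarrow> real"
  assumes u: "weighted_integrable p u" "0 \<le> p" and z: "z \<longlonglongrightarrow> 0"
  shows "(\<lambda>n. \<integral>x. \<bar>u (x + z n) - u x\<bar> * weight p x \<partial>lborel) \<longlonglongrightarrow> 0"
proof -
  have [measurable]: "u \<in> borel_measurable borel" using u by (simp add: weighted_integrable_def)
  define U where "U x = u x * weight p x" for x
  have U: "integrable lborel U" using u by (simp add: weighted_integrable_def U_def[abs_def])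
  have Ut: "integrable lborel (\<lambda>x. U (x + t))" "(\<integral>x. \<bar>U (x + t)\<bar> \<partial>lborel) = (\<integral>x. \<bar>U x\<bar> \<partial>lborel)" for t
    using integrable_translate[of U t] integral_translate[of "\<lambda>x. \<bar>U x\<bar>" t] U
    by (auto simp: add.commute borel_measurable_integrable)
  let ?I = "\<lambda>n. (\<integral>x. \<bar>U (x + z n) - U x\<bar> \<partial>lborel) + ((1 + norm (z n)) powr p - 1) * (\<integral>x. \<bar>U x\<bar> \<partial>lborel)"
  have le: "(\<integral>x. \<bar>u (x + z n) - u x\<bar> * weight p x \<partial>lborel) \<le> ?I n" for n
  proof -
    let ?a = "(1 + norm (z n)) powr p"
    have a: "1 \<le> ?a" using u(2) by (simp add: ge_one_powr_ge_zero)
    have "(\<integral>x. \<bar>u (x + z n) - u x\<bar> * weight p x \<partial>lborel)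
        \<le> (\<integral>x. \<bar>U (x + z n) - U x\<bar> + (?a - 1) * \<bar>U (x + z n)\<bar> \<partial>lborel)"
    proof (rule integral_mono)
      show "integrable lborel (\<lambda>x. \<bar>u (x + z n) - u x\<bar> * weight p x)"
        using weighted_integrable_abs[OF weighted_integrable_diff[OF weighted_integrable_translate[OF u] u(1)]]
        by (simp add: weighted_integrable_def)
      show "integrable lborel (\<lambda>x. \<bar>U (x + z n) - U x\<bar> + (?a - 1) * \<bar>U (x + z n)\<bar>)"
        using U Ut(1) by (intro Bochner_Integration.integrable_add integrable_mult_right integrable_abs Bochner_Integration.integrable_diff)
      fix x
      let ?w = "weight p x" and ?w' = "weight p (x + z n)"
      have w: "?w \<le> ?a * ?w'" "?w' \<le> ?a * ?w" "0 < ?w" "0 < ?w'"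
        using weight_translate[OF u(2), of x "z n"] weight_translate[OF u(2), of "x + z n" "- z n"] weight_pos
        by auto
      have "?w' - ?w \<le> (?a - 1) * ?w'"
      proof -
        have "(?a - 1) * (?w' - ?w) \<ge> 0 \<or> ?w' \<le> ?w" using a by auto
        then show ?thesis using w a by (smt (verit) left_diff_distrib right_diff_distrib mult_cancel_right1 mult_nonneg_nonneg)
      qed
      then have "\<bar>?w - ?w'\<bar> \<le> (?a - 1) * ?w'" using w by (auto simp: abs_le_iff left_diff_distrib)
      then have "\<bar>u (x + z n)\<bar> * \<bar>?w - ?w'\<bar> \<le> (?a - 1) * \<bar>U (x + z n)\<bar>"
        using mult_left_mono[OF _ abs_ge_zero, of "\<bar>?w - ?w'\<bar>" "(?a - 1) * ?w'" "u (x + z n)"] w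
        by (simp add: U_def abs_mult mult_ac)
      moreover have "(u (x + z n) - u x) * ?w = (U (x + z n) - U x) + u (x + z n) * (?w - ?w')"
        by (simp add: U_def algebra_simps)
      then have "\<bar>(u (x + z n) - u x) * ?w\<bar> \<le> \<bar>U (x + z n) - U x\<bar> + \<bar>u (x + z n)\<bar> * \<bar>?w - ?w'\<bar>"
        by (metis abs_mult abs_triangle_ineq)
      ultimately show "\<bar>u (x + z n) - u x\<bar> * ?w \<le> \<bar>U (x + z n) - U x\<bar> + (?a - 1) * \<bar>U (x + z n)\<bar>"
        using w by (simp add: abs_mult)
    qed
    also have "\<dots> = ?I n" using U Ut by simp
    finally show ?thesis .
  qed
  have "?I \<longlonglongrightarrow> 0 + ((1 + norm (0::'a)) powr p - 1) * (\<integral>x. \<bar>U x\<bar> \<partial>lborel)"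
    by (intro tendsto_add L1_translation_continuous[OF U z] tendsto_mult tendsto_diff tendsto_powr tendsto_const tendsto_norm z) simp
  then have lim: "?I \<longlonglongrightarrow> 0" by simp
  show ?thesis
  proof (rule tendsto_sandwich[OF always_eventually always_eventually tendsto_const lim])
    show "\<forall>n. 0 \<le> (\<integral>x. \<bar>u (x + z n) - u x\<bar> * weight p x \<partial>lborel)"
      using less_imp_le[OF weight_pos[of p]] by (auto intro!: integral_nonneg_AE AE_I2 mult_nonneg_nonneg)
  qed (use le in blast)
qed

text \<open>By Tonelli's theorem the integral is, up to the volume of the unit ball, an average over
  \<open>|z| \<le> r\<close> of the weighted norms of \<open>u(\<cdot> + z) - u\<close>.\<close>

lemma oscillation_weighted_small:
  fixes u :: "'a::euclidean_space \<Rightarrow> real"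
  assumes u: "weighted_integrable p u" "0 \<le> p" and "0 < e"
  obtains \<delta> where "0 < \<delta>" "\<And>r. 0 < r \<Longrightarrow> r < \<delta> \<Longrightarrow> weighted_integrable p (oscillation r u)"
    "\<And>r. 0 < r \<Longrightarrow> r < \<delta> \<Longrightarrow> (\<integral>x. oscillation r u x * weight p x \<partial>lborel) \<le> e"
proof -
  have [measurable]: "u \<in> borel_measurable borel" using u by (simp add: weighted_integrable_def)
  define \<tau> where "\<tau> z = (\<integral>x. \<bar>u (x + z) - u x\<bar> * weight p x \<partial>lborel)" for z
  let ?w = "unit_ball_vol (real DIM('a))"
  have "isCont \<tau> 0"
    unfolding continuous_at_sequentially
    using weighted_L1_translation_continuous[OF u] by (simp add: \<tau>_def o_def)
  moreover have "\<tau> 0 = 0" by (simp add: \<tau>_def)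
  moreover have "0 < e / ?w" using \<open>0 < e\<close> by simp
  ultimately obtain \<delta> where \<delta>: "0 < \<delta>" "\<And>z. norm z < \<delta> \<Longrightarrow> \<bar>\<tau> z\<bar> < e / ?w"
    unfolding continuous_at_eps_delta by (auto simp: dist_norm)
  have main: "weighted_integrable p (oscillation r u) \<and> (\<integral>x. oscillation r u x * weight p x \<partial>lborel) \<le> e"
    if r: "0 < r" "r < \<delta>" for r
  proof -
    have nn: "0 \<le> oscillation r u x * weight p x" for x
      using oscillation_nonneg[of r u x] r weight_pos[of p x] by simp
    have "(\<integral>\<^sup>+x. ennreal (oscillation r u x * weight p x) \<partial>lborel)
      = (\<integral>\<^sup>+x. (\<integral>\<^sup>+z. ennreal (indicator (cball 0 r) z / r ^ DIM('a) * (\<bar>u (x + z) - u x\<bar> * weight p x)) \<partial>lborel) \<partial>lborel)"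
    proof (rule nn_integral_cong)
      fix x
      have i: "integrable lborel (\<lambda>z. indicator (cball 0 r) z / r ^ DIM('a) * (\<bar>u (x + z) - u x\<bar> * weight p x))"
        using integrable_mult_right[OF integrable_oscillation_integrand[OF u, of r x], of "weight p x / r ^ DIM('a)"]
        by (simp add: mult_ac)
      have "oscillation r u x * weight p x = (\<integral>z. indicator (cball 0 r) z / r ^ DIM('a) * (\<bar>u (x + z) - u x\<bar> * weight p x) \<partial>lborel)"
        using integral_mult_right_zero[of lborel "weight p x / r ^ DIM('a)" "\<lambda>z. indicator (cball 0 r) z * \<bar>u (x + z) - u x\<bar>"]
        by (simp add: oscillation_def mult_ac)
      then show "ennreal (oscillation r u x * weight p x)
          = (\<integral>\<^sup>+z. ennreal (indicator (cball 0 r) z / r ^ DIM('a) * (\<bar>u (x + z) - u x\<bar> * weight p x)) \<partial>lborel)"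
        using r less_imp_le[OF weight_pos[of p x]] by (subst nn_integral_eq_integral[OF i]) (auto intro!: AE_I2 mult_nonneg_nonneg divide_nonneg_nonneg)
    qed
    also have "\<dots> = (\<integral>\<^sup>+z. (\<integral>\<^sup>+x. ennreal (indicator (cball 0 r) z / r ^ DIM('a) * (\<bar>u (x + z) - u x\<bar> * weight p x)) \<partial>lborel) \<partial>lborel)"
      by (rule lborel_pair.Fubini'[symmetric]) measurable
    also have "\<dots> = (\<integral>\<^sup>+z. ennreal (indicator (cball (0::'a) r) z / r ^ DIM('a) * \<tau> z) \<partial>lborel)"
    proof (rule nn_integral_cong)
      fix z :: 'a
      have "integrable lborel (\<lambda>x. \<bar>u (x + z) - u x\<bar> * weight p x)"
        using weighted_integrable_abs[OF weighted_integrable_diff[OF weighted_integrable_translate[OF u] u(1)]]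
        by (simp add: weighted_integrable_def)
      then have i: "integrable lborel (\<lambda>x. indicator (cball 0 r) z / r ^ DIM('a) * (\<bar>u (x + z) - u x\<bar> * weight p x))"
        by (rule integrable_mult_right)
      show "(\<integral>\<^sup>+x. ennreal (indicator (cball 0 r) z / r ^ DIM('a) * (\<bar>u (x + z) - u x\<bar> * weight p x)) \<partial>lborel)
        = ennreal (indicator (cball 0 r) z / r ^ DIM('a) * \<tau> z)"
        using r less_imp_le[OF weight_pos[of p]] by (subst nn_integral_eq_integral[OF i]) (auto simp: \<tau>_def intro!: AE_I2 mult_nonneg_nonneg divide_nonneg_nonneg)
    qed
    also have "\<dots> \<le> (\<integral>\<^sup>+z. ennreal (e / ?w / r ^ DIM('a)) * indicator (cball (0::'a) r) z \<partial>lborel)"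
    proof (rule nn_integral_mono)
      fix z :: 'a
      show "ennreal (indicator (cball (0::'a) r) z / r ^ DIM('a) * \<tau> z) \<le> ennreal (e / ?w / r ^ DIM('a)) * indicator (cball (0::'a) r) z"
      proof (cases "norm z \<le> r")
        case True
        then have "\<tau> z \<le> e / ?w" using \<delta>(2)[of z] r by auto
        from divide_right_mono[OF this, of "r ^ DIM('a)"] show ?thesis
          using True r by (auto intro!: ennreal_leI)
      qed simp
    qed
    also have "\<dots> = ennreal (e / ?w / r ^ DIM('a)) * ennreal (?w * r ^ DIM('a))"
      using r by (simp add: nn_integral_cmult_indicator emeasure_cball)
    also have "\<dots> = ennreal e"
    proof -
      have "0 < ?w" by simp
      then have "?w \<noteq> 0" by (rule less_imp_neq[symmetric])
      then show ?thesis using r \<open>0 < e\<close> by (simp add: ennreal_mult[symmetric])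
    qed
    finally have nn_le: "(\<integral>\<^sup>+x. ennreal (oscillation r u x * weight p x) \<partial>lborel) \<le> ennreal e" .
    have i: "integrable lborel (\<lambda>x. oscillation r u x * weight p x)"
    proof (rule integrableI_nonneg)
      show "(\<integral>\<^sup>+x. ennreal (oscillation r u x * weight p x) \<partial>lborel) < \<infinity>"
        using nn_le by (rule le_less_trans) simp
    qed (use nn in auto)
    have "ennreal (\<integral>x. oscillation r u x * weight p x \<partial>lborel) \<le> ennreal e"
      using nn_le nn_integral_eq_integral[OF i AE_I2[OF nn]] by simp
    then have "(\<integral>x. oscillation r u x * weight p x \<partial>lborel) \<le> e" using \<open>0 < e\<close> by (simp add: ennreal_le_iff)
    with i show ?thesis by (simp add: weighted_integrable_def)
  qed
  show thesis using that[OF \<delta>(1)] main by blast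
qed

section \<open>Mollification\<close>

definition mollify :: "real \<Rightarrow> (real ^ 'n::finite \<Rightarrow> real) \<Rightarrow> real ^ 'n \<Rightarrow> real"
  where "mollify r u x = (\<integral>y. u y * mollifier r (x - y) \<partial>lborel)"

lemma mollifier_minus: "mollifier r (- z) = mollifier r z"
  by (simp add: mollifier_def bump_def)

lemma Ck_on_mollifier_0: "0 < r \<Longrightarrow> Ck_on k UNIV (mollifier r)"
  using Ck_on_mollifier[of r k 0] by (simp add: mollifier_minus)

lemma mollifier_measurable [measurable]: "mollifier r \<in> borel_measurable borel"
  unfolding mollifier_def[abs_def] by measurable

lemma partial_mollifier_measurable [measurable]: "0 < r \<Longrightarrow> partial i (mollifier r) \<in> borel_measurable borel"
  using Ck_on_mollifier_0[of r 1] by (auto intro: borel_measurable_continuous_onI)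

lemma partial_mollifier_eq_0: "0 < r \<Longrightarrow> r < norm z \<Longrightarrow> partial i (mollifier r) z = 0"
  by (rule partial_eq_0_outside[of r]) (auto simp: mollifier_eq_0)

lemma mollify_measurable [measurable]:
  assumes [measurable]: "u \<in> borel_measurable borel"
  shows "mollify r u \<in> borel_measurable borel"
  unfolding mollify_def[abs_def] by (rule borel_measurable_integral_lborel) measurable

text \<open>Integrating the second-order remainder of the mollifier against \<open>u\<close> gives a remainder of order
  \<open>|h|\<^sup>2\<close> for the mollification.\<close>

lemma mollify_C1:
  fixes u :: "real ^ 'n::finite \<Rightarrow> real"
  assumes u: "weighted_integrable p u" "0 \<le> p" and r: "0 < r"
  shows "mollify r u differentiable (at x)"
    and "partial i (mollify r u) x = (\<integral>y. u y * partial i (mollifier r) (x - y) \<partial>lborel)"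
    and "continuous_on UNIV (partial i (mollify r u))"
proof -
  have [measurable]: "u \<in> borel_measurable borel" using u by (simp add: weighted_integrable_def)
  note [measurable] = partial_mollifier_measurable[OF r]
  define G where "G i x = (\<integral>y. u y * partial i (mollifier r) (x - y) \<partial>lborel)" for i x
  obtain C where C: "0 < C"
    "\<And>x y i. \<bar>partial i (mollifier r) x - partial i (mollifier r) (y :: real ^ 'n)\<bar> \<le> C * norm (x - y)"
    "\<And>x h. \<bar>mollifier r (x + h) - mollifier r (x :: real ^ 'n) - (\<Sum>i\<in>UNIV. h $ i * partial i (mollifier r) x)\<bar> \<le> C * (norm h)\<^sup>2"
    by (rule Taylor_quadratic_bound[OF Ck_on_mollifier_0[OF r], of r]) (auto intro: mollifier_eq_0[OF r])
  obtain C' where C': "\<And>z. mollifier r (z :: real ^ 'n) \<le> C' / r ^ CARD('n)"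
    "\<And>z i. \<bar>partial i (mollifier r) (z :: real ^ 'n)\<bar> \<le> C' / r ^ (CARD('n) + 1)"
    by (rule mollifier_bounds[where 'n = 'n]) (use r in blast)
  have near: "norm y \<le> norm x + norm h + r" if "norm (x + h - y) \<le> r" for x y h :: "real ^ 'n"
    using norm_triangle_ineq4[of "x + h" "x + h - y"] norm_triangle_ineq[of x h] that by simp
  define M where "M x = (\<integral>y. \<bar>u y\<bar> * indicator (cball 0 (norm x + 1 + r)) y \<partial>lborel)" for x :: "real ^ 'n"
  have iM: "integrable lborel (\<lambda>y. \<bar>u y\<bar> * indicator (cball 0 (norm x + 1 + r)) y)" for x :: "real ^ 'n"
    by (rule weighted_integrable_mult_bounded_support[OF weighted_integrable_abs[OF u(1)] u(2), where B = 1 and R = "norm x + 1 + r"])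
      (auto simp: indicator_def intro!: borel_measurable_indicator borel_closed)
  have iu: "integrable lborel (\<lambda>y. u y * mollifier r (x - y))" for x
    by (rule kernel_oscillation_bound(2)[OF u _ r, where x = x and C = C'])
      (use C'(1) in \<open>auto simp: abs_of_nonneg[OF mollifier_nonneg[OF r]] intro!: mollifier_eq_0[OF r]\<close>)
  have iG: "integrable lborel (\<lambda>y. u y * partial i (mollifier r) (x - y))" for i x
    by (rule kernel_oscillation_bound(2)[OF u _ r, where x = x and C = "C' / r"])
      (use C'(2) partial_mollifier_eq_0[OF r] in \<open>auto simp: mult.commute\<close>)
  \<comment> \<open>both increments below vanish for \<open>y\<close> outside the ball that defines \<open>M x\<close>\<close>
  have est: "\<bar>\<integral>y. u y * q y \<partial>lborel\<bar> \<le> B * M x"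
    if "integrable lborel (\<lambda>y. u y * q y)" "\<And>y. \<bar>q y\<bar> \<le> B" "\<And>y. norm x + 1 + r < norm y \<Longrightarrow> q y = 0" for q B x
  proof -
    have "\<bar>\<integral>y. u y * q y \<partial>lborel\<bar> \<le> (\<integral>y. \<bar>u y * q y\<bar> \<partial>lborel)" by simp
    also have "\<dots> \<le> (\<integral>y. B * (\<bar>u y\<bar> * indicator (cball 0 (norm x + 1 + r)) y) \<partial>lborel)"
    proof (rule integral_mono)
      fix y
      show "\<bar>u y * q y\<bar> \<le> B * (\<bar>u y\<bar> * indicator (cball 0 (norm x + 1 + r)) y)"
        using mult_left_mono[OF that(2)[of y] abs_ge_zero[of "u y"]] that(3)[of y]
        by (cases "norm y \<le> norm x + 1 + r") (auto simp: abs_mult mult.commute)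
    qed (use that(1) iM in auto)
    finally show ?thesis by (simp add: M_def)
  qed
  have remainder: "\<bar>mollify r u (x + h) - mollify r u x - (\<Sum>i\<in>UNIV. h $ i * G i x)\<bar> \<le> C * (norm h)\<^sup>2 * M x"
    if "norm h \<le> 1" for x h
  proof -
    let ?q = "\<lambda>y. mollifier r (x + h - y) - mollifier r (x - y) - (\<Sum>i\<in>UNIV. h $ i * partial i (mollifier r) (x - y))"
    have eq: "u y * ?q y = u y * mollifier r (x + h - y) - u y * mollifier r (x - y)
        - (\<Sum>i\<in>UNIV. h $ i * (u y * partial i (mollifier r) (x - y)))" for y
      by (simp add: algebra_simps sum_distrib_left)
    have iq: "integrable lborel (\<lambda>y. u y * ?q y)"
      unfolding eq by (intro Bochner_Integration.integrable_diff Bochner_Integration.integrable_sum integrable_mult_right iu iG)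
    have "(\<integral>y. u y * ?q y \<partial>lborel) = mollify r u (x + h) - mollify r u x - (\<Sum>i\<in>UNIV. h $ i * G i x)"
      unfolding eq by (simp add: iu iG mollify_def G_def Bochner_Integration.integral_sum)
    moreover have "\<bar>\<integral>y. u y * ?q y \<partial>lborel\<bar> \<le> C * (norm h)\<^sup>2 * M x"
    proof (rule est[OF iq])
      show "\<bar>?q y\<bar> \<le> C * (norm h)\<^sup>2" for y using C(3)[of "x - y" h] by (simp add: algebra_simps)
      fix y :: "real ^ 'n" assume "norm x + 1 + r < norm y"
      then have "r < norm (x + h - y)" "r < norm (x + 0 - y)"
        using near[of x h y] near[of x 0 y] that by force+
      then show "?q y = 0" using mollifier_eq_0[OF r, of "x + h - y"] mollifier_eq_0[OF r, of "x - y"]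
          partial_mollifier_eq_0[OF r, of "x - y"] by simp
    qed
    ultimately show ?thesis by simp
  qed
  have lip: "\<bar>G i (x + h) - G i x\<bar> \<le> C * norm h * M x" if "norm h \<le> 1" for i x h
  proof -
    let ?q = "\<lambda>y. partial i (mollifier r) (x + h - y) - partial i (mollifier r) (x - y)"
    have iq: "integrable lborel (\<lambda>y. u y * ?q y)" by (simp add: right_diff_distrib iG)
    have "(\<integral>y. u y * ?q y \<partial>lborel) = G i (x + h) - G i x"
      by (simp add: right_diff_distrib iG G_def)
    moreover have "\<bar>\<integral>y. u y * ?q y \<partial>lborel\<bar> \<le> C * norm h * M x"
    proof (rule est[OF iq])
      show "\<bar>?q y\<bar> \<le> C * norm h" for y using C(2)[of i "x + h - y" "x - y"] by simp
      fix y :: "real ^ 'n" assume "norm x + 1 + r < norm y"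
      then have "r < norm (x + h - y)" "r < norm (x + 0 - y)"
        using near[of x h y] near[of x 0 y] that by force+
      then show "?q y = 0"
        using partial_mollifier_eq_0[OF r, of "x + h - y" i] partial_mollifier_eq_0[OF r, of "x - y" i] by simp
    qed
    ultimately show ?thesis by simp
  qed
  have d: "(mollify r u has_derivative (\<lambda>h. \<Sum>i\<in>UNIV. h $ i * G i x)) (at x)" for x
  proof (rule has_derivativeI_sandwich[of 1 _ _ _ _ "\<lambda>y. C * norm (y - x) * M x"])
    show "bounded_linear (\<lambda>h. \<Sum>i\<in>UNIV. h $ i * G i x)"
      by (intro bounded_linear_sum bounded_linear_mult_const bounded_linear_vec_nth)
    show "((\<lambda>y. C * norm (y - x) * M x) \<longlongrightarrow> 0) (at x)"
      by (auto intro!: tendsto_eq_intros)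
    fix y assume "y \<noteq> x" "dist y x < 1"
    then show "norm (mollify r u y - mollify r u x - (\<Sum>i\<in>UNIV. (y - x) $ i * G i x)) / norm (y - x)
        \<le> C * norm (y - x) * M x"
      using remainder[of "y - x" x] by (simp add: dist_norm divide_le_eq power2_eq_square mult_ac)
  qed simp
  show "mollify r u differentiable (at x)" using d by (auto simp: differentiable_def)
  have p: "partial i (mollify r u) x = G i x" for i x
    using partial_has_derivative[OF d, of i x]
    by (simp add: axis_def if_distrib[of "\<lambda>a. a * _"] cong: if_cong)
  then show "partial i (mollify r u) x = (\<integral>y. u y * partial i (mollifier r) (x - y) \<partial>lborel)"
    by (simp add: G_def)
  have "isCont (G i) x" for x
  proof -
    have "(\<lambda>y. G i y - G i x) \<midarrow>x\<rightarrow> 0"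
    proof (rule Lim_null_comparison)
      show "\<forall>\<^sub>F y in at x. norm (G i y - G i x) \<le> C * norm (y - x) * M x"
        unfolding eventually_at using lip[of "_ - x" i x] by (intro exI[of _ 1]) (auto simp: dist_norm)
      show "((\<lambda>y. C * norm (y - x) * M x) \<longlongrightarrow> 0) (at x)" by (auto intro!: tendsto_eq_intros)
    qed
    then show ?thesis unfolding isCont_def by (simp add: LIM_zero_iff)
  qed
  moreover have "partial i (mollify r u) = G i" using p by (rule ext)
  ultimately show "continuous_on UNIV (partial i (mollify r u))"
    by (simp add: continuous_at_imp_continuous_on)
qed

section \<open>Truncations of the fractional Laplacian\<close>

definition trunc_kernel :: "real \<Rightarrow> real \<Rightarrow> 'a::real_normed_vector \<Rightarrow> real"
  where "trunc_kernel p e h = indicator {h. e < norm h} h / norm h powr p"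

text \<open>Away from the diagonal the kernel is bounded and integrable.  Hence the truncation acts pointwise on
  the whole weighted space, in particular on the maximum of two mollifications, whereas the operator
  itself acts pointwise on test functions only.\<close>

definition trunc_op :: "real \<Rightarrow> real \<Rightarrow> ('a::euclidean_space \<Rightarrow> real) \<Rightarrow> 'a \<Rightarrow> real"
  where "trunc_op p e \<phi> x = (\<integral>y. (\<phi> x - \<phi> y) * trunc_kernel p e (x - y) \<partial>lborel)"

text \<open>The symmetrized form of the principal value, which converges absolutely for \<open>C\<^sup>2\<close> functions
  of compact support.\<close>

definition nonlocal_op :: "real \<Rightarrow> ('a::euclidean_space \<Rightarrow> real) \<Rightarrow> 'a \<Rightarrow> real"
  where "nonlocal_op p \<phi> x = (\<integral>h. (\<phi> x - (\<phi> (x + h) + \<phi> (x - h)) / 2) / norm h powr p \<partial>lborel)"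

lemma trunc_kernel_nonneg: "0 \<le> trunc_kernel p e h"
  by (simp add: trunc_kernel_def)

lemma trunc_kernel_minus: "trunc_kernel p e (- h) = trunc_kernel p e h"
  by (simp add: trunc_kernel_def indicator_def)

lemma trunc_kernel_commute: "trunc_kernel p e (x - y) = trunc_kernel p e (y - x)"
  using trunc_kernel_minus[of p e "x - y"] by simp

lemma trunc_kernel_measurable [measurable]:
  "trunc_kernel p e \<in> borel_measurable (borel :: 'a::euclidean_space measure)"
  unfolding trunc_kernel_def[abs_def] by measurable

lemma integrable_trunc_kernel:
  "0 < e \<Longrightarrow> real DIM('a::euclidean_space) < p \<Longrightarrow> integrable lborel (trunc_kernel p e :: 'a \<Rightarrow> real)"
  unfolding trunc_kernel_def[abs_def] by (rule integrable_norm_powr_outside)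

text \<open>If \<open>|x - y| > e\<close> and \<open>|y| \<le> R\<close> then \<open>1 + |x| \<le> ((1 + R) / e + 1) |x - y|\<close>.\<close>

lemma trunc_kernel_le_weight:
  fixes x y :: "'a::euclidean_space"
  assumes "0 < e" "0 \<le> p" "norm y \<le> R"
  shows "trunc_kernel p e (x - y) \<le> ((1 + R) / e + 1) powr p * weight p x"
proof (cases "e < norm (x - y)")
  case True
  have R: "0 \<le> R" using assms(3) norm_ge_zero order_trans by blast
  have "1 + norm x \<le> 1 + R + norm (x - y)" using norm_triangle_ineq[of "x - y" y] assms(3) by simp
  also have "1 + R \<le> (1 + R) / e * norm (x - y)"
    using True assms(1) R mult_left_mono[of e "norm (x - y)" "(1 + R) / e"] by simp
  finally have "1 + norm x \<le> ((1 + R) / e + 1) * norm (x - y)" by (simp add: algebra_simps)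
  then have "(1 + norm x) powr p \<le> ((1 + R) / e + 1) powr p * norm (x - y) powr p"
    using assms R powr_mono2[OF assms(2), of "1 + norm x" "((1 + R) / e + 1) * norm (x - y)"] by (simp add: powr_mult)
  moreover have "0 < norm (x - y) powr p" using True assms(1) by (metis less_trans less_irrefl powr_gt_zero)
  moreover have "0 < (1 + norm x) powr p" by (smt (verit) norm_ge_zero powr_gt_zero)
  ultimately show ?thesis using True by (simp add: trunc_kernel_def weight_def powr_minus field_simps)
next
  case False
  then show ?thesis using weight_pos[of p x] by (simp add: trunc_kernel_def)
qed

lemma trunc_op_measurable [measurable]:
  fixes w :: "'a::euclidean_space \<Rightarrow> real"
  assumes [measurable]: "w \<in> borel_measurable borel"
  shows "trunc_op p e w \<in> borel_measurable borel"
  unfolding trunc_op_def[abs_def] by (rule borel_measurable_integral_lborel) measurable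

lemma integrable_kernel_translate:
  fixes x :: "'a::euclidean_space"
  assumes "0 < e" "real DIM('a) < p"
  shows "integrable lborel (\<lambda>y. trunc_kernel p e (x - y))"
  using integrable_reflect[of "trunc_kernel p e" x] integrable_trunc_kernel[OF assms] by simp

lemma integrable_weighted_kernel:
  fixes w :: "'a::euclidean_space \<Rightarrow> real"
  assumes "weighted_integrable p w" "0 < e" "0 \<le> p"
  shows "integrable lborel (\<lambda>y. w y * trunc_kernel p e (x - y))"
proof (rule weighted_integrable_mult[OF assms(1)])
  show "\<bar>trunc_kernel p e (x - y)\<bar> \<le> ((1 + norm x) / e + 1) powr p * weight p y" for y
    using trunc_kernel_le_weight[OF assms(2,3) order_refl, where x = y and y = x] trunc_kernel_nonneg[of p e "x - y"]
    by (simp add: trunc_kernel_commute[of p e x y])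
qed measurable

lemma integrable_trunc_op_integrand:
  fixes w :: "'a::euclidean_space \<Rightarrow> real"
  assumes "weighted_integrable p w" "0 < e" "real DIM('a) < p"
  shows "integrable lborel (\<lambda>y. (w x - w y) * trunc_kernel p e (x - y))"
  unfolding left_diff_distrib using assms
  by (intro Bochner_Integration.integrable_diff integrable_mult_right integrable_kernel_translate integrable_weighted_kernel) auto

lemma borel_measurable_pair_lborel:
  fixes f :: "'a::euclidean_space \<times> 'b::euclidean_space \<Rightarrow> real"
  assumes "f \<in> borel_measurable (borel \<Otimes>\<^sub>M borel)"
  shows "f \<in> borel_measurable (lborel \<Otimes>\<^sub>M lborel)"
proof -
  have "sets ((lborel :: 'a measure) \<Otimes>\<^sub>M (lborel :: 'b measure)) = sets (borel \<Otimes>\<^sub>M borel)"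
    by (intro sets_pair_measure_cong) auto
  then show ?thesis using assms measurable_cong_sets by blast
qed

text \<open>Every exchange of integrals below is justified by a majorant of this product type.\<close>

lemma integrable_pair_bound:
  fixes f :: "'a::euclidean_space \<times> 'a \<Rightarrow> real" and a :: "'a \<Rightarrow> real" and k :: "'a \<Rightarrow> 'a \<Rightarrow> real"
  assumes f: "f \<in> borel_measurable (borel \<Otimes>\<^sub>M borel)"
    and k: "(\<lambda>(x, y). k x y) \<in> borel_measurable (borel \<Otimes>\<^sub>M borel)"
    and a: "integrable lborel a"
    and nn: "\<And>x y. 0 \<le> k x y" and int: "\<And>x. integrable lborel (k x)" "\<And>x. integral\<^sup>L lborel (k x) = c"
    and le: "\<And>x y. \<bar>f (x, y)\<bar> \<le> \<bar>a x\<bar> * k x y"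
  shows "integrable (lborel \<Otimes>\<^sub>M lborel) f"
proof (rule Bochner_Integration.integrable_bound)
  have [measurable]: "a \<in> borel_measurable borel" using a by (simp add: borel_measurable_integrable)
  note [measurable] = k
  show "integrable (lborel \<Otimes>\<^sub>M lborel) (\<lambda>(x, y). \<bar>a x\<bar> * k x y)"
  proof (rule lborel_pair.Fubini_integrable)
    show "(\<lambda>(x, y). \<bar>a x\<bar> * k x y) \<in> borel_measurable (lborel \<Otimes>\<^sub>M lborel)"
      by (rule borel_measurable_pair_lborel) measurable
    have "(\<integral>y. norm (case (x, y) of (x, y) \<Rightarrow> \<bar>a x\<bar> * k x y) \<partial>lborel) = \<bar>a x\<bar> * c" for x
      using nn int by (simp add: abs_mult)
    then show "integrable lborel (\<lambda>x. \<integral>y. norm (case (x, y) of (x, y) \<Rightarrow> \<bar>a x\<bar> * k x y) \<partial>lborel)"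
      using a by simp
    show "AE x in lborel. integrable lborel (\<lambda>y. case (x, y) of (x, y) \<Rightarrow> \<bar>a x\<bar> * k x y)"
      using int(1) by simp
  qed
  show "f \<in> borel_measurable (lborel \<Otimes>\<^sub>M lborel)" by (rule borel_measurable_pair_lborel[OF f])
  show "AE z in lborel \<Otimes>\<^sub>M lborel. norm (f z) \<le> norm (case z of (x, y) \<Rightarrow> \<bar>a x\<bar> * k x y)"
    using le by (auto intro!: AE_I2 intro: order_trans[OF _ abs_ge_self])
qed

text \<open>The two halves of the difference are separately integrable on the product space: the first
  because the truncated kernel is integrable, the second because it is dominated by the weight where
  \<open>\<phi>\<close> does not vanish.\<close>

lemma trunc_op_self_adjoint:
  fixes w \<phi> :: "'a::euclidean_space \<Rightarrow> real"
  assumes w: "weighted_integrable p w" and e: "0 < e" and p: "real DIM('a) < p"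
    and \<phi>: "\<phi> \<in> borel_measurable borel" "\<And>x. \<bar>\<phi> x\<bar> \<le> B" "\<And>x. R < norm x \<Longrightarrow> \<phi> x = 0"
  shows "(\<integral>x. w x * trunc_op p e \<phi> x \<partial>lborel) = (\<integral>x. \<phi> x * trunc_op p e w x \<partial>lborel)"
    and "integrable lborel (\<lambda>x. \<phi> x * trunc_op p e w x)"
proof -
  have p0: "0 \<le> p" using p by simp
  have [measurable]: "w \<in> borel_measurable borel" using w by (simp add: weighted_integrable_def)
  note [measurable] = \<phi>(1)
  let ?K = "trunc_kernel p e :: 'a \<Rightarrow> real"
  have i\<phi>: "integrable lborel \<phi>" by (rule integrable_bounded_support[OF \<phi>])
  have iw\<phi>: "integrable lborel (\<lambda>x. w x * \<phi> x)"
    by (rule weighted_integrable_mult_bounded_support[OF w p0 \<phi>])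
  have K: "integrable lborel (\<lambda>y. ?K (x - y))" "(\<integral>y. ?K (x - y) \<partial>lborel) = integral\<^sup>L lborel ?K" for x :: 'a
    using integrable_kernel_translate[OF e p, of x] integral_reflect[of ?K x] by auto
  have P1: "integrable (lborel \<Otimes>\<^sub>M lborel) (\<lambda>(x, y). w x * \<phi> x * ?K (x - y))"
    by (rule integrable_pair_bound[where a = "\<lambda>x. w x * \<phi> x" and k = "\<lambda>x y. ?K (x - y)"])
      (use iw\<phi> K in \<open>auto simp: abs_mult trunc_kernel_nonneg abs_of_nonneg[OF trunc_kernel_nonneg]\<close>)
  have P2: "integrable (lborel \<Otimes>\<^sub>M lborel) (\<lambda>(x, y). w x * \<phi> y * ?K (x - y))"
  proof (rule integrable_pair_bound[where a = "\<lambda>x. ((1 + \<bar>R\<bar>) / e + 1) powr p * (w x * weight p x)" and k = "\<lambda>x y. \<bar>\<phi> y\<bar>"])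
    show "integrable lborel (\<lambda>x. ((1 + \<bar>R\<bar>) / e + 1) powr p * (w x * weight p x))"
      using w by (simp add: weighted_integrable_def)
    fix x y
    show "\<bar>case (x, y) of (x, y) \<Rightarrow> w x * \<phi> y * ?K (x - y)\<bar>
        \<le> \<bar>((1 + \<bar>R\<bar>) / e + 1) powr p * (w x * weight p x)\<bar> * \<bar>\<phi> y\<bar>"
    proof (cases "norm y \<le> R")
      case True
      then have "norm y \<le> \<bar>R\<bar>" by simp
      from mult_left_mono[OF trunc_kernel_le_weight[OF e p0 this, of x], of "\<bar>w x\<bar> * \<bar>\<phi> y\<bar>"]
      show ?thesis using trunc_kernel_nonneg[of p e "x - y"] weight_pos[of p x] by (simp add: abs_mult mult_ac)
    next
      case False
      then show ?thesis using \<phi>(3)[of y] by simp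
    qed
  qed (use i\<phi> in auto)
  have I: "integrable lborel (\<lambda>y. \<phi> y * ?K (x - y))" for x
  proof (rule Bochner_Integration.integrable_bound)
    show "integrable lborel (\<lambda>y. B * ?K (x - y))" by (intro integrable_mult_right K)
    show "AE y in lborel. norm (\<phi> y * ?K (x - y)) \<le> norm (B * ?K (x - y))"
      by (auto simp: abs_mult intro!: mult_right_mono order_trans[OF \<phi>(2) abs_ge_self])
  qed measurable
  have "(\<integral>x. w x * trunc_op p e \<phi> x \<partial>lborel)
      = (\<integral>x. (\<integral>y. w x * \<phi> x * ?K (x - y) \<partial>lborel) - (\<integral>y. w x * \<phi> y * ?K (x - y) \<partial>lborel) \<partial>lborel)"
  proof (rule Bochner_Integration.integral_cong[OF refl])
    fix x
    have "w x * trunc_op p e \<phi> x = (\<integral>y. w x * \<phi> x * ?K (x - y) - w x * (\<phi> y * ?K (x - y)) \<partial>lborel)"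
      by (simp add: trunc_op_def left_diff_distrib right_diff_distrib mult.assoc flip: integral_mult_right_zero)
    also have "\<dots> = (\<integral>y. w x * \<phi> x * ?K (x - y) \<partial>lborel) - (\<integral>y. w x * (\<phi> y * ?K (x - y)) \<partial>lborel)"
      by (intro Bochner_Integration.integral_diff integrable_mult_right K I)
    finally show "w x * trunc_op p e \<phi> x = (\<integral>y. w x * \<phi> x * ?K (x - y) \<partial>lborel) - (\<integral>y. w x * \<phi> y * ?K (x - y) \<partial>lborel)"
      by (simp add: mult.assoc)
  qed
  also have "\<dots> = (\<integral>x. (\<integral>y. w x * \<phi> x * ?K (x - y) \<partial>lborel) \<partial>lborel) - (\<integral>x. (\<integral>y. w x * \<phi> y * ?K (x - y) \<partial>lborel) \<partial>lborel)"
    by (intro Bochner_Integration.integral_diff lborel_pair.integrable_fst P1 P2)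
  also have "(\<integral>x. (\<integral>y. w x * \<phi> y * ?K (x - y) \<partial>lborel) \<partial>lborel) = (\<integral>x. (\<integral>y. w y * \<phi> x * ?K (y - x) \<partial>lborel) \<partial>lborel)"
    by (rule lborel_pair.Fubini_integral[OF P2, symmetric])
  finally have 1: "(\<integral>x. w x * trunc_op p e \<phi> x \<partial>lborel) = (\<integral>x. (\<integral>y. w x * \<phi> x * ?K (x - y) \<partial>lborel) \<partial>lborel)
      - (\<integral>x. (\<integral>y. w y * \<phi> x * ?K (y - x) \<partial>lborel) \<partial>lborel)" .
  have eq: "\<phi> x * trunc_op p e w x = (\<integral>y. w x * \<phi> x * ?K (x - y) \<partial>lborel) - (\<integral>y. w y * \<phi> x * ?K (y - x) \<partial>lborel)" for x
  proof -
    have "\<phi> x * trunc_op p e w x = (\<integral>y. w x * \<phi> x * ?K (x - y) - \<phi> x * (w y * ?K (x - y)) \<partial>lborel)"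
      by (simp add: trunc_op_def left_diff_distrib right_diff_distrib mult_ac flip: integral_mult_right_zero)
    also have "\<dots> = (\<integral>y. w x * \<phi> x * ?K (x - y) \<partial>lborel) - (\<integral>y. \<phi> x * (w y * ?K (x - y)) \<partial>lborel)"
      by (intro Bochner_Integration.integral_diff integrable_mult_right K integrable_weighted_kernel[OF w e p0])
    finally show ?thesis by (simp add: trunc_kernel_commute[of p e x] mult_ac)
  qed
  show "integrable lborel (\<lambda>x. \<phi> x * trunc_op p e w x)"
    unfolding eq by (intro Bochner_Integration.integrable_diff lborel_pair.integrable_fst P1 lborel_pair.integrable_snd[OF P2])
  show "(\<integral>x. w x * trunc_op p e \<phi> x \<partial>lborel) = (\<integral>x. \<phi> x * trunc_op p e w x \<partial>lborel)"
    unfolding 1 eq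
    by (intro Bochner_Integration.integral_diff[symmetric] lborel_pair.integrable_fst P1 lborel_pair.integrable_snd[OF P2])
qed

lemma trunc_op_shift:
  fixes \<phi> :: "'a::euclidean_space \<Rightarrow> real"
  assumes [measurable]: "\<phi> \<in> borel_measurable borel"
  shows "trunc_op p e \<phi> x = (\<integral>h. (\<phi> x - \<phi> (x - h)) * trunc_kernel p e h \<partial>lborel)"
    and "trunc_op p e \<phi> x = (\<integral>h. (\<phi> x - \<phi> (x + h)) * trunc_kernel p e h \<partial>lborel)"
proof -
  have m: "(\<lambda>y. (\<phi> x - \<phi> y) * trunc_kernel p e (x - y)) \<in> borel_measurable borel" by measurable
  show "trunc_op p e \<phi> x = (\<integral>h. (\<phi> x - \<phi> (x - h)) * trunc_kernel p e h \<partial>lborel)"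
    using integral_reflect[OF m, of x] by (simp add: trunc_op_def)
  show "trunc_op p e \<phi> x = (\<integral>h. (\<phi> x - \<phi> (x + h)) * trunc_kernel p e h \<partial>lborel)"
    using integral_translate[OF m, of x] by (simp add: trunc_op_def trunc_kernel_minus)
qed

text \<open>Truncation and mollification commute.  The operator ends up on the mollifier, so that the truncation
  can be removed on the right-hand side.\<close>

lemma trunc_op_mollify:
  fixes u :: "real ^ 'n::finite \<Rightarrow> real"
  assumes u: "weighted_integrable p u" and e: "0 < e" and p: "real CARD('n) < p" and r: "0 < r"
  shows "trunc_op p e (mollify r u) x = (\<integral>y. u y * trunc_op p e (mollifier r) (x - y) \<partial>lborel)"
proof -
  have p0: "0 \<le> p" and p': "real DIM(real ^ 'n) < p" using p by auto
  have [measurable]: "u \<in> borel_measurable borel" using u by (simp add: weighted_integrable_def)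
  let ?K = "trunc_kernel p e :: real ^ 'n \<Rightarrow> real" and ?\<rho> = "mollifier r :: real ^ 'n \<Rightarrow> real"
  let ?S = "norm x + r"
  obtain C' where C': "\<And>z. ?\<rho> (z :: real ^ 'n) \<le> C' / r ^ CARD('n)"
    by (rule mollifier_bounds[where 'n = 'n]) (use r in blast)
  have iu: "integrable lborel (\<lambda>y. u y * ?\<rho> (x - y))" for x
    by (rule kernel_oscillation_bound(2)[OF u p0 _ r, where x = x and C = C'])
      (use C' in \<open>auto simp: abs_of_nonneg[OF mollifier_nonneg[OF r]] intro!: mollifier_eq_0[OF r]\<close>)
  have i\<rho>: "integrable lborel (?\<rho> :: real ^ 'n \<Rightarrow> real)"
    by (rule integrable_bounded_support[OF _ _ mollifier_eq_0[OF r], where B = "C' / r ^ CARD('n)" and R = r])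
      (use C' in \<open>auto simp: abs_of_nonneg[OF mollifier_nonneg[OF r]]\<close>)
  have \<rho>h: "integrable lborel (\<lambda>h. ?\<rho> (z - h))" "(\<integral>h. ?\<rho> (z - h) \<partial>lborel) = 1" for z :: "real ^ 'n"
    using integrable_reflect[of ?\<rho> z] integral_reflect[of ?\<rho> z] i\<rho> integral_mollifier[OF r, where 'n = 'n] by auto
  note iK = integrable_trunc_kernel[OF e p']
  have P1: "integrable (lborel \<Otimes>\<^sub>M lborel) (\<lambda>(y, h). u y * ?\<rho> (x - y) * ?K h)"
    by (rule integrable_pair_bound[where a = "\<lambda>y. u y * ?\<rho> (x - y)" and k = "\<lambda>y h. ?K h"])
      (use iu iK in \<open>auto simp: abs_mult trunc_kernel_nonneg abs_of_nonneg[OF trunc_kernel_nonneg]\<close>)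
  have P2: "integrable (lborel \<Otimes>\<^sub>M lborel) (\<lambda>(y, h). u y * ?\<rho> (x - y - h) * ?K h)"
  proof (rule integrable_pair_bound[where a = "\<lambda>y. ((1 + ?S) / e + 1) powr p * (u y * weight p y)" and k = "\<lambda>y h. ?\<rho> (x - y - h)"])
    show "integrable lborel (\<lambda>y. ((1 + ?S) / e + 1) powr p * (u y * weight p y))"
      using u by (simp add: weighted_integrable_def)
    fix y h :: "real ^ 'n"
    show "\<bar>case (y, h) of (y, h) \<Rightarrow> u y * ?\<rho> (x - y - h) * ?K h\<bar>
        \<le> \<bar>((1 + ?S) / e + 1) powr p * (u y * weight p y)\<bar> * ?\<rho> (x - y - h)"
    proof (cases "norm (x - y - h) < r")
      case True
      have "norm (y + h) \<le> norm x + norm (x - y - h)"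
        using norm_triangle_ineq4[of x "x - y - h"] by simp
      then have "norm (y + h) \<le> ?S" using True by simp
      from mult_left_mono[OF trunc_kernel_le_weight[OF e p0 this, of y], of "\<bar>u y\<bar> * ?\<rho> (x - y - h)"]
      show ?thesis using trunc_kernel_nonneg[of p e h] weight_pos[of p y] mollifier_nonneg[OF r, of "x - y - h"]
        by (simp add: abs_mult mult_ac trunc_kernel_minus)
    next
      case False
      then have "?\<rho> (x - y - h) = 0" by (intro mollifier_eq_0[OF r]) simp
      then show ?thesis by simp
    qed
  qed (use \<rho>h mollifier_nonneg[OF r] in auto)
  have i2: "integrable lborel (\<lambda>h. ?\<rho> (z - h) * ?K h)" for z :: "real ^ 'n"
  proof (rule Bochner_Integration.integrable_bound[OF integrable_mult_right[OF iK, of "C' / r ^ CARD('n)"]])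
    show "AE h in lborel. norm (?\<rho> (z - h) * ?K h) \<le> norm (C' / r ^ CARD('n) * ?K h)"
    proof (rule AE_I2)
      fix h
      have "\<bar>?\<rho> (z - h)\<bar> \<le> \<bar>C' / r ^ CARD('n)\<bar>"
        using C'[of "z - h"] mollifier_nonneg[OF r, of "z - h"] by linarith
      from mult_right_mono[OF this abs_ge_zero[of "?K h"]]
      show "norm (?\<rho> (z - h) * ?K h) \<le> norm (C' / r ^ CARD('n) * ?K h)"
        by (simp only: real_norm_def abs_mult)
    qed
  qed measurable
  have "(\<integral>y. u y * trunc_op p e ?\<rho> (x - y) \<partial>lborel)
      = (\<integral>y. (\<integral>h. u y * ?\<rho> (x - y) * ?K h - u y * ?\<rho> (x - y - h) * ?K h \<partial>lborel) \<partial>lborel)"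
    by (simp add: trunc_op_shift(1) left_diff_distrib right_diff_distrib mult.assoc flip: integral_mult_right_zero)
  also have "\<dots> = (\<integral>h. (\<integral>y. u y * ?\<rho> (x - y) * ?K h - u y * ?\<rho> (x - y - h) * ?K h \<partial>lborel) \<partial>lborel)"
    by (rule lborel_pair.Fubini_integral[symmetric])
      (use Bochner_Integration.integrable_diff[OF P1 P2] in \<open>simp add: case_prod_unfold\<close>)
  also have "\<dots> = (\<integral>h. (mollify r u x - mollify r u (x - h)) * ?K h \<partial>lborel)"
  proof (rule Bochner_Integration.integral_cong[OF refl])
    fix h :: "real ^ 'n"
    have sw: "x - y - h = x - h - y" for y by simp
    show "(\<integral>y. u y * ?\<rho> (x - y) * ?K h - u y * ?\<rho> (x - y - h) * ?K h \<partial>lborel) = (mollify r u x - mollify r u (x - h)) * ?K h"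
      unfolding sw using iu[of x] iu[of "x - h"] by (simp add: mollify_def left_diff_distrib)
  qed
  also have "\<dots> = trunc_op p e (mollify r u) x" by (rule trunc_op_shift(1)[symmetric]) measurable
  finally show ?thesis by simp
qed

lemma trunc_op_symmetrized:
  fixes \<phi> :: "'a::euclidean_space \<Rightarrow> real"
  assumes \<phi> [measurable]: "\<phi> \<in> borel_measurable borel" and B: "\<And>x. \<bar>\<phi> x\<bar> \<le> B"
    and e: "0 < e" and p: "real DIM('a) < p"
  shows "trunc_op p e \<phi> x = (\<integral>h. (\<phi> x - (\<phi> (x + h) + \<phi> (x - h)) / 2) * trunc_kernel p e h \<partial>lborel)"
proof -
  note iK = integrable_trunc_kernel[OF e p]
  have i: "integrable lborel (\<lambda>h. g h * trunc_kernel p e h)"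
    if [measurable]: "g \<in> borel_measurable borel" and g: "\<And>h. \<bar>g h\<bar> \<le> B'" for g :: "'a \<Rightarrow> real" and B'
  proof (rule Bochner_Integration.integrable_bound[OF integrable_mult_right[OF iK, of B']])
    show "AE h in lborel. norm (g h * trunc_kernel p e h) \<le> norm (B' * trunc_kernel p e h)"
      using order_trans[OF g abs_ge_self] by (auto simp: abs_mult intro!: mult_right_mono)
  qed measurable
  have d: "\<bar>\<phi> x - \<phi> y\<bar> \<le> 2 * B" for x y using B[of x] B[of y] by linarith
  have i1: "integrable lborel (\<lambda>h. (\<phi> x - \<phi> (x - h)) * trunc_kernel p e h)" by (rule i[OF _ d]) measurable
  have i2: "integrable lborel (\<lambda>h. (\<phi> x - \<phi> (x + h)) * trunc_kernel p e h)" by (rule i[OF _ d]) measurable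
  have "trunc_op p e \<phi> x = ((\<integral>h. (\<phi> x - \<phi> (x - h)) * trunc_kernel p e h \<partial>lborel)
      + (\<integral>h. (\<phi> x - \<phi> (x + h)) * trunc_kernel p e h \<partial>lborel)) / 2"
    using trunc_op_shift[OF \<phi>, of p e x] by simp
  also have "\<dots> = (\<integral>h. ((\<phi> x - \<phi> (x - h)) * trunc_kernel p e h + (\<phi> x - \<phi> (x + h)) * trunc_kernel p e h) / 2 \<partial>lborel)"
    unfolding integral_divide_zero Bochner_Integration.integral_add[OF i1 i2] ..
  also have "\<dots> = (\<integral>h. (\<phi> x - (\<phi> (x + h) + \<phi> (x - h)) / 2) * trunc_kernel p e h \<partial>lborel)"
  proof (rule Bochner_Integration.integral_cong[OF refl])
    have "((a - c) * k + (a - b) * k) / 2 = (a - (b + c) / 2) * k" for a b c k :: real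
      by (simp add: field_simps)
    then show "((\<phi> x - \<phi> (x - h)) * trunc_kernel p e h + (\<phi> x - \<phi> (x + h)) * trunc_kernel p e h) / 2
        = (\<phi> x - (\<phi> (x + h) + \<phi> (x - h)) / 2) * trunc_kernel p e h" for h .
  qed
  finally show ?thesis .
qed

text \<open>After symmetrization the numerator is \<open>O(min 1 |h|\<^sup>2)\<close>, which is integrable against \<open>|h|\<^sup>-\<^sup>p\<close>
  exactly because \<open>n < p < n + 2\<close>; this gives convergence and a uniform bound.  Off the support of
  \<open>\<phi>\<close> the kernel is evaluated far from its singularity, whence the decay.\<close>

lemma trunc_op_limit:
  fixes \<phi> :: "real ^ 'n::finite \<Rightarrow> real"
  assumes C2: "Ck_on 2 UNIV \<phi>" and supp: "\<And>x. R < norm x \<Longrightarrow> \<phi> x = 0"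
    and p: "real CARD('n) < p" "p < real CARD('n) + 2"
  shows "((\<lambda>e. trunc_op p e \<phi> x) \<longlongrightarrow> nonlocal_op p \<phi> x) (at_right 0)"
    and "\<exists>C>0. \<forall>e x. 0 < e \<longrightarrow> \<bar>trunc_op p e \<phi> x\<bar> \<le> C * weight p x"
proof -
  have p': "real DIM(real ^ 'n) < p" and p0: "0 \<le> p" and p2: "p < real DIM(real ^ 'n) + 2" using p by auto
  have cont: "continuous_on UNIV \<phi>"
    by (rule Ck_on_2_continuous[OF C2])
  then have \<phi> [measurable]: "\<phi> \<in> borel_measurable borel" by (rule borel_measurable_continuous_onI)
  obtain B where B: "0 < B" "\<And>x. \<bar>\<phi> x\<bar> \<le> B"
    using continuous_compact_support_bounded[OF cont supp] by (metis real_norm_def)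
  obtain C where C: "0 < C"
    "\<And>x y i. \<bar>partial i \<phi> x - partial i \<phi> y\<bar> \<le> C * norm (x - y)"
    "\<And>x h. \<bar>\<phi> (x + h) - \<phi> x - (\<Sum>i\<in>UNIV. h $ i * partial i \<phi> x)\<bar> \<le> C * (norm h)\<^sup>2"
    by (rule Taylor_quadratic_bound[OF C2 supp]) auto
  let ?D = "\<lambda>x h. \<phi> x - (\<phi> (x + h) + \<phi> (x - h)) / 2"
  have D1: "\<bar>?D x h\<bar> \<le> C * (norm h)\<^sup>2" for x h
    using C(3)[of x h] C(3)[of x "- h"] by (simp add: sum_negf abs_le_iff field_simps)
  have D2: "\<bar>?D x h\<bar> \<le> 2 * B" for x h
    using B(2)[of x] B(2)[of "x + h"] B(2)[of "x - h"] by (simp add: abs_le_iff field_simps)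
  define G :: "real ^ 'n \<Rightarrow> real" where "G h = C * (indicator (cball 0 1) h * (norm h)\<^sup>2 / norm h powr p)
    + 2 * B * (indicator {h. 1 / 2 < norm h} h / norm h powr p)" for h
  have G: "integrable lborel G"
    unfolding G_def by (intro Bochner_Integration.integrable_add integrable_mult_right
      integrable_norm_powr_inside[OF p0 p2] integrable_norm_powr_outside[OF _ p']) simp
  have DG: "\<bar>?D x h / norm h powr p\<bar> \<le> G h" for x h
  proof (cases "norm h \<le> 1")
    case True
    have "\<bar>?D x h / norm h powr p\<bar> \<le> C * ((norm h)\<^sup>2 / norm h powr p)"
      using divide_right_mono[OF D1, of "norm h powr p" x h] by (simp add: abs_divide)
    also have "\<dots> \<le> G h" using True B(1) by (simp add: G_def)
    finally show ?thesis .
  next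
    case False
    have "\<bar>?D x h / norm h powr p\<bar> \<le> 2 * B * (1 / norm h powr p)"
      using divide_right_mono[OF D2, of "norm h powr p" x h] by (simp add: abs_divide)
    also have "\<dots> = G h" using False by (simp add: G_def)
    finally show ?thesis .
  qed
  have K: "?D x h * trunc_kernel p e h = indicator {h. e < norm h} h * (?D x h / norm h powr p)" for x h e
    by (simp add: trunc_kernel_def)
  have KG: "\<bar>?D x h * trunc_kernel p e h\<bar> \<le> G h" for x h e
    unfolding K using DG[of x h] order_trans[OF abs_ge_zero DG, of h] by (auto simp: indicator_def)
  show "((\<lambda>e. trunc_op p e \<phi> x) \<longlongrightarrow> nonlocal_op p \<phi> x) (at_right 0)"
  proof (rule tendsto_at_right_sequentially[of 0 1])
    fix e :: "nat \<Rightarrow> real" assume e: "\<And>n. 0 < e n" "e \<longlonglongrightarrow> 0"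
    have "(\<lambda>n. \<integral>h. ?D x h * trunc_kernel p (e n) h \<partial>lborel) \<longlonglongrightarrow> nonlocal_op p \<phi> x"
      unfolding nonlocal_op_def
    proof (rule integral_dominated_convergence[OF _ _ G])
      show "AE h in lborel. (\<lambda>n. ?D x h * trunc_kernel p (e n) h) \<longlonglongrightarrow> ?D x h / norm h powr p"
      proof (rule AE_I2)
        fix h :: "real ^ 'n"
        show "(\<lambda>n. ?D x h * trunc_kernel p (e n) h) \<longlonglongrightarrow> ?D x h / norm h powr p"
        proof (cases "h = 0")
          case False
          then have "\<forall>\<^sub>F n in sequentially. e n < norm h" using order_tendstoD(2)[OF e(2), of "norm h"] by simp
          then have "\<forall>\<^sub>F n in sequentially. ?D x h * trunc_kernel p (e n) h = ?D x h / norm h powr p"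
            by eventually_elim (simp add: trunc_kernel_def)
          then show ?thesis by (rule tendsto_eventually)
        qed simp
      qed
      show "AE h in lborel. norm (?D x h * trunc_kernel p (e n) h) \<le> G h" for n
        using KG by simp
    qed measurable
    then show "(\<lambda>n. trunc_op p (e n) \<phi> x) \<longlonglongrightarrow> nonlocal_op p \<phi> x"
      using trunc_op_symmetrized[OF \<phi> B(2) e(1) p'] by simp
  qed simp
  define A where "A = integral\<^sup>L lborel G"
  have bnd: "\<bar>trunc_op p e \<phi> x\<bar> \<le> A" if "0 < e" for e x
  proof -
    have i: "integrable lborel (\<lambda>h. ?D x h * trunc_kernel p e h)"
      by (rule Bochner_Integration.integrable_bound[OF G]) (use KG in \<open>auto intro!: AE_I2 order_trans[OF KG abs_ge_self]\<close>)
    have "\<bar>trunc_op p e \<phi> x\<bar> \<le> (\<integral>h. \<bar>?D x h * trunc_kernel p e h\<bar> \<partial>lborel)"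
      unfolding trunc_op_symmetrized[OF \<phi> B(2) that p'] by simp
    also have "\<dots> \<le> A" unfolding A_def by (rule integral_mono[OF _ G]) (use i KG in auto)
    finally show ?thesis .
  qed
  have i\<phi>: "integrable lborel \<phi>" by (rule integrable_bounded_support[OF \<phi> B(2) supp])
  define I where "I = (\<integral>y. \<bar>\<phi> y\<bar> \<partial>lborel)"
  have I0: "0 \<le> I" unfolding I_def by (intro integral_nonneg_AE) simp
  have A0: "0 \<le> A" using bnd[of 1 0] by linarith
  define S where "S = max 1 (2 * R)"
  have far: "\<bar>trunc_op p e \<phi> x\<bar> \<le> 4 powr p * I * weight p x" if "0 < e" "S < norm x" for e x
  proof -
    have x: "1 < norm x" "2 * R < norm x" using that by (auto simp: S_def)
    have "\<phi> x = 0" using x supp[of x] by (cases "0 \<le> R") auto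
    have le: "\<bar>(\<phi> x - \<phi> y) * trunc_kernel p e (x - y)\<bar> \<le> 4 powr p * weight p x * \<bar>\<phi> y\<bar>" for y
    proof (cases "norm y \<le> R")
      case True
      have "norm x \<le> norm (x - y) + norm y" using norm_triangle_ineq[of "x - y" y] by simp
      then have n: "1 + norm x \<le> 4 * norm (x - y)" using True x by linarith
      then have "(1 + norm x) powr p \<le> 4 powr p * norm (x - y) powr p"
        using powr_mono2[OF p0 _ n] by (simp add: powr_mult)
      moreover have "0 < (1 + norm x) powr p" "0 < norm (x - y) powr p" using n x by (smt (verit) powr_gt_zero)+
      ultimately have "1 / norm (x - y) powr p \<le> 4 powr p * weight p x"
        by (simp add: weight_def powr_minus field_simps)
      then have "trunc_kernel p e (x - y) \<le> 4 powr p * weight p x"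
        using weight_pos[of p x] by (auto simp: trunc_kernel_def indicator_def)
      from mult_right_mono[OF this, of "\<bar>\<phi> y\<bar>"] show ?thesis
        using trunc_kernel_nonneg[of p e "x - y"] \<open>\<phi> x = 0\<close> by (simp add: abs_mult mult.commute)
    next
      case False
      then show ?thesis using supp[of y] \<open>\<phi> x = 0\<close> by simp
    qed
    have i: "integrable lborel (\<lambda>y. (\<phi> x - \<phi> y) * trunc_kernel p e (x - y))"
      by (rule Bochner_Integration.integrable_bound[OF integrable_mult_right[OF integrable_abs[OF i\<phi>], of "4 powr p * weight p x"]])
        (auto intro!: AE_I2 order_trans[OF le abs_ge_self])
    have "\<bar>trunc_op p e \<phi> x\<bar> \<le> (\<integral>y. \<bar>(\<phi> x - \<phi> y) * trunc_kernel p e (x - y)\<bar> \<partial>lborel)"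
      unfolding trunc_op_def by simp
    also have "\<dots> \<le> (\<integral>y. 4 powr p * weight p x * \<bar>\<phi> y\<bar> \<partial>lborel)"
      by (rule integral_mono) (use i i\<phi> le in auto)
    also have "\<dots> = 4 powr p * I * weight p x" by (simp add: I_def)
    finally show ?thesis .
  qed
  define C' where "C' = (1 + S) powr p * A + 4 powr p * I + 1"
  have "\<bar>trunc_op p e \<phi> x\<bar> \<le> C' * weight p x" if "0 < e" for e x
  proof (cases "norm x \<le> S")
    case True
    have "A \<le> A * ((1 + S) powr p * weight p x)"
      using mult_left_mono[OF weight_lower_bound[OF p0 True] A0] by simp
    also have "\<dots> \<le> C' * weight p x"
      using I0 weight_pos[of p x] by (simp add: C'_def algebra_simps)
    finally show ?thesis using bnd[OF that, of x] by linarith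
  next
    case False
    have "4 powr p * I * weight p x \<le> C' * weight p x"
      using A0 weight_pos[of p x] by (intro mult_right_mono) (auto simp: C'_def)
    then show ?thesis using far[OF that, of x] False by linarith
  qed
  moreover have "0 < C'" using A0 I0 by (simp add: C'_def add_nonneg_pos)
  ultimately show "\<exists>C>0. \<forall>e x. 0 < e \<longrightarrow> \<bar>trunc_op p e \<phi> x\<bar> \<le> C * weight p x" by blast
qed

lemma trunc_op_sequence:
  fixes \<phi> :: "real ^ 'n::finite \<Rightarrow> real"
  assumes "Ck_on 2 UNIV \<phi>" "\<And>x. R < norm x \<Longrightarrow> \<phi> x = 0" "real CARD('n) < p" "p < real CARD('n) + 2"
  shows "(\<lambda>k. trunc_op p (1 / real (Suc k)) \<phi> x) \<longlonglongrightarrow> nonlocal_op p \<phi> x"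
proof -
  have "filterlim (\<lambda>k. 1 / real (Suc k)) (at_right 0) sequentially"
    unfolding filterlim_at
    using LIMSEQ_inverse_real_of_nat by (auto simp: inverse_eq_divide)
  from filterlim_compose[OF trunc_op_limit(1)[OF assms] this] show ?thesis .
qed

lemma
  fixes \<phi> :: "real ^ 'n::finite \<Rightarrow> real"
  assumes C2: "Ck_on 2 UNIV \<phi>" and supp: "\<And>x. R < norm x \<Longrightarrow> \<phi> x = 0"
    and p: "real CARD('n) < p" "p < real CARD('n) + 2"
  shows nonlocal_op_measurable: "nonlocal_op p \<phi> \<in> borel_measurable borel"
    and nonlocal_op_decay: "\<exists>C>0. \<forall>x. \<bar>nonlocal_op p \<phi> x\<bar> \<le> C * weight p x"
proof -
  have cont: "continuous_on UNIV \<phi>"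
    by (rule Ck_on_2_continuous[OF C2])
  then have [measurable]: "\<phi> \<in> borel_measurable borel" by (rule borel_measurable_continuous_onI)
  show "nonlocal_op p \<phi> \<in> borel_measurable borel"
    by (rule borel_measurable_LIMSEQ_real[OF trunc_op_sequence[OF assms]]) measurable
  obtain C where C: "C > 0" "\<And>e x. 0 < e \<Longrightarrow> \<bar>trunc_op p e \<phi> x\<bar> \<le> C * weight p x"
    using trunc_op_limit(2)[OF assms] by blast
  have "\<bar>nonlocal_op p \<phi> x\<bar> \<le> C * weight p x" for x
    by (rule LIMSEQ_le_const2[OF tendsto_rabs[OF trunc_op_sequence[OF assms]]]) (use C in auto)
  with C(1) show "\<exists>C>0. \<forall>x. \<bar>nonlocal_op p \<phi> x\<bar> \<le> C * weight p x" by blast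
qed

lemma weighted_trunc_op_limit:
  fixes \<phi> w :: "real ^ 'n::finite \<Rightarrow> real"
  assumes \<phi>: "Ck_on 2 UNIV \<phi>" "\<And>x. R < norm x \<Longrightarrow> \<phi> x = 0"
    and p: "real CARD('n) < p" "p < real CARD('n) + 2" and w: "weighted_integrable p w"
  shows "(\<lambda>k. \<integral>y. w y * trunc_op p (1 / real (Suc k)) \<phi> (a - y) \<partial>lborel)
      \<longlonglongrightarrow> (\<integral>y. w y * nonlocal_op p \<phi> (a - y) \<partial>lborel)" (is ?lim)
    and "(\<lambda>k. \<integral>y. w y * trunc_op p (1 / real (Suc k)) \<phi> y \<partial>lborel)
      \<longlonglongrightarrow> (\<integral>y. w y * nonlocal_op p \<phi> y \<partial>lborel)" (is ?lim')
    and "\<exists>C>0. \<forall>k a. \<bar>\<integral>y. w y * trunc_op p (1 / real (Suc k)) \<phi> (a - y) \<partial>lborel\<bar> \<le> C * (1 + norm a) powr p"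
proof -
  have p0: "0 \<le> p" using p by simp
  have cont: "continuous_on UNIV \<phi>"
    by (rule Ck_on_2_continuous[OF \<phi>(1)])
  then have [measurable]: "\<phi> \<in> borel_measurable borel" by (rule borel_measurable_continuous_onI)
  have [measurable]: "w \<in> borel_measurable borel" using w by (simp add: weighted_integrable_def)
  note [measurable] = nonlocal_op_measurable[OF \<phi> p]
  obtain C where C: "C > 0" "\<And>e x. 0 < e \<Longrightarrow> \<bar>trunc_op p e \<phi> x\<bar> \<le> C * weight p x"
    using trunc_op_limit(2)[OF \<phi> p] by blast
  have iw: "integrable lborel (\<lambda>y. c * \<bar>w y * weight p y\<bar>)" for c
    using w by (simp add: weighted_integrable_def)
  have le': "\<bar>w y * trunc_op p (1 / real (Suc k)) \<phi> y\<bar> \<le> C * \<bar>w y * weight p y\<bar>" for k y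
    using mult_left_mono[OF C(2)[of "1 / real (Suc k)" y], of "\<bar>w y\<bar>"] weight_pos[of p y]
    by (simp add: abs_mult mult_ac)
  have le: "\<bar>w y * trunc_op p (1 / real (Suc k)) \<phi> (a - y)\<bar> \<le> C * (1 + norm a) powr p * \<bar>w y * weight p y\<bar>" for k y a
  proof -
    have "weight p (a - y) \<le> (1 + norm a) powr p * weight p y"
      using weight_translate[OF p0, of "a - y" "- a"] by (simp add: weight_def)
    then have "\<bar>trunc_op p (1 / real (Suc k)) \<phi> (a - y)\<bar> \<le> C * ((1 + norm a) powr p * weight p y)"
      using mult_left_mono[of "weight p (a - y)" _ C] C(1) by (intro order_trans[OF C(2)]) auto
    from mult_left_mono[OF this, of "\<bar>w y\<bar>"] show ?thesis
      using weight_pos[of p y] by (simp add: abs_mult mult_ac)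
  qed
  show ?lim
  proof (rule integral_dominated_convergence[OF _ _ iw])
    show "AE y in lborel. (\<lambda>k. w y * trunc_op p (1 / real (Suc k)) \<phi> (a - y)) \<longlonglongrightarrow> w y * nonlocal_op p \<phi> (a - y)"
      by (intro AE_I2 tendsto_mult tendsto_const trunc_op_sequence[OF \<phi> p])
    show "AE y in lborel. norm (w y * trunc_op p (1 / real (Suc k)) \<phi> (a - y)) \<le> C * (1 + norm a) powr p * \<bar>w y * weight p y\<bar>" for k
      using le by simp
  qed measurable
  show ?lim'
  proof (rule integral_dominated_convergence[OF _ _ iw])
    show "AE y in lborel. (\<lambda>k. w y * trunc_op p (1 / real (Suc k)) \<phi> y) \<longlonglongrightarrow> w y * nonlocal_op p \<phi> y"
      by (intro AE_I2 tendsto_mult tendsto_const trunc_op_sequence[OF \<phi> p])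
    show "AE y in lborel. norm (w y * trunc_op p (1 / real (Suc k)) \<phi> y) \<le> C * \<bar>w y * weight p y\<bar>" for k
      using le' by simp
  qed measurable
  define I where "I = (\<integral>y. \<bar>w y * weight p y\<bar> \<partial>lborel)"
  have I0: "0 \<le> I" unfolding I_def by (intro integral_nonneg_AE) simp
  have "\<bar>\<integral>y. w y * trunc_op p (1 / real (Suc k)) \<phi> (a - y) \<partial>lborel\<bar> \<le> (C * I + 1) * (1 + norm a) powr p" for k a
  proof -
    have i: "integrable lborel (\<lambda>y. w y * trunc_op p (1 / real (Suc k)) \<phi> (a - y))"
      by (rule Bochner_Integration.integrable_bound[OF iw[of "C * (1 + norm a) powr p"]])
        (measurable, simp only: real_norm_def, intro AE_I2 order_trans[OF le abs_ge_self])
    have "\<bar>\<integral>y. w y * trunc_op p (1 / real (Suc k)) \<phi> (a - y) \<partial>lborel\<bar>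
        \<le> (\<integral>y. \<bar>w y * trunc_op p (1 / real (Suc k)) \<phi> (a - y)\<bar> \<partial>lborel)" by simp
    also have "\<dots> \<le> (\<integral>y. C * (1 + norm a) powr p * \<bar>w y * weight p y\<bar> \<partial>lborel)"
      by (rule integral_mono[OF integrable_abs[OF i] iw le])
    also have "\<dots> = C * I * (1 + norm a) powr p" by (simp add: I_def)
    also have "\<dots> \<le> (C * I + 1) * (1 + norm a) powr p" by (intro mult_right_mono) auto
    finally show ?thesis .
  qed
  moreover have "0 < C * I + 1" using C(1) I0 by (simp add: add_nonneg_pos)
  ultimately show "\<exists>C>0. \<forall>k a. \<bar>\<integral>y. w y * trunc_op p (1 / real (Suc k)) \<phi> (a - y) \<partial>lborel\<bar> \<le> C * (1 + norm a) powr p"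
    by blast
qed

text \<open>The pointwise Kato inequality: convexity of the maximum, applied under the integral.\<close>

lemma trunc_op_max_le:
  fixes U V :: "'a::euclidean_space \<Rightarrow> real"
  assumes U: "weighted_integrable p U" and V: "weighted_integrable p V"
    and e: "0 < e" and p: "real DIM('a) < p" and t: "0 \<le> t" "t \<le> 1"
    and eq: "t * U x + (1 - t) * V x = max (U x) (V x)"
  shows "trunc_op p e (\<lambda>x. max (U x) (V x)) x \<le> t * trunc_op p e U x + (1 - t) * trunc_op p e V x"
proof -
  note iU = integrable_trunc_op_integrand[OF U e p, of x] and iV = integrable_trunc_op_integrand[OF V e p, of x]
    and iW = integrable_trunc_op_integrand[OF weighted_integrable_max[OF U V] e p, of x]
  have "trunc_op p e (\<lambda>x. max (U x) (V x)) x
      \<le> (\<integral>y. t * ((U x - U y) * trunc_kernel p e (x - y)) + (1 - t) * ((V x - V y) * trunc_kernel p e (x - y)) \<partial>lborel)"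
    unfolding trunc_op_def
  proof (rule integral_mono[OF iW])
    show "integrable lborel (\<lambda>y. t * ((U x - U y) * trunc_kernel p e (x - y)) + (1 - t) * ((V x - V y) * trunc_kernel p e (x - y)))"
      by (intro Bochner_Integration.integrable_add integrable_mult_right iU iV)
    fix y
    have "t * U y \<le> t * max (U y) (V y)" "(1 - t) * V y \<le> (1 - t) * max (U y) (V y)"
      using t by (auto intro!: mult_left_mono)
    then have "t * U y + (1 - t) * V y \<le> max (U y) (V y)" by (simp add: algebra_simps)
    then have "max (U x) (V x) - max (U y) (V y) \<le> t * (U x - U y) + (1 - t) * (V x - V y)"
      unfolding eq[symmetric] by (simp add: algebra_simps)
    from mult_right_mono[OF this trunc_kernel_nonneg[of p e "x - y"]]
    show "(max (U x) (V x) - max (U y) (V y)) * trunc_kernel p e (x - y)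
        \<le> t * ((U x - U y) * trunc_kernel p e (x - y)) + (1 - t) * ((V x - V y) * trunc_kernel p e (x - y))"
      by (simp add: algebra_simps)
  qed
  also have "\<dots> = t * trunc_op p e U x + (1 - t) * trunc_op p e V x"
    using iU iV by (simp add: trunc_op_def)
  finally show ?thesis .
qed

text \<open>For the truncations one may integrate the pointwise inequality against \<open>\<phi>\<close> and move the operator to
  \<open>\<phi>\<close> on the left and to the mollifiers on the right; only then is the truncation removed.  The weight
  \<open>\<theta>\<close> is never differentiated, so it may jump where the two mollifications agree.\<close>

lemma nonlocal_Kato:
  fixes u v \<phi> \<theta> :: "real ^ 'n::finite \<Rightarrow> real"
  assumes u: "weighted_integrable p u" and v: "weighted_integrable p v" and r: "0 < r"
    and U: "weighted_integrable p (mollify r u)" and V: "weighted_integrable p (mollify r v)"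
    and p: "real CARD('n) < p" "p < real CARD('n) + 2"
    and \<phi>: "Ck_on 2 UNIV \<phi>" "\<And>x. R < norm x \<Longrightarrow> \<phi> x = 0" "\<And>x. 0 \<le> \<phi> x"
    and \<theta> [measurable]: "\<theta> \<in> borel_measurable borel" and \<theta>01: "\<And>x. 0 \<le> \<theta> x" "\<And>x. \<theta> x \<le> 1"
    and \<theta>max: "\<And>x. \<theta> x * mollify r u x + (1 - \<theta> x) * mollify r v x = max (mollify r u x) (mollify r v x)"
  defines "A \<equiv> \<lambda>u x. \<integral>y. u y * nonlocal_op p (mollifier r) (x - y) \<partial>lborel"
  shows "(\<integral>x. max (mollify r u x) (mollify r v x) * nonlocal_op p \<phi> x \<partial>lborel)
      \<le> (\<integral>x. \<phi> x * (\<theta> x * A u x + (1 - \<theta> x) * A v x) \<partial>lborel)"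
    and "integrable lborel (\<lambda>x. \<phi> x * (\<theta> x * A u x + (1 - \<theta> x) * A v x))"
proof -
  have p': "real DIM(real ^ 'n) < p" and p0: "0 \<le> p" using p by auto
  let ?e = "\<lambda>k. 1 / real (Suc k)" and ?U = "mollify r u" and ?V = "mollify r v"
  let ?W = "\<lambda>x. max (?U x) (?V x)"
  have [measurable]: "u \<in> borel_measurable borel" "v \<in> borel_measurable borel"
    using u v by (simp_all add: weighted_integrable_def)
  have cont: "continuous_on UNIV \<phi>"
    by (rule Ck_on_2_continuous[OF \<phi>(1)])
  then have m\<phi> [measurable]: "\<phi> \<in> borel_measurable borel" by (rule borel_measurable_continuous_onI)
  obtain B where B: "0 < B" "\<And>x. \<bar>\<phi> x\<bar> \<le> B"
    using continuous_compact_support_bounded[OF cont \<phi>(2)] by (metis real_norm_def)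
  note \<rho>2 = Ck_on_mollifier_0[OF r, of 2] and \<rho>0 = mollifier_eq_0[OF r, OF less_imp_le]
  have lim: "(\<lambda>k. trunc_op p (?e k) (mollify r w) x) \<longlonglongrightarrow> A w x" if "weighted_integrable p w" for w x
    using weighted_trunc_op_limit(1)[OF \<rho>2 \<rho>0 p that, where a = x]
    by (simp add: A_def trunc_op_mollify[OF that _ p(1) r])
  have A_meas: "A w \<in> borel_measurable borel" if "weighted_integrable p w" for w
  proof (rule borel_measurable_LIMSEQ_real[OF lim[OF that]])
    have [measurable]: "w \<in> borel_measurable borel" using that by (simp add: weighted_integrable_def)
    show "trunc_op p (?e k) (mollify r w) \<in> borel_measurable borel" for k by measurable
  qed
  note [measurable] = A_meas[OF u] A_meas[OF v]
  obtain Cu where Cu: "\<And>k a. \<bar>\<integral>y. u y * trunc_op p (?e k) (mollifier r) (a - y) \<partial>lborel\<bar> \<le> Cu * (1 + norm a) powr p" "0 < Cu"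
    using weighted_trunc_op_limit(3)[OF \<rho>2 \<rho>0 p u] by blast
  obtain Cv where Cv: "\<And>k a. \<bar>\<integral>y. v y * trunc_op p (?e k) (mollifier r) (a - y) \<partial>lborel\<bar> \<le> Cv * (1 + norm a) powr p" "0 < Cv"
    using weighted_trunc_op_limit(3)[OF \<rho>2 \<rho>0 p v] by blast
  let ?rhs = "\<lambda>k x. \<phi> x * (\<theta> x * trunc_op p (?e k) ?U x + (1 - \<theta> x) * trunc_op p (?e k) ?V x)"
  let ?dom = "\<lambda>x. B * ((Cu + Cv) * (1 + \<bar>R\<bar>) powr p) * indicator (cball (0 :: real ^ 'n) R) x"
  have idom: "integrable lborel ?dom"
    using emeasure_lborel_cball_finite[of "0 :: real ^ 'n" R]
    by (intro integrable_mult_right integrable_real_indicator) auto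
  have le: "\<bar>?rhs k x\<bar> \<le> ?dom x" for k x
  proof (cases "norm x \<le> R")
    case True
    have tU: "\<bar>trunc_op p (?e k) ?U x\<bar> \<le> Cu * (1 + norm x) powr p"
      using Cu(1)[where k = k and a = x] by (simp add: trunc_op_mollify[OF u _ p(1) r])
    have tV: "\<bar>trunc_op p (?e k) ?V x\<bar> \<le> Cv * (1 + norm x) powr p"
      using Cv(1)[where k = k and a = x] by (simp add: trunc_op_mollify[OF v _ p(1) r])
    have "\<bar>\<theta> x * trunc_op p (?e k) ?U x + (1 - \<theta> x) * trunc_op p (?e k) ?V x\<bar>
        \<le> \<bar>trunc_op p (?e k) ?U x\<bar> + \<bar>trunc_op p (?e k) ?V x\<bar>"
      using \<theta>01[of x] by (intro order_trans[OF abs_triangle_ineq] add_mono) (auto simp: abs_mult intro!: mult_left_le_one_le)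
    also have "\<dots> \<le> (Cu + Cv) * (1 + norm x) powr p" using tU tV by (simp add: algebra_simps)
    also have "\<dots> \<le> (Cu + Cv) * (1 + \<bar>R\<bar>) powr p"
      using True p0 Cu(2) Cv(2) by (intro mult_left_mono powr_mono2) auto
    finally have "\<bar>\<phi> x\<bar> * \<bar>\<theta> x * trunc_op p (?e k) ?U x + (1 - \<theta> x) * trunc_op p (?e k) ?V x\<bar>
        \<le> B * ((Cu + Cv) * (1 + \<bar>R\<bar>) powr p)"
      using B by (intro mult_mono) auto
    then show ?thesis using True by (simp add: abs_mult)
  next
    case False
    then show ?thesis using \<phi>(2)[of x] by simp
  qed
  have irhs: "integrable lborel (?rhs k)" for k
    by (rule Bochner_Integration.integrable_bound[OF idom])
      (measurable, simp only: real_norm_def, intro AE_I2 order_trans[OF le abs_ge_self])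
  have pw: "(\<lambda>k. ?rhs k x) \<longlonglongrightarrow> \<phi> x * (\<theta> x * A u x + (1 - \<theta> x) * A v x)" for x
    by (intro tendsto_intros lim u v)
  have dc: "AE x in lborel. (\<lambda>k. ?rhs k x) \<longlonglongrightarrow> \<phi> x * (\<theta> x * A u x + (1 - \<theta> x) * A v x)"
    "\<And>k. AE x in lborel. norm (?rhs k x) \<le> ?dom x"
    using pw le by simp_all
  show "integrable lborel (\<lambda>x. \<phi> x * (\<theta> x * A u x + (1 - \<theta> x) * A v x))"
    by (rule integrable_dominated_convergence[OF _ _ idom dc]) measurable
  have rhs: "(\<lambda>k. integral\<^sup>L lborel (?rhs k)) \<longlonglongrightarrow> (\<integral>x. \<phi> x * (\<theta> x * A u x + (1 - \<theta> x) * A v x) \<partial>lborel)"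
    by (rule integral_dominated_convergence[OF _ _ idom dc]) measurable
  have W: "weighted_integrable p ?W" by (rule weighted_integrable_max[OF U V])
  have lhs: "(\<lambda>k. \<integral>x. ?W x * trunc_op p (?e k) \<phi> x \<partial>lborel) \<longlonglongrightarrow> (\<integral>x. ?W x * nonlocal_op p \<phi> x \<partial>lborel)"
    by (rule weighted_trunc_op_limit(2)[OF \<phi>(1,2) p W])
  have "(\<integral>x. ?W x * trunc_op p (?e k) \<phi> x \<partial>lborel) \<le> integral\<^sup>L lborel (?rhs k)" for k
  proof -
    have e: "0 < ?e k" by simp
    have "(\<integral>x. ?W x * trunc_op p (?e k) \<phi> x \<partial>lborel) = (\<integral>x. \<phi> x * trunc_op p (?e k) ?W x \<partial>lborel)"
      by (rule trunc_op_self_adjoint(1)[OF W e p' m\<phi> B(2) \<phi>(2)])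
    also have "\<dots> \<le> integral\<^sup>L lborel (?rhs k)"
      by (intro integral_mono trunc_op_self_adjoint(2)[OF W e p' m\<phi> B(2) \<phi>(2)] irhs mult_left_mono
        trunc_op_max_le[OF U V e p' \<theta>01 \<theta>max] \<phi>(3))
    finally show ?thesis .
  qed
  then show "(\<integral>x. ?W x * nonlocal_op p \<phi> x \<partial>lborel) \<le> (\<integral>x. \<phi> x * (\<theta> x * A u x + (1 - \<theta> x) * A v x) \<partial>lborel)"
    by (intro LIMSEQ_le[OF lhs rhs]) blast
qed

section \<open>Integration by parts\<close>

definition C1_supported :: "real \<Rightarrow> (real ^ 'n::finite \<Rightarrow> real) \<Rightarrow> bool"
  where "C1_supported R F \<longleftrightarrow> Ck_on 1 UNIV F \<and> (\<forall>x. R < norm x \<longrightarrow> F x = 0)"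

lemma C1_continuous: "Ck_on 1 UNIV f \<Longrightarrow> continuous_on UNIV f"
  by (auto intro!: continuous_at_imp_continuous_on differentiable_imp_continuous_within)

lemma integrable_continuous_bounded_support:
  fixes f :: "'a::euclidean_space \<Rightarrow> real"
  assumes "continuous_on UNIV f" "\<And>x. R < norm x \<Longrightarrow> f x = 0"
  shows "integrable lborel f"
proof -
  obtain B where "\<And>x. norm (f x) \<le> B"
    using continuous_compact_support_bounded[OF assms] by blast
  then show ?thesis
    using assms by (intro integrable_bounded_support[of f B R] borel_measurable_continuous_onI) auto
qed

text \<open>The integral of a difference quotient vanishes by translation invariance, and the quotients
  converge dominatedly.\<close>

lemma integral_partial_eq_0:
  assumes F: "C1_supported R (F :: real ^ 'n::finite \<Rightarrow> real)"
  shows "(\<integral>x. partial i F x \<partial>lborel) = 0"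
proof -
  have d: "F differentiable (at x)" and c: "continuous_on UNIV (partial j F)" and z: "R < norm x \<Longrightarrow> F x = 0" for x j
    using F by (auto simp: C1_supported_def)
  have cF: "continuous_on UNIV F" using F by (intro C1_continuous) (simp add: C1_supported_def)
  have [measurable]: "F \<in> borel_measurable borel" "partial i F \<in> borel_measurable borel"
    using cF c by (auto intro: borel_measurable_continuous_onI)
  have "\<exists>B>0. \<forall>x. \<bar>partial j F x\<bar> \<le> B" for j
  proof -
    have "partial j F x = 0" if "R < norm x" for x by (rule partial_eq_0_outside[OF z that])
    then obtain B where "0 < B" "\<And>x. norm (partial j F x) \<le> B"
      using continuous_compact_support_bounded[OF c] by blast
    then show ?thesis by auto
  qed
  then obtain B' where B': "\<And>j. 0 < B' j" "\<And>j x. \<bar>partial j F x\<bar> \<le> B' j" by metis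
  define B where "B = (\<Sum>j\<in>UNIV. B' j)"
  have "B' j \<le> B" for j unfolding B_def using less_imp_le[OF B'(1)] by (intro member_le_sum) auto
  then have B: "\<bar>partial j F x\<bar> \<le> B" for j x using B'(2) order_trans by blast
  define M where "M = real CARD('n) * B"
  have M0: "0 \<le> M" using order_trans[OF abs_ge_zero B] by (simp add: M_def)
  have lip: "\<bar>F x - F y\<bar> \<le> M * norm (x - y)" for x y
    using bounded_partials_Lipschitz[of UNIV F B x y] d B by (simp add: M_def)
  let ?e = "axis i 1 :: real ^ 'n"
  define t where "t k = 1 / real (Suc k)" for k
  have t: "0 < t k" "t k \<le> 1" for k by (auto simp: t_def)
  have t0: "filterlim t (at 0) sequentially"
    unfolding filterlim_at t_def using LIMSEQ_inverse_real_of_nat by (auto simp: inverse_eq_divide)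
  define Q where "Q k x = (F (t k *\<^sub>R ?e + x) - F x) / t k" for k x
  have iF: "integrable lborel F" by (rule integrable_continuous_bounded_support[OF cF z])
  have Q0: "(\<integral>x. Q k x \<partial>lborel) = 0" for k
    using integral_translate[of F "t k *\<^sub>R ?e"] integrable_translate[of F "t k *\<^sub>R ?e"] iF by (simp add: Q_def)
  have "(\<lambda>k. \<integral>x. Q k x \<partial>lborel) \<longlonglongrightarrow> (\<integral>x. partial i F x \<partial>lborel)"
  proof (rule integral_dominated_convergence[where w = "\<lambda>x. M * indicator (cball (0 :: real ^ 'n) (R + 1)) x"])
    show "integrable lborel (\<lambda>x. M * indicator (cball (0 :: real ^ 'n) (R + 1)) x)"
      using emeasure_lborel_cball_finite[of "0 :: real ^ 'n" "R + 1"]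
      by (intro integrable_mult_right integrable_real_indicator) auto
    show "AE x in lborel. (\<lambda>k. Q k x) \<longlonglongrightarrow> partial i F x"
    proof (rule AE_I2)
      fix x
      have "((\<lambda>a. F (a *\<^sub>R ?e + x)) has_derivative (\<lambda>a. \<Sum>j\<in>UNIV. (a *\<^sub>R ?e) $ j *\<^sub>R partial j F x)) (at 0)"
        by (rule has_derivative_compose[of "\<lambda>a. a *\<^sub>R ?e + x" "\<lambda>a. a *\<^sub>R ?e"])
          (use has_derivative_partial[OF d, of x] in \<open>auto intro!: derivative_eq_intros\<close>)
      moreover have "(\<lambda>a. \<Sum>j\<in>UNIV. (a *\<^sub>R ?e) $ j *\<^sub>R partial j F x) = (*) (partial i F x)"
        by (simp add: fun_eq_iff axis_def if_distrib[of "\<lambda>a. _ * a"] if_distrib[of "\<lambda>a. a * _"] mult.commute cong: if_cong)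
      ultimately have "((\<lambda>a. F (a *\<^sub>R ?e + x)) has_real_derivative partial i F x) (at 0)"
        by (simp only: has_field_derivative_def)
      then have "((\<lambda>h. (F (h *\<^sub>R ?e + x) - F x) / h) \<longlongrightarrow> partial i F x) (at 0)"
        by (simp add: DERIV_def)
      from filterlim_compose[OF this t0] show "(\<lambda>k. Q k x) \<longlonglongrightarrow> partial i F x" by (simp add: Q_def)
    qed
    show "AE x in lborel. norm (Q k x) \<le> M * indicator (cball 0 (R + 1)) x" for k
    proof (rule AE_I2)
      fix x :: "real ^ 'n"
      show "norm (Q k x) \<le> M * indicator (cball 0 (R + 1)) x"
      proof (cases "norm x \<le> R + 1")
        case True
        have "\<bar>F (t k *\<^sub>R ?e + x) - F x\<bar> \<le> M * t k" using lip[of "t k *\<^sub>R ?e + x" x] t[of k] by simp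
        then show ?thesis using True t[of k] by (simp add: Q_def divide_le_eq)
      next
        case False
        have "norm x - t k \<le> norm (t k *\<^sub>R ?e + x)"
          using norm_triangle_ineq4[of "t k *\<^sub>R ?e + x" "t k *\<^sub>R ?e"] t[of k] by simp
        then have "R < norm (t k *\<^sub>R ?e + x)" "R < norm x" using False t[of k] by auto
        then show ?thesis using z M0 by (simp add: Q_def)
      qed
    qed
  qed (simp_all add: Q_def[abs_def])
  then show ?thesis using Q0 by (simp add: LIMSEQ_const_iff)
qed

lemma C1_supported_mult:
  assumes "Ck_on 1 UNIV q" "C1_supported R X"
  shows "C1_supported R (\<lambda>x. q x * X x)"
  using assms by (auto simp: C1_supported_def simp del: Ck_on.simps One_nat_def intro: Ck_on_mult)

lemma C1_integrable_products:
  assumes q: "Ck_on 1 UNIV (q :: real ^ 'n::finite \<Rightarrow> real)" and X: "C1_supported R X"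
  shows "integrable lborel (\<lambda>x. q x * partial i X x)" "integrable lborel (\<lambda>x. partial i q x * X x)"
proof -
  have z: "R < norm x \<Longrightarrow> X x = 0" for x using X by (simp add: C1_supported_def)
  have c: "continuous_on UNIV q" "continuous_on UNIV (partial i q)" "continuous_on UNIV X" "continuous_on UNIV (partial i X)"
    using q X C1_continuous[of q] C1_continuous[of X] by (auto simp: C1_supported_def)
  show "integrable lborel (\<lambda>x. q x * partial i X x)"
    by (rule integrable_continuous_bounded_support[of _ R])
      (use c partial_eq_0_outside[of R X, OF z] in \<open>auto intro: continuous_on_mult\<close>)
  show "integrable lborel (\<lambda>x. partial i q x * X x)"
    by (rule integrable_continuous_bounded_support[of _ R]) (use c z in \<open>auto intro: continuous_on_mult\<close>)
qed

lemma integration_by_parts: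
  assumes q: "Ck_on 1 UNIV (q :: real ^ 'n::finite \<Rightarrow> real)" and X: "C1_supported R X"
  shows "(\<integral>x. q x * partial i X x \<partial>lborel) = - (\<integral>x. partial i q x * X x \<partial>lborel)"
proof -
  have "partial i (\<lambda>x. q x * X x) x = partial i q x * X x + q x * partial i X x" for x
    using q X by (intro partial_mult) (auto simp: C1_supported_def)
  then have "0 = (\<integral>x. partial i q x * X x + q x * partial i X x \<partial>lborel)"
    using integral_partial_eq_0[OF C1_supported_mult[OF assms], of i] by simp
  also have "\<dots> = (\<integral>x. partial i q x * X x \<partial>lborel) + (\<integral>x. q x * partial i X x \<partial>lborel)"
    by (intro Bochner_Integration.integral_add C1_integrable_products[OF assms])
  finally show ?thesis by simp
qed

text \<open>The chain rule for the maximum in weak form: write the maximum as \<open>(U + V + |U - V|) / 2\<close> and smooth \<open>|t|\<close>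
  to \<open>sqrt (t\<^sup>2 + \<delta>\<^sup>2)\<close>; in the limit both arguments get weight \<open>1/2\<close> where they coincide.\<close>

lemma integration_by_parts_max:
  fixes U V X :: "real ^ 'n::finite \<Rightarrow> real"
  assumes U: "Ck_on 1 UNIV U" and V: "Ck_on 1 UNIV V" and X: "C1_supported R X"
  defines "\<theta> \<equiv> \<lambda>x. (1 + sgn (U x - V x)) / 2"
  shows "(\<integral>x. max (U x) (V x) * partial i X x \<partial>lborel)
    = - (\<integral>x. (\<theta> x * partial i U x + (1 - \<theta> x) * partial i V x) * X x \<partial>lborel)"
proof -
  define \<delta> where "\<delta> k = 1 / real (Suc k)" for k
  have \<delta>: "0 < \<delta> k" "\<delta> k \<le> 1" for k by (auto simp: \<delta>_def)
  have \<delta>0: "\<delta> \<longlonglongrightarrow> 0" unfolding \<delta>_def using LIMSEQ_inverse_real_of_nat by (simp add: inverse_eq_divide)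
  define h where "h k a = sqrt (a\<^sup>2 + (\<delta> k)\<^sup>2)" for k a
  define q where "q k x = (U x + V x) * (1/2) + h k (U x - V x) * (1/2)" for k x
  have pos: "0 < a\<^sup>2 + (\<delta> k)\<^sup>2" for a k using \<delta>(1)[of k] by (simp add: add_nonneg_pos)
  have hd: "(h k has_real_derivative a / h k a) (at a)" for k a
  proof -
    have "((\<lambda>a. sqrt (a\<^sup>2 + (\<delta> k)\<^sup>2)) has_real_derivative (2 * a) * (inverse (sqrt (a\<^sup>2 + (\<delta> k)\<^sup>2)) / 2)) (at a)"
      using pos[of a k] by (auto intro!: derivative_eq_intros)
    moreover have "(2 * a) * (inverse (sqrt (a\<^sup>2 + (\<delta> k)\<^sup>2)) / 2) = a / sqrt (a\<^sup>2 + (\<delta> k)\<^sup>2)"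
      by (simp add: inverse_eq_divide)
    ultimately have "((\<lambda>a. sqrt (a\<^sup>2 + (\<delta> k)\<^sup>2)) has_real_derivative a / sqrt (a\<^sup>2 + (\<delta> k)\<^sup>2)) (at a)"
      by (rule DERIV_cong)
    moreover have "h k = (\<lambda>a. sqrt (a\<^sup>2 + (\<delta> k)\<^sup>2))" by (rule ext) (rule h_def)
    ultimately show ?thesis by (simp only:)
  qed
  have hge: "\<bar>a\<bar> \<le> h k a" "h k a \<le> \<bar>a\<bar> + \<delta> k" "0 < h k a" for k a
  proof -
    show "\<bar>a\<bar> \<le> h k a" unfolding h_def using real_sqrt_le_mono[of "a\<^sup>2" "a\<^sup>2 + (\<delta> k)\<^sup>2"] by simp
    show "h k a \<le> \<bar>a\<bar> + \<delta> k" unfolding h_def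
      using sqrt_add_le_add_sqrt[of "a\<^sup>2" "(\<delta> k)\<^sup>2"] \<delta>(1)[of k] by simp
    show "0 < h k a" unfolding h_def using pos by simp
  qed
  have d: "U differentiable (at x)" "V differentiable (at x)" for x using U V by auto
  have cU: "continuous_on UNIV U" "continuous_on UNIV V" "continuous_on UNIV (partial i U)" "continuous_on UNIV (partial i V)" for i
    using U V C1_continuous[OF U] C1_continuous[OF V] by auto
  have cX: "continuous_on UNIV X" "continuous_on UNIV (partial i X)" for i
    using X C1_continuous[of X] by (auto simp: C1_supported_def)
  have zX: "R < norm x \<Longrightarrow> X x = 0" for x using X by (simp add: C1_supported_def)
  have UV: "(\<lambda>x. U x - V x) differentiable (at x)" "partial i (\<lambda>x. U x - V x) x = partial i U x - partial i V x" for x i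
  proof -
    show "(\<lambda>x. U x - V x) differentiable (at x)" using d by (intro differentiable_diff)
    obtain f where fg1: "(U has_derivative f) (at x)" using d(1)[of x] unfolding differentiable_def by blast
    obtain g where fg2: "(V has_derivative g) (at x)" using d(2)[of x] unfolding differentiable_def by blast
    note fg = fg1 fg2
    show "partial i (\<lambda>x. U x - V x) x = partial i U x - partial i V x"
      using partial_has_derivative[OF has_derivative_diff[OF fg]] partial_has_derivative[OF fg(1)] partial_has_derivative[OF fg(2)] by simp
  qed
  have dq: "q k differentiable (at x)"
    "partial i (q k) x = (partial i U x + partial i V x) * (1/2) + ((U x - V x) / h k (U x - V x) * (partial i U x - partial i V x)) * (1/2)" for k x i
  proof -
    have dh: "(\<lambda>x. h k (U x - V x)) differentiable (at x)"
      by (rule differentiable_real_comp[OF UV(1) hd])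
    have ph: "partial i (\<lambda>x. h k (U x - V x)) x = (U x - V x) / h k (U x - V x) * (partial i U x - partial i V x)"
      by (subst partial_real_comp[OF UV(1) hd]) (simp add: UV(2))
    have c0: "partial i (\<lambda>x :: real ^ 'n. 1 / 2 :: real) x = 0"
      by (rule partial_has_derivative[OF has_derivative_const, THEN trans]) simp
    show "q k differentiable (at x)" unfolding q_def[abs_def]
      using d dh by (intro differentiable_add differentiable_mult differentiable_const)
    have "partial i (q k) x = partial i (\<lambda>x. (U x + V x) * (1/2)) x + partial i (\<lambda>x. h k (U x - V x) * (1/2)) x"
      unfolding q_def[abs_def] using d dh by (intro partial_add differentiable_add differentiable_mult differentiable_const)
    also have "partial i (\<lambda>x. (U x + V x) * (1/2)) x = (partial i U x + partial i V x) * (1/2)"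
      using partial_mult[of "\<lambda>x. U x + V x" x "\<lambda>x. 1/2" i] partial_add[OF d, of i x] d c0 by simp
    also have "partial i (\<lambda>x. h k (U x - V x) * (1/2)) x = (U x - V x) / h k (U x - V x) * (partial i U x - partial i V x) * (1/2)"
      using partial_mult[OF dh, of "\<lambda>x. 1/2" i] c0 ph by simp
    finally show "partial i (q k) x = (partial i U x + partial i V x) * (1/2) + ((U x - V x) / h k (U x - V x) * (partial i U x - partial i V x)) * (1/2)" .
  qed
  have ch: "continuous_on UNIV (\<lambda>x. h k (U x - V x))" for k
    unfolding h_def by (intro continuous_intros cU)
  have C1q: "Ck_on 1 UNIV (q k)" for k
  proof -
    have "h k (U x - V x) \<noteq> 0" for x using hge(3)[of k "U x - V x"] by simp
    then have "continuous_on UNIV (partial i (q k))" for i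
      unfolding dq(2)[abs_def] by (intro continuous_intros cU ch) auto
    then show ?thesis using dq(1) by simp
  qed
  have [measurable]: "U \<in> borel_measurable borel" "V \<in> borel_measurable borel" "X \<in> borel_measurable borel"
    "partial i U \<in> borel_measurable borel" "partial i V \<in> borel_measurable borel" "partial i X \<in> borel_measurable borel"
    by (intro borel_measurable_continuous_onI cU cX)+
  have cq: "continuous_on UNIV (partial i (q k))" for k using C1q[of k] by simp
  have [measurable]: "q k \<in> borel_measurable borel" for k
    by (intro borel_measurable_continuous_onI C1_continuous C1q)
  have [measurable]: "partial i (q k) \<in> borel_measurable borel" for k
    by (intro borel_measurable_continuous_onI cq)
  have [measurable]: "\<theta> \<in> borel_measurable borel" unfolding \<theta>_def sgn_if by measurable
  have lim1: "(\<lambda>k. \<integral>x. q k x * partial i X x \<partial>lborel) \<longlonglongrightarrow> (\<integral>x. max (U x) (V x) * partial i X x \<partial>lborel)"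
  proof (rule integral_dominated_convergence[where w = "\<lambda>x. (\<bar>U x\<bar> + \<bar>V x\<bar> + 1) * \<bar>partial i X x\<bar>"])
    show "integrable lborel (\<lambda>x. (\<bar>U x\<bar> + \<bar>V x\<bar> + 1) * \<bar>partial i X x\<bar>)"
      by (rule integrable_continuous_bounded_support[of _ R])
        (auto intro!: continuous_intros cU cX simp: partial_eq_0_outside[of R X, OF zX])
    have near: "\<bar>q k x - max (U x) (V x)\<bar> \<le> \<delta> k" for k x
    proof -
      have "max (U x) (V x) = (U x + V x) * (1/2) + \<bar>U x - V x\<bar> * (1/2)"
        by (simp add: max_def abs_if field_simps)
      then have "q k x - max (U x) (V x) = (h k (U x - V x) - \<bar>U x - V x\<bar>) / 2" by (simp add: q_def)
      then show ?thesis using hge(1,2)[where a = "U x - V x" and k = k] \<delta>(1)[of k] by simp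
    qed
    show "AE x in lborel. (\<lambda>k. q k x * partial i X x) \<longlonglongrightarrow> max (U x) (V x) * partial i X x"
    proof (intro AE_I2 tendsto_mult tendsto_const)
      fix x
      have "(\<lambda>k. q k x - max (U x) (V x)) \<longlonglongrightarrow> 0"
        by (rule Lim_null_comparison[OF _ \<delta>0]) (use near in auto)
      then show "(\<lambda>k. q k x) \<longlonglongrightarrow> max (U x) (V x)" by (simp add: LIM_zero_iff)
    qed
    show "AE x in lborel. norm (q k x * partial i X x) \<le> (\<bar>U x\<bar> + \<bar>V x\<bar> + 1) * \<bar>partial i X x\<bar>" for k
    proof (rule AE_I2)
      fix x
      have "\<bar>q k x\<bar> \<le> \<bar>U x\<bar> + \<bar>V x\<bar> + 1" using near[of k x] \<delta>(2)[of k] by (auto simp: max_def split: if_splits)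
      then show "norm (q k x * partial i X x) \<le> (\<bar>U x\<bar> + \<bar>V x\<bar> + 1) * \<bar>partial i X x\<bar>"
        by (simp add: abs_mult mult_right_mono)
    qed
  qed measurable
  have lim2: "(\<lambda>k. \<integral>x. partial i (q k) x * X x \<partial>lborel)
      \<longlonglongrightarrow> (\<integral>x. (\<theta> x * partial i U x + (1 - \<theta> x) * partial i V x) * X x \<partial>lborel)"
  proof (rule integral_dominated_convergence[where w = "\<lambda>x. (\<bar>partial i U x\<bar> + \<bar>partial i V x\<bar>) * \<bar>X x\<bar>"])
    show "integrable lborel (\<lambda>x. (\<bar>partial i U x\<bar> + \<bar>partial i V x\<bar>) * \<bar>X x\<bar>)"
      by (rule integrable_continuous_bounded_support[of _ R])
        (auto intro!: continuous_intros cU cX simp: zX)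
    show "AE x in lborel. (\<lambda>k. partial i (q k) x * X x) \<longlonglongrightarrow> (\<theta> x * partial i U x + (1 - \<theta> x) * partial i V x) * X x"
    proof (intro AE_I2 tendsto_mult tendsto_const)
      fix x
      let ?a = "U x - V x"
      have "(\<lambda>k. ?a / h k ?a) \<longlonglongrightarrow> sgn ?a"
      proof (cases "?a = 0")
        case False
        have "(\<lambda>k. h k ?a) \<longlonglongrightarrow> sqrt (?a\<^sup>2 + 0\<^sup>2)" unfolding h_def by (intro tendsto_intros \<delta>0)
        then have "(\<lambda>k. ?a / h k ?a) \<longlonglongrightarrow> ?a / \<bar>?a\<bar>" using False by (intro tendsto_divide tendsto_const) auto
        moreover have "?a / \<bar>?a\<bar> = sgn ?a" using False by (simp only: real_sgn_eq)
        ultimately show ?thesis by simp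
      qed simp
      then have "(\<lambda>k. partial i (q k) x) \<longlonglongrightarrow> (partial i U x + partial i V x) * (1/2) + (sgn ?a * (partial i U x - partial i V x)) * (1/2)"
        unfolding dq(2) by (intro tendsto_intros)
      also have "(partial i U x + partial i V x) * (1/2) + (sgn ?a * (partial i U x - partial i V x)) * (1/2)
          = \<theta> x * partial i U x + (1 - \<theta> x) * partial i V x"
        by (simp add: \<theta>_def field_simps)
      finally show "(\<lambda>k. partial i (q k) x) \<longlonglongrightarrow> \<theta> x * partial i U x + (1 - \<theta> x) * partial i V x" .
    qed
    show "AE x in lborel. norm (partial i (q k) x * X x) \<le> (\<bar>partial i U x\<bar> + \<bar>partial i V x\<bar>) * \<bar>X x\<bar>" for k
    proof (rule AE_I2)
      fix x
      let ?c = "(U x - V x) / h k (U x - V x)"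
      have "\<bar>?c\<bar> \<le> 1" using hge(1)[of "U x - V x" k] hge(3)[of k "U x - V x"] by (simp add: abs_divide divide_le_eq)
      then have "\<bar>?c * (partial i U x - partial i V x)\<bar> \<le> \<bar>partial i U x - partial i V x\<bar>"
        unfolding abs_mult by (intro mult_left_le_one_le) auto
      then have "\<bar>partial i (q k) x\<bar> \<le> \<bar>partial i U x\<bar> + \<bar>partial i V x\<bar>"
      proof -
        have "\<bar>(a + b) * (1/2) + e * (1/2)\<bar> \<le> \<bar>a\<bar> + \<bar>b\<bar>" if "\<bar>e\<bar> \<le> \<bar>a - b\<bar>" for a b e :: real
        proof -
          have "\<bar>e\<bar> \<le> \<bar>a\<bar> + \<bar>b\<bar>" using that abs_triangle_ineq4 by (rule order_trans)
          moreover have "\<bar>(a + b) * (1/2) + e * (1/2)\<bar> \<le> (\<bar>a + b\<bar> + \<bar>e\<bar>) / 2"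
            using abs_triangle_ineq[of "a + b" e] by (simp add: add_divide_distrib[symmetric] abs_divide)
          ultimately show ?thesis using abs_triangle_ineq[of a b] by simp
        qed
        then show "\<bar>?c * (partial i U x - partial i V x)\<bar> \<le> \<bar>partial i U x - partial i V x\<bar> \<Longrightarrow> ?thesis"
          unfolding dq(2) .
      qed
      then show "norm (partial i (q k) x * X x) \<le> (\<bar>partial i U x\<bar> + \<bar>partial i V x\<bar>) * \<bar>X x\<bar>"
        by (simp add: abs_mult mult_right_mono)
    qed
  qed measurable
  have "(\<lambda>k. - (\<integral>x. partial i (q k) x * X x \<partial>lborel)) \<longlonglongrightarrow> (\<integral>x. max (U x) (V x) * partial i X x \<partial>lborel)"
    using lim1 unfolding integration_by_parts[OF C1q X] .
  from LIMSEQ_unique[OF this tendsto_minus[OF lim2]] show ?thesis .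
qed

section \<open>The drift term\<close>

lemma partial_vec_nth:
  fixes b :: "real ^ 'n::finite \<Rightarrow> real ^ 'm::finite"
  assumes "b differentiable (at y)"
  shows "partial j (\<lambda>y. b y $ i) y = partial j b y $ i" and "(\<lambda>y. b y $ i) differentiable (at y)"
proof -
  obtain b' where d: "(b has_derivative b') (at y)" using assms by (auto simp: differentiable_def)
  have d': "((\<lambda>y. b y $ i) has_derivative (\<lambda>v. b' v $ i)) (at y)"
    by (rule bounded_linear.has_derivative[OF bounded_linear_vec_nth d])
  show "partial j (\<lambda>y. b y $ i) y = partial j b y $ i"
    using partial_has_derivative[OF d'] partial_has_derivative[OF d] by simp
  show "(\<lambda>y. b y $ i) differentiable (at y)" using d' by (auto simp: differentiable_def)
qed

lemma test_function_support:
  assumes "\<phi> \<in> test_functions \<Omega>"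
  defines "K \<equiv> closure {x. \<phi> x \<noteq> 0}"
  shows "compact K" "K \<subseteq> \<Omega>" "\<And>x. x \<notin> K \<Longrightarrow> \<phi> x = 0" "\<And>k. Ck_on k UNIV \<phi>"
  using assms closure_subset[of "{x. \<phi> x \<noteq> 0}"] by (auto simp: test_functions_def)

text \<open>The product is \<open>C\<^sup>1\<close> on \<open>\<Omega>\<close> and vanishes on the complement of the support of \<open>\<phi>\<close>; these two open sets
  cover the space.\<close>

lemma test_function_times_field:
  fixes b :: "real ^ 'n::finite \<Rightarrow> real ^ 'n"
  assumes \<phi>: "\<phi> \<in> test_functions \<Omega>" and \<Omega>: "open \<Omega>" and b: "Ck_on 1 \<Omega> b"
    and R: "closure {x. \<phi> x \<noteq> 0} \<subseteq> cball 0 R"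
  shows "C1_supported R (\<lambda>y. \<phi> y * b y $ i)"
    and "\<And>y. y \<in> \<Omega> \<Longrightarrow> partial j (\<lambda>y. \<phi> y * b y $ i) y = partial j \<phi> y * b y $ i + \<phi> y * partial j b y $ i"
    and "\<And>y. y \<notin> closure {x. \<phi> x \<noteq> 0} \<Longrightarrow> partial j (\<lambda>y. \<phi> y * b y $ i) y = 0"
proof -
  let ?K = "closure {x. \<phi> x \<noteq> 0}"
  note K = test_function_support[OF \<phi>]
  have "open (- ?K)" by (simp add: open_Compl)
  have d\<phi>: "\<phi> differentiable (at y)" and c\<phi>: "continuous_on S (partial j \<phi>)" for y j S
    using K(4)[of 1] by (auto intro: continuous_on_subset)
  have c\<phi>0: "continuous_on S \<phi>" for S using K(4)[of 0] by (auto intro: continuous_on_subset)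
  have db: "b differentiable (at y)" if "y \<in> \<Omega>" for y using b that by simp
  have cb: "continuous_on \<Omega> b" using db by (auto intro!: continuous_at_imp_continuous_on differentiable_imp_continuous_within)
  have cpb: "continuous_on \<Omega> (partial j b)" for j using b by simp
  show p1: "partial j (\<lambda>y. \<phi> y * b y $ i) y = partial j \<phi> y * b y $ i + \<phi> y * partial j b y $ i" if "y \<in> \<Omega>" for y j
    using partial_mult[OF d\<phi> partial_vec_nth(2)[OF db[OF that]], of j i] partial_vec_nth(1)[OF db[OF that], of j i] by simp
  have out: "\<phi> y * b y $ i = 0" if "y \<in> - ?K" for y using K(3)[of y] that by simp
  show p2: "partial j (\<lambda>y. \<phi> y * b y $ i) y = 0" if "y \<notin> ?K" for y j
    by (rule partial_eq_0_open(1)[OF \<open>open (- ?K)\<close>]) (use that out in auto)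
  have "(\<lambda>y. \<phi> y * b y $ i) differentiable (at y)" for y
  proof (cases "y \<in> \<Omega>")
    case True
    then show ?thesis using d\<phi> partial_vec_nth(2)[OF db] by (intro differentiable_mult)
  next
    case False
    then show ?thesis using K(2) out by (intro partial_eq_0_open(2)[OF \<open>open (- ?K)\<close>]) auto
  qed
  moreover have "continuous_on UNIV (partial j (\<lambda>y. \<phi> y * b y $ i))" for j
  proof -
    have "continuous_on \<Omega> (\<lambda>y. partial j \<phi> y * b y $ i + \<phi> y * partial j b y $ i)"
      by (intro continuous_intros c\<phi> c\<phi>0 cb cpb)
    then have "continuous_on \<Omega> (partial j (\<lambda>y. \<phi> y * b y $ i))"
      by (rule continuous_on_cong[THEN iffD1, rotated -1]) (use p1 in auto)
    moreover have "continuous_on (- ?K) (partial j (\<lambda>y. \<phi> y * b y $ i))"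
      by (rule continuous_on_cong[THEN iffD1, rotated -1, OF continuous_on_const[of _ 0]]) (use p2 in auto)
    ultimately have "continuous_on (\<Omega> \<union> - ?K) (partial j (\<lambda>y. \<phi> y * b y $ i))"
      by (rule continuous_on_open_Un[OF \<Omega> \<open>open (- ?K)\<close>])
    moreover have "\<Omega> \<union> - ?K = UNIV" using K(2) by auto
    ultimately show ?thesis by simp
  qed
  moreover have "\<phi> x * b x $ i = 0" if "R < norm x" for x
    using out[of x] R that by fastforce
  ultimately show "C1_supported R (\<lambda>y. \<phi> y * b y $ i)" by (auto simp: C1_supported_def)
qed

lemma divergence_test_function_times_field:
  fixes b :: "real ^ 'n::finite \<Rightarrow> real ^ 'n"
  assumes "\<phi> \<in> test_functions \<Omega>" "open \<Omega>" "Ck_on 1 \<Omega> b"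
  shows "continuous_on UNIV (divergence (\<lambda>y. \<phi> y *\<^sub>R b y))"
    and "\<And>y. y \<notin> closure {x. \<phi> x \<noteq> 0} \<Longrightarrow> divergence (\<lambda>y. \<phi> y *\<^sub>R b y) y = 0"
    and "\<And>y. y \<in> \<Omega> \<Longrightarrow> divergence (\<lambda>y. \<phi> y *\<^sub>R b y) y = (\<Sum>i\<in>UNIV. partial i \<phi> y * b y $ i + \<phi> y * partial i b y $ i)"
proof -
  obtain R where "\<forall>x\<in>closure {x. \<phi> x \<noteq> 0}. norm x \<le> R"
    using compact_imp_bounded[OF test_function_support(1)[OF assms(1)]] by (auto simp: bounded_iff)
  then have R: "closure {x. \<phi> x \<noteq> 0} \<subseteq> cball 0 R" by auto
  note T = test_function_times_field[OF assms R]
  show "continuous_on UNIV (divergence (\<lambda>y. \<phi> y *\<^sub>R b y))"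
    unfolding divergence_def[abs_def] using T(1) by (auto simp: C1_supported_def intro!: continuous_on_sum)
  show "divergence (\<lambda>y. \<phi> y *\<^sub>R b y) y = 0" if "y \<notin> closure {x. \<phi> x \<noteq> 0}" for y
    using T(3)[OF that] by (simp add: divergence_def)
  show "divergence (\<lambda>y. \<phi> y *\<^sub>R b y) y = (\<Sum>i\<in>UNIV. partial i \<phi> y * b y $ i + \<phi> y * partial i b y $ i)" if "y \<in> \<Omega>" for y
    using T(2)[OF that] by (simp add: divergence_def)
qed

lemma mollifier_reflected_measurable: "(\<lambda>y. mollifier r (x - y)) \<in> borel_measurable borel"
  by measurable

lemma mollify_oscillation_bound:
  obtains C where "0 < C" "\<And>(u :: real ^ 'n::finite \<Rightarrow> real) r x. weighted_integrable p u \<Longrightarrow> 0 \<le> p \<Longrightarrow> 0 < r \<Longrightarrow>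
    \<bar>mollify r u x - u x\<bar> \<le> C * oscillation r u x"
proof -
  obtain C where C: "0 < C" "\<And>r z. 0 < r \<Longrightarrow> mollifier r (z :: real ^ 'n) \<le> C / r ^ CARD('n)"
    by (rule mollifier_bounds[where 'n = 'n]) blast
  have "\<bar>mollify r u x - u x\<bar> \<le> C * oscillation r u x"
    if u: "weighted_integrable p u" "0 \<le> p" and r: "0 < r" for u r and x :: "real ^ 'n"
  proof -
    have m: "(\<integral>y. mollifier r (x - y) \<partial>lborel) = 1"
      using integral_reflect[of "mollifier r" x] integral_mollifier[OF r, where 'n = 'n] by simp
    have le: "\<bar>mollifier r (x - y)\<bar> \<le> C / r ^ DIM(real ^ 'n)" for y
      using C(2)[OF r, of "x - y"] mollifier_nonneg[OF r, of "x - y"] by simp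
    have z: "mollifier r (x - y) = 0" if "r < norm (x - y)" for y
      by (rule mollifier_eq_0[OF r]) (use that in simp)
    show ?thesis
      using kernel_oscillation_bound(1)[OF u mollifier_reflected_measurable r le z] m by (simp add: mollify_def)
  qed
  with C(1) that show thesis by blast
qed

text \<open>Friedrichs' commutator: the kernel
  \<open>(b(y) - b(x)) \<cdot> \<nabla>\<rho>\<^sub>r(x - y) - div b(y) \<rho>\<^sub>r(x - y)\<close> has size \<open>r\<^sup>-\<^sup>n\<close>, because the increment of \<open>b\<close>
  compensates one derivative of the mollifier, and it has integral \<open>0\<close> because it is a divergence.\<close>

lemma commutator_estimate:
  fixes b :: "real ^ 'n::finite \<Rightarrow> real ^ 'n"
  assumes \<Omega>: "open \<Omega>" and b: "Ck_on 1 \<Omega> b" and B: "0 \<le> B" "\<And>x i. x \<in> \<Omega> \<Longrightarrow> norm (partial i b x) \<le> B" and p: "0 \<le> p"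
  obtains C where "0 < C" "\<And>u r x. weighted_integrable p u \<Longrightarrow> 0 < r \<Longrightarrow> cball x r \<subseteq> \<Omega> \<Longrightarrow>
    \<bar>(\<integral>y. u y * - divergence (\<lambda>y. mollifier r (x - y) *\<^sub>R b y) y \<partial>lborel)
      - (\<Sum>i\<in>UNIV. b x $ i * partial i (mollify r u) x)\<bar> \<le> C * oscillation r u x"
proof -
  let ?d = "real CARD('n)"
  obtain C where C: "0 < C" "\<And>r z. 0 < r \<Longrightarrow> mollifier r (z :: real ^ 'n) \<le> C / r ^ CARD('n)"
    "\<And>r z i. 0 < r \<Longrightarrow> \<bar>partial i (mollifier r) (z :: real ^ 'n)\<bar> \<le> C / r ^ (CARD('n) + 1)"
    by (rule mollifier_bounds[where 'n = 'n]) blast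
  define C' where "C' = ?d * (?d * B * C + B * C) + 1"
  have "\<bar>(\<integral>y. u y * - divergence (\<lambda>y. mollifier r (x - y) *\<^sub>R b y) y \<partial>lborel)
      - (\<Sum>i\<in>UNIV. b x $ i * partial i (mollify r u) x)\<bar> \<le> C' * oscillation r u x"
    if u: "weighted_integrable p u" and r: "0 < r" and x: "cball x r \<subseteq> \<Omega>" for u r x
  proof -
    have [measurable]: "u \<in> borel_measurable borel" using u by (simp add: weighted_integrable_def)
    note [measurable] = partial_mollifier_measurable[OF r]
    let ?\<phi> = "\<lambda>y. mollifier r (x - y)"
    let ?D = "divergence (\<lambda>y. ?\<phi> y *\<^sub>R b y)"
    let ?\<rho> = "\<lambda>i y. partial i (mollifier r) (x - y)"
    let ?k = "\<lambda>y. - ?D y - (\<Sum>i\<in>UNIV. b x $ i * ?\<rho> i y)"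
    have \<phi>: "?\<phi> \<in> test_functions \<Omega>" by (rule test_function_mollifier[OF r x])
    have "{y. ?\<phi> y \<noteq> 0} \<subseteq> cball x r"
      using mollifier_eq_0[OF r] by (force simp: dist_norm)
    then have K: "closure {y. ?\<phi> y \<noteq> 0} \<subseteq> cball x r" by (intro closure_minimal) auto
    have "norm y \<le> norm x + r" if "y \<in> cball x r" for y
      using norm_triangle_ineq4[of x "x - y"] that by (simp add: dist_norm)
    then have R: "closure {y. ?\<phi> y \<noteq> 0} \<subseteq> cball 0 (norm x + r)" using K by auto
    note Dv = divergence_test_function_times_field[OF \<phi> \<Omega> b] and T = test_function_times_field[OF \<phi> \<Omega> b R]
    have [measurable]: "?D \<in> borel_measurable borel" by (rule borel_measurable_continuous_onI[OF Dv(1)])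
    have p\<phi>: "partial i ?\<phi> y = - ?\<rho> i y" for i y by (rule partial_reflect(1)[OF differentiable_mollifier[OF r]])
    have far: "?D y = 0" "?\<rho> i y = 0" if "r < norm (x - y)" for y i
    proof -
      have "y \<notin> cball x r" using that by (simp add: dist_norm)
      then show "?D y = 0" using K Dv(2)[of y] by blast
      show "?\<rho> i y = 0" by (rule partial_mollifier_eq_0[OF r that])
    qed
    have kb: "\<bar>?k y\<bar> \<le> C' / r ^ DIM(real ^ 'n)" for y
    proof (cases "norm (x - y) \<le> r")
      case True
      then have y: "y \<in> cball x r" "y \<in> \<Omega>" using x by (auto simp: dist_norm)
      have Dy: "?D y = (\<Sum>i\<in>UNIV. - ?\<rho> i y * b y $ i + ?\<phi> y * partial i b y $ i)"
        using Dv(3)[OF y(2)] unfolding p\<phi> .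
      have "?k y = (\<Sum>i\<in>UNIV. (b y $ i - b x $ i) * ?\<rho> i y - ?\<phi> y * partial i b y $ i)"
        unfolding Dy sum_negf[symmetric] sum_subtractf[symmetric] by (intro sum.cong) (auto simp: algebra_simps)
      also have "\<bar>\<dots>\<bar> \<le> (\<Sum>i\<in>(UNIV :: 'n set). (?d * B * C + B * C) / r ^ CARD('n))"
      proof (rule order_trans[OF sum_abs sum_mono])
        fix i :: 'n
        have "norm (b y - b x) \<le> ?d * B * norm (y - x)"
          by (rule bounded_partials_Lipschitz[of "cball x r"]) (use x b B y r in \<open>auto simp: dist_norm\<close>)
        also have "\<dots> \<le> ?d * B * r" using True B by (intro mult_left_mono) (auto simp: norm_minus_commute)
        finally have "\<bar>b y $ i - b x $ i\<bar> \<le> ?d * B * r"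
          using component_le_norm_cart[of "b y - b x" i] by simp
        then have "\<bar>b y $ i - b x $ i\<bar> * \<bar>?\<rho> i y\<bar> \<le> (?d * B * r) * (C / r ^ (CARD('n) + 1))"
          using C(3)[OF r] B r by (intro mult_mono) auto
        also have "\<dots> = ?d * B * C / r ^ CARD('n)" using r by simp
        finally have 1: "\<bar>(b y $ i - b x $ i) * ?\<rho> i y\<bar> \<le> ?d * B * C / r ^ CARD('n)" by (simp only: abs_mult)
        have "\<bar>partial i b y $ i\<bar> \<le> B" using component_le_norm_cart[of "partial i b y" i] B(2)[OF y(2), of i] by linarith
        then have "\<bar>?\<phi> y\<bar> * \<bar>partial i b y $ i\<bar> \<le> (C / r ^ CARD('n)) * B"
          using C(2)[OF r, of "x - y"] mollifier_nonneg[OF r, of "x - y"] C(1) r by (intro mult_mono) auto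
        then have 2: "\<bar>?\<phi> y * partial i b y $ i\<bar> \<le> B * C / r ^ CARD('n)" by (simp add: abs_mult mult.commute)
        have "\<bar>(b y $ i - b x $ i) * ?\<rho> i y - ?\<phi> y * partial i b y $ i\<bar> \<le> ?d * B * C / r ^ CARD('n) + B * C / r ^ CARD('n)"
          by (rule order_trans[OF abs_triangle_ineq4 add_mono[OF 1 2]])
        then show "\<bar>(b y $ i - b x $ i) * ?\<rho> i y - ?\<phi> y * partial i b y $ i\<bar> \<le> (?d * B * C + B * C) / r ^ CARD('n)"
          by (simp only: add_divide_distrib)
      qed
      also have "\<dots> = (?d * (?d * B * C + B * C)) / r ^ CARD('n)" by simp
      also have "\<dots> \<le> C' / r ^ CARD('n)" using r by (intro divide_right_mono) (auto simp: C'_def)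
      finally show ?thesis by simp
    next
      case False
      have "0 \<le> C'" using B C(1) by (simp add: C'_def)
      with False far[of y] r show ?thesis by simp
    qed
    have kz: "?k y = 0" if "r < norm (x - y)" for y using far[OF that] by simp
    have m: "?k \<in> borel_measurable borel" by measurable
    note KO = kernel_oscillation_bound[OF u p m r kb kz]
    have i\<rho>: "integrable lborel (?\<rho> i)" "integral\<^sup>L lborel (?\<rho> i) = 0" for i
    proof -
      have S: "C1_supported r (mollifier r :: real ^ 'n \<Rightarrow> real)"
        using Ck_on_mollifier_0[OF r, of 1] by (auto simp: C1_supported_def intro!: mollifier_eq_0[OF r])
      have "integrable lborel (partial i (mollifier r :: real ^ 'n \<Rightarrow> real))"
        using C1_integrable_products(1)[OF _ S, of "\<lambda>_. 1" i] Ck_on_const[of 1 "1 :: real"] by simp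
      then show "integrable lborel (?\<rho> i)" "integral\<^sup>L lborel (?\<rho> i) = 0"
        using integrable_reflect[of "partial i (mollifier r)" x] integral_reflect[of "partial i (mollifier r)" x]
          integral_partial_eq_0[OF S, of i] by auto
    qed
    have iD: "integrable lborel ?D" "integral\<^sup>L lborel ?D = 0"
    proof -
      have eq: "?D = (\<lambda>y. \<Sum>i\<in>UNIV. partial i (\<lambda>y. ?\<phi> y * b y $ i) y)"
        by (simp add: divergence_def fun_eq_iff)
      have i: "integrable lborel (partial i (\<lambda>y. ?\<phi> y * b y $ i))" for i
        using C1_integrable_products(1)[OF _ T(1), of "\<lambda>_. 1" i i] Ck_on_const[of 1 "1 :: real"] by simp
      show "integrable lborel ?D" unfolding eq by (intro Bochner_Integration.integrable_sum i)
      show "integral\<^sup>L lborel ?D = 0" unfolding eq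
        by (subst Bochner_Integration.integral_sum) (use i integral_partial_eq_0[OF T(1)] in auto)
    qed
    have k0: "integral\<^sup>L lborel ?k = 0" using iD i\<rho> by (simp add: Bochner_Integration.integral_sum)
    have out: "r < norm (x - y)" if "norm x + r < norm y" for y
      using norm_triangle_ineq4[of x "x - y"] that by simp
    have zD: "?D y = 0" if "norm x + r < norm y" for y by (rule far(1)[OF out[OF that]])
    have z\<rho>: "?\<rho> i y = 0" if "norm x + r < norm y" for i y by (rule far(2)[OF out[OF that]])
    have iuD: "integrable lborel (\<lambda>y. u y * - ?D y)"
    proof -
      obtain M where M: "\<And>y. norm (?D y) \<le> M"
        by (rule continuous_compact_support_bounded[OF Dv(1), of "norm x + r"]) (auto intro: zD that)
      show ?thesis
        by (rule weighted_integrable_mult_bounded_support[OF u p, of _ M "norm x + r"])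
          (use M zD in auto)
    qed
    have iu\<rho>: "integrable lborel (\<lambda>y. u y * ?\<rho> i y)" for i
      by (rule weighted_integrable_mult_bounded_support[OF u p, of _ "C / r ^ (CARD('n) + 1)" "norm x + r"])
        (measurable, rule C(3)[OF r], rule z\<rho>)
    have "(\<integral>y. u y * ?k y \<partial>lborel) = (\<integral>y. u y * - ?D y - (\<Sum>i\<in>UNIV. b x $ i * (u y * ?\<rho> i y)) \<partial>lborel)"
      by (intro Bochner_Integration.integral_cong) (auto simp: algebra_simps sum_distrib_left)
    also have "\<dots> = (\<integral>y. u y * - ?D y \<partial>lborel) - (\<Sum>i\<in>UNIV. b x $ i * (\<integral>y. u y * ?\<rho> i y \<partial>lborel))"
      using iuD iu\<rho> by (simp add: Bochner_Integration.integral_sum)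
    finally have "(\<integral>y. u y * ?k y \<partial>lborel) = (\<integral>y. u y * - ?D y \<partial>lborel) - (\<Sum>i\<in>UNIV. b x $ i * partial i (mollify r u) x)"
      by (simp only: mollify_C1(2)[OF u p r])
    then show ?thesis using KO(1) k0 by simp
  qed
  moreover have "0 < C'" using B C(1) by (simp add: C'_def add_nonneg_pos)
  ultimately show thesis using that by blast
qed

section \<open>Kato's inequality\<close>

text \<open>The setting of the theorem with Borel coefficients, where \<open>p = n + 2s\<close> and \<open>\<kappa>\<close> is the normalization
  constant.  Borel functions are needed because products and translates are integrated over product
  spaces.\<close>

locale nonlocal_drift =
  fixes \<Omega> :: "(real ^ 'n::finite) set" and b :: "real ^ 'n \<Rightarrow> real ^ 'n" and c :: "real ^ 'n \<Rightarrow> real"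
    and p \<kappa> B :: real
  assumes open_domain: "open \<Omega>" and drift_C1: "Ck_on 1 \<Omega> b"
    and drift_bound: "\<And>x i. x \<in> \<Omega> \<Longrightarrow> norm (partial i b x) \<le> B"
    and potential_measurable [measurable]: "c \<in> borel_measurable borel"
    and potential_bound: "\<And>x. \<bar>c x\<bar> \<le> B"
    and order_bounds: "real CARD('n) < p" "p < real CARD('n) + 2"
    and constant_nonneg: "0 \<le> \<kappa>"
begin

text \<open>The operator that acts on the test function in the weak formulation.\<close>

definition adjoint_op :: "(real ^ 'n \<Rightarrow> real) \<Rightarrow> real ^ 'n \<Rightarrow> real"
  where "adjoint_op \<phi> y = \<kappa> * nonlocal_op p \<phi> y - divergence (\<lambda>y. \<phi> y *\<^sub>R b y) y + c y * \<phi> y"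

definition subsolution :: "(real ^ 'n \<Rightarrow> real) \<Rightarrow> (real ^ 'n \<Rightarrow> real) \<Rightarrow> bool"
  where "subsolution u f \<longleftrightarrow> (\<forall>\<phi>\<in>test_functions \<Omega>. (\<forall>x. 0 \<le> \<phi> x) \<longrightarrow>
    (\<integral>y. u y * adjoint_op \<phi> y \<partial>lborel) \<le> (\<integral>y. f y * \<phi> y \<partial>lborel))"

lemma p_nonneg: "0 \<le> p" using order_bounds by simp

lemma B_nonneg: "0 \<le> B" using potential_bound[of 0] by linarith

text \<open>The decay shows that all parts of the adjoint operator may be integrated against functions of the
  weighted space.\<close>

lemma test_function_data:
  assumes "\<phi> \<in> test_functions \<Omega>"
  obtains R C where "closure {x. \<phi> x \<noteq> 0} \<subseteq> cball 0 R" "\<And>x. R < norm x \<Longrightarrow> \<phi> x = 0" "0 < C"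
    "\<And>x. \<bar>nonlocal_op p \<phi> x\<bar> \<le> C * weight p x"
    "\<And>x. \<bar>divergence (\<lambda>y. \<phi> y *\<^sub>R b y) x\<bar> \<le> C * weight p x" "\<And>x. \<bar>\<phi> x\<bar> \<le> C * weight p x"
    "\<phi> \<in> borel_measurable borel" "nonlocal_op p \<phi> \<in> borel_measurable borel"
    "divergence (\<lambda>y. \<phi> y *\<^sub>R b y) \<in> borel_measurable borel"
proof -
  note K = test_function_support[OF assms] and Dv = divergence_test_function_times_field[OF assms open_domain drift_C1]
  obtain R where "\<forall>x\<in>closure {x. \<phi> x \<noteq> 0}. norm x \<le> R"
    using compact_imp_bounded[OF K(1)] by (auto simp: bounded_iff)
  then have R: "closure {x. \<phi> x \<noteq> 0} \<subseteq> cball 0 R" by auto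
  have z: "\<phi> x = 0" if "R < norm x" for x using K(3)[of x] R that by force
  have zD: "divergence (\<lambda>y. \<phi> y *\<^sub>R b y) x = 0" if "R < norm x" for x using Dv(2)[of x] R that by force
  have c\<phi>: "continuous_on UNIV \<phi>" using K(4)[of 0] by simp
  have W: "\<exists>C>0. \<forall>x. \<bar>g x\<bar> \<le> C * weight p x"
    if g: "continuous_on UNIV g" "\<And>x. R < norm x \<Longrightarrow> g x = 0" for g :: "real ^ 'n \<Rightarrow> real"
  proof -
    obtain M where M: "0 < M" "\<And>x. norm (g x) \<le> M" using continuous_compact_support_bounded[OF g] by blast
    have "\<bar>g x\<bar> \<le> (M * (1 + \<bar>R\<bar>) powr p) * weight p x" for x
    proof (cases "norm x \<le> R")
      case True
      then have "norm x \<le> \<bar>R\<bar>" by simp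
      have "M * 1 \<le> M * ((1 + \<bar>R\<bar>) powr p * weight p x)"
        by (rule mult_left_mono[OF weight_lower_bound[OF p_nonneg \<open>norm x \<le> \<bar>R\<bar>\<close>]]) (use M(1) in simp)
      then show ?thesis using M(2)[of x] unfolding real_norm_def mult.assoc by linarith
    next
      case False
      then show ?thesis using g(2)[of x] M(1) weight_pos[of p x] by simp
    qed
    moreover have "0 < M * (1 + \<bar>R\<bar>) powr p" using M(1) by (smt (verit) mult_pos_pos powr_gt_zero)
    ultimately show ?thesis by blast
  qed
  obtain C1 where C1: "0 < C1" "\<And>x. \<bar>nonlocal_op p \<phi> x\<bar> \<le> C1 * weight p x"
    using nonlocal_op_decay[OF K(4) z order_bounds] by blast
  obtain C2 where C2: "0 < C2" "\<And>x. \<bar>divergence (\<lambda>y. \<phi> y *\<^sub>R b y) x\<bar> \<le> C2 * weight p x"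
    using W[OF Dv(1) zD] by blast
  obtain C3 where C3: "0 < C3" "\<And>x. \<bar>\<phi> x\<bar> \<le> C3 * weight p x" using W[OF c\<phi> z] by blast
  have up: "a * weight p x \<le> (C1 + C2 + C3) * weight p x" if "a \<in> {C1, C2, C3}" for a and x :: "real ^ 'n"
    using that C1(1) C2(1) C3(1) weight_pos[of p x] by (intro mult_right_mono) auto
  show thesis
  proof (rule that[OF R z, of "C1 + C2 + C3"])
    show "\<bar>nonlocal_op p \<phi> x\<bar> \<le> (C1 + C2 + C3) * weight p x" for x using C1(2)[of x] up[of C1 x] by simp
    show "\<bar>divergence (\<lambda>y. \<phi> y *\<^sub>R b y) x\<bar> \<le> (C1 + C2 + C3) * weight p x" for x using C2(2)[of x] up[of C2 x] by simp
    show "\<bar>\<phi> x\<bar> \<le> (C1 + C2 + C3) * weight p x" for x using C3(2)[of x] up[of C3 x] by simp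
    show "\<phi> \<in> borel_measurable borel" by (rule borel_measurable_continuous_onI[OF c\<phi>])
    show "nonlocal_op p \<phi> \<in> borel_measurable borel" by (rule nonlocal_op_measurable[OF K(4) z order_bounds])
    show "divergence (\<lambda>y. \<phi> y *\<^sub>R b y) \<in> borel_measurable borel" by (rule borel_measurable_continuous_onI[OF Dv(1)])
  qed (use C1(1) C2(1) C3(1) in auto)
qed

lemma weighted_integrable_potential:
  assumes "weighted_integrable p u" shows "weighted_integrable p (\<lambda>y. c y * u y)"
proof (rule weighted_integrable_bound[OF weighted_integrable_cmult[OF assms, of B]])
  have [measurable]: "u \<in> borel_measurable borel" using assms by (simp add: weighted_integrable_def)
  show "(\<lambda>y. c y * u y) \<in> borel_measurable borel" by measurable
  show "\<bar>c x * u x\<bar> \<le> \<bar>B * u x\<bar>" for x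
    using mult_right_mono[OF potential_bound[of x] abs_ge_zero[of "u x"]] B_nonneg by (simp add: abs_mult)
qed

text \<open>Testing with \<open>\<rho>\<^sub>r(x - \<cdot>)\<close> gives a pointwise inequality for the mollification, in which every
  error is an oscillation at scale \<open>r\<close>.\<close>

lemma mollified_inequality:
  "\<exists>C>0. \<forall>u f f' r x. subsolution u f \<longrightarrow> weighted_integrable p u \<longrightarrow> weighted_integrable p f' \<longrightarrow>
    0 < r \<longrightarrow> cball x r \<subseteq> \<Omega> \<longrightarrow> (\<forall>y\<in>cball x r. f' y = f y) \<longrightarrow>
    \<kappa> * (\<integral>y. u y * nonlocal_op p (mollifier r) (x - y) \<partial>lborel)
      + (\<Sum>i\<in>UNIV. b x $ i * partial i (mollify r u) x) + c x * u x
    \<le> f' x + C * (oscillation r u x + oscillation r (\<lambda>y. c y * u y) x + oscillation r f' x)"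
proof -
  obtain C1 where C1: "0 < C1" "\<And>u r x. weighted_integrable p u \<Longrightarrow> 0 < r \<Longrightarrow> cball x r \<subseteq> \<Omega> \<Longrightarrow>
    \<bar>(\<integral>y. u y * - divergence (\<lambda>y. mollifier r (x - y) *\<^sub>R b y) y \<partial>lborel)
      - (\<Sum>i\<in>UNIV. b x $ i * partial i (mollify r u) x)\<bar> \<le> C1 * oscillation r u x"
    by (rule commutator_estimate[OF open_domain drift_C1 B_nonneg drift_bound p_nonneg]) blast+
  obtain C2 where C2: "0 < C2" "\<And>(u :: real ^ 'n \<Rightarrow> real) r x. weighted_integrable p u \<Longrightarrow> 0 \<le> p \<Longrightarrow> 0 < r \<Longrightarrow>
    \<bar>mollify r u x - u x\<bar> \<le> C2 * oscillation r u x"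
    by (rule mollify_oscillation_bound[where 'n = 'n]) blast
  have "\<kappa> * (\<integral>y. u y * nonlocal_op p (mollifier r) (x - y) \<partial>lborel)
      + (\<Sum>i\<in>UNIV. b x $ i * partial i (mollify r u) x) + c x * u x
    \<le> f' x + (C1 + C2) * (oscillation r u x + oscillation r (\<lambda>y. c y * u y) x + oscillation r f' x)"
    if s: "subsolution u f" and u: "weighted_integrable p u" and f': "weighted_integrable p f'"
      and r: "0 < r" and x: "cball x r \<subseteq> \<Omega>" and ff: "\<And>y. y \<in> cball x r \<Longrightarrow> f' y = f y" for u f f' r x
  proof -
    let ?\<phi> = "\<lambda>y. mollifier r (x - y)"
    let ?D = "divergence (\<lambda>y. ?\<phi> y *\<^sub>R b y)"
    have \<phi>: "?\<phi> \<in> test_functions \<Omega>" by (rule test_function_mollifier[OF r x])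
    obtain R C where T: "closure {x. ?\<phi> x \<noteq> 0} \<subseteq> cball 0 R" "\<And>x. R < norm x \<Longrightarrow> ?\<phi> x = 0" "0 < C"
      "\<And>x. \<bar>nonlocal_op p ?\<phi> x\<bar> \<le> C * weight p x"
      "\<And>x. \<bar>?D x\<bar> \<le> C * weight p x" "\<And>x. \<bar>?\<phi> x\<bar> \<le> C * weight p x"
      "?\<phi> \<in> borel_measurable borel" "nonlocal_op p ?\<phi> \<in> borel_measurable borel" "?D \<in> borel_measurable borel"
      by (rule test_function_data[OF \<phi>]) (rule that; assumption)
    have nl: "nonlocal_op p ?\<phi> y = nonlocal_op p (mollifier r) (x - y)" for y
      by (simp add: nonlocal_op_def algebra_simps)
    note cu = weighted_integrable_potential[OF u]
    have i1: "integrable lborel (\<lambda>y. u y * nonlocal_op p ?\<phi> y)" by (rule weighted_integrable_mult[OF u T(8,4)])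
    have i2: "integrable lborel (\<lambda>y. u y * - ?D y)"
      by (rule weighted_integrable_mult[OF u, where C = C]) (use T(5,9) in auto)
    have i3: "integrable lborel (\<lambda>y. (c y * u y) * ?\<phi> y)" by (rule weighted_integrable_mult[OF cu T(7,6)])
    have "(\<integral>y. u y * adjoint_op ?\<phi> y \<partial>lborel)
        = (\<integral>y. \<kappa> * (u y * nonlocal_op p ?\<phi> y) + u y * - ?D y + (c y * u y) * ?\<phi> y \<partial>lborel)"
      by (intro Bochner_Integration.integral_cong) (auto simp: adjoint_op_def algebra_simps)
    also have "\<dots> = \<kappa> * (\<integral>y. u y * nonlocal_op p ?\<phi> y \<partial>lborel) + (\<integral>y. u y * - ?D y \<partial>lborel) + mollify r (\<lambda>y. c y * u y) x"
      using i1 i2 i3 by (simp add: mollify_def)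
    finally have "\<kappa> * (\<integral>y. u y * nonlocal_op p (mollifier r) (x - y) \<partial>lborel) + (\<integral>y. u y * - ?D y \<partial>lborel)
        + mollify r (\<lambda>y. c y * u y) x = (\<integral>y. u y * adjoint_op ?\<phi> y \<partial>lborel)" by (simp only: nl)
    also have "\<dots> \<le> (\<integral>y. f y * ?\<phi> y \<partial>lborel)"
      using bspec[OF s[unfolded subsolution_def] \<phi>] by (simp add: mollifier_nonneg[OF r])
    also have "\<dots> = mollify r f' x"
      unfolding mollify_def
    proof (intro Bochner_Integration.integral_cong refl)
      fix y show "f y * ?\<phi> y = f' y * ?\<phi> y"
        using ff[of y] mollifier_eq_0[OF r, of "x - y"] by (cases "y \<in> cball x r") (auto simp: dist_norm)
    qed
    finally have "\<kappa> * (\<integral>y. u y * nonlocal_op p (mollifier r) (x - y) \<partial>lborel) + (\<integral>y. u y * - ?D y \<partial>lborel)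
        + mollify r (\<lambda>y. c y * u y) x \<le> mollify r f' x" .
    moreover note C1(2)[OF u r x] C2(2)[OF cu p_nonneg r, of x] C2(2)[OF f' p_nonneg r, of x]
    moreover have "C1 * oscillation r u x + C2 * oscillation r (\<lambda>y. c y * u y) x + C2 * oscillation r f' x
        \<le> (C1 + C2) * (oscillation r u x + oscillation r (\<lambda>y. c y * u y) x + oscillation r f' x)"
      using C1(1) C2(1) r by (simp add: algebra_simps oscillation_nonneg add_nonneg_nonneg)
    ultimately show ?thesis by linarith
  qed
  note main = this
  show ?thesis
    by (rule exI[of _ "C1 + C2"]) (use C1(1) C2(1) main in auto)
qed

end

context nonlocal_drift
begin

text \<open>Up to a constant, the error in the mollified inequality for a subsolution \<open>u\<close> with right-hand
  side \<open>f\<close>.\<close>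

definition total_oscillation ::
    "real \<Rightarrow> (real ^ 'n \<Rightarrow> real) \<Rightarrow> (real ^ 'n \<Rightarrow> real) \<Rightarrow> real ^ 'n \<Rightarrow> real"
  where "total_oscillation r u f = (\<lambda>x. oscillation r u x + oscillation r (\<lambda>y. c y * u y) x + oscillation r f x)"

text \<open>The functions \<open>f'\<close> and \<open>g'\<close> are localizations of \<open>f\<close> and \<open>g\<close>, which need not be integrable up to the
  boundary of \<open>\<Omega>\<close>.  Multiply the mollified inequalities by \<open>\<theta>\<phi>\<close> and \<open>(1 - \<theta>)\<phi>\<close>, add, and integrate.  On the left the
  nonlocal part is controlled by the convexity of the maximum, the drift part is an exact chain rule,
  and the zeroth order part is exact up to oscillations.\<close>

lemma mollified_Kato:
  assumes \<phi>: "\<phi> \<in> test_functions \<Omega>" and \<phi>0: "\<And>x. 0 \<le> \<phi> x"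
  shows "\<exists>C>0.
    (\<forall>u v f g f' g' r E. subsolution u f \<longrightarrow> subsolution v g \<longrightarrow> weighted_integrable p u \<longrightarrow> weighted_integrable p v \<longrightarrow>
      weighted_integrable p f' \<longrightarrow> weighted_integrable p g' \<longrightarrow> 0 < r \<longrightarrow>
      (\<forall>x. \<phi> x \<noteq> 0 \<longrightarrow> cball x r \<subseteq> \<Omega>) \<longrightarrow>
      (\<forall>x. \<phi> x \<noteq> 0 \<longrightarrow> (\<forall>y\<in>cball x r. f' y = f y \<and> g' y = g y)) \<longrightarrow>
      E = (\<lambda>x. total_oscillation r u f' x + total_oscillation r v g' x) \<longrightarrow> weighted_integrable p E \<longrightarrow>
      (\<integral>x. max (u x) (v x) * adjoint_op \<phi> x \<partial>lborel)
      \<le> (\<integral>x. \<phi> x * ((1 + sgn (mollify r u x - mollify r v x)) / 2 * f' x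
            + (1 - (1 + sgn (mollify r u x - mollify r v x)) / 2) * g' x) \<partial>lborel)
        + C * (\<integral>x. E x * weight p x \<partial>lborel)) \<and>
    (\<forall>u v f' g' r x. 0 < r \<longrightarrow> weighted_integrable p u \<longrightarrow> weighted_integrable p v \<longrightarrow>
      \<bar>mollify r u x - u x\<bar> + \<bar>mollify r v x - v x\<bar> \<le> C * (total_oscillation r u f' x + total_oscillation r v g' x))"
proof -
  obtain R C\<phi> where T: "closure {x. \<phi> x \<noteq> 0} \<subseteq> cball 0 R" "\<And>x. R < norm x \<Longrightarrow> \<phi> x = 0" "0 < C\<phi>"
    "\<And>x. \<bar>nonlocal_op p \<phi> x\<bar> \<le> C\<phi> * weight p x"
    "\<And>x. \<bar>divergence (\<lambda>y. \<phi> y *\<^sub>R b y) x\<bar> \<le> C\<phi> * weight p x" "\<And>x. \<bar>\<phi> x\<bar> \<le> C\<phi> * weight p x"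
    "\<phi> \<in> borel_measurable borel" "nonlocal_op p \<phi> \<in> borel_measurable borel"
    "divergence (\<lambda>y. \<phi> y *\<^sub>R b y) \<in> borel_measurable borel"
    by (rule test_function_data[OF \<phi>]) (rule that; assumption)
  note [measurable] = T(7,8,9)
  let ?N = "nonlocal_op p \<phi>" and ?D = "divergence (\<lambda>y. \<phi> y *\<^sub>R b y)"
  let ?A = "\<lambda>r u x. \<integral>y. u y * nonlocal_op p (mollifier r) (x - y) \<partial>lborel"
  obtain Cp where Cp1: "0 < Cp" and "\<forall>u f f' r x. subsolution u f \<longrightarrow> weighted_integrable p u \<longrightarrow> weighted_integrable p f' \<longrightarrow>
    0 < r \<longrightarrow> cball x r \<subseteq> \<Omega> \<longrightarrow> (\<forall>y\<in>cball x r. f' y = f y) \<longrightarrow>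
    \<kappa> * ?A r u x + (\<Sum>i\<in>UNIV. b x $ i * partial i (mollify r u) x) + c x * u x
    \<le> f' x + Cp * (oscillation r u x + oscillation r (\<lambda>y. c y * u y) x + oscillation r f' x)"
    using mollified_inequality by blast
  note Cp = this(1) this(2)[rule_format]
  obtain Cm where Cm: "0 < Cm" "\<And>(u :: real ^ 'n \<Rightarrow> real) r x. weighted_integrable p u \<Longrightarrow> 0 \<le> p \<Longrightarrow> 0 < r \<Longrightarrow>
    \<bar>mollify r u x - u x\<bar> \<le> Cm * oscillation r u x"
    by (rule mollify_oscillation_bound[where 'n = 'n]) (rule that; assumption)
  have near: "\<bar>mollify r u x - u x\<bar> + \<bar>mollify r v x - v x\<bar> \<le> Cm * (total_oscillation r u f' x + total_oscillation r v g' x)"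
    if r: "0 < r" and u: "weighted_integrable p u" and v: "weighted_integrable p v" for u v f' g' r x
  proof -
    have "oscillation r u x \<le> total_oscillation r u f' x" "oscillation r v x \<le> total_oscillation r v g' x"
      using r by (simp_all add: total_oscillation_def oscillation_nonneg)
    then have "Cm * oscillation r u x \<le> Cm * total_oscillation r u f' x" "Cm * oscillation r v x \<le> Cm * total_oscillation r v g' x"
      using Cm(1) by simp_all
    then show ?thesis using Cm(2)[OF u p_nonneg r, of x] Cm(2)[OF v p_nonneg r, of x] unfolding distrib_left by linarith
  qed
  define C where "C = Cp * C\<phi> + (\<kappa> * C\<phi> + C\<phi>) * Cm + B * C\<phi> * (2 * Cm) + Cm"
  have C: "0 < C" using Cp(1) Cm(1) T(3) constant_nonneg B_nonneg by (simp add: C_def add_nonneg_pos)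
  show ?thesis
  proof (intro exI[of _ C] conjI allI impI C)
    fix u v f g f' g' :: "real ^ 'n \<Rightarrow> real" and r and E :: "real ^ 'n \<Rightarrow> real"
    assume su: "subsolution u f" and sv: "subsolution v g" and u: "weighted_integrable p u" and v: "weighted_integrable p v"
      and f': "weighted_integrable p f'" and g': "weighted_integrable p g'" and r: "0 < r"
      and ball: "\<forall>x. \<phi> x \<noteq> 0 \<longrightarrow> cball x r \<subseteq> \<Omega>"
      and ff: "\<forall>x. \<phi> x \<noteq> 0 \<longrightarrow> (\<forall>y\<in>cball x r. f' y = f y \<and> g' y = g y)"
      and Edef: "E = (\<lambda>x. total_oscillation r u f' x + total_oscillation r v g' x)" and iE: "weighted_integrable p E"
    let ?U = "mollify r u" and ?V = "mollify r v"
    define \<theta> where "\<theta> x = (1 + sgn (?U x - ?V x)) / 2" for x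
    have [measurable]: "u \<in> borel_measurable borel" "v \<in> borel_measurable borel" "f' \<in> borel_measurable borel"
      "g' \<in> borel_measurable borel" "E \<in> borel_measurable borel"
      using u v f' g' iE by (simp_all add: weighted_integrable_def)
    have [measurable]: "\<theta> \<in> borel_measurable borel" unfolding \<theta>_def[abs_def] sgn_if by measurable
    have \<theta>01: "0 \<le> \<theta> x" "\<theta> x \<le> 1" for x by (auto simp: \<theta>_def sgn_if)
    have conv: "\<bar>\<theta> x * a + (1 - \<theta> x) * a'\<bar> \<le> \<theta> x * \<bar>a\<bar> + (1 - \<theta> x) * \<bar>a'\<bar>" for x a a'
      using abs_triangle_ineq[of "\<theta> x * a" "(1 - \<theta> x) * a'"] \<theta>01[of x] by (simp add: abs_mult)
    have \<theta>max: "\<theta> x * ?U x + (1 - \<theta> x) * ?V x = max (?U x) (?V x)" for x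
      by (auto simp: \<theta>_def sgn_if max_def field_simps)
    have E0: "0 \<le> E x" for x using r by (simp add: Edef total_oscillation_def oscillation_nonneg)
    have nearE: "\<bar>?U x - u x\<bar> + \<bar>?V x - v x\<bar> \<le> Cm * E x" for x
      unfolding Edef by (rule near[OF r u v])
    have wU: "weighted_integrable p ?U" and wV: "weighted_integrable p ?V"
    proof -
      have dU: "weighted_integrable p (\<lambda>x. ?U x - u x)"
      proof (rule weighted_integrable_bound[OF weighted_integrable_cmult[OF iE, of Cm]])
        show "\<bar>?U x - u x\<bar> \<le> \<bar>Cm * E x\<bar>" for x
          using nearE[of x] abs_ge_zero[of "?V x - v x"] abs_ge_self[of "Cm * E x"] by linarith
      qed measurable
      have dV: "weighted_integrable p (\<lambda>x. ?V x - v x)"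
      proof (rule weighted_integrable_bound[OF weighted_integrable_cmult[OF iE, of Cm]])
        show "\<bar>?V x - v x\<bar> \<le> \<bar>Cm * E x\<bar>" for x
          using nearE[of x] abs_ge_zero[of "?U x - u x"] abs_ge_self[of "Cm * E x"] by linarith
      qed measurable
      show "weighted_integrable p ?U" using weighted_integrable_add[OF dU u] by simp
      show "weighted_integrable p ?V" using weighted_integrable_add[OF dV v] by simp
    qed
    have C1U: "Ck_on 1 UNIV ?U" and C1V: "Ck_on 1 UNIV ?V"
      using mollify_C1(1,3)[OF u p_nonneg r] mollify_C1(1,3)[OF v p_nonneg r] by simp_all
    note X = test_function_times_field(1)[OF \<phi> open_domain drift_C1 T(1)]
    have X_meas: "(\<lambda>y. \<phi> y * b y $ i) \<in> borel_measurable borel" for i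
      using C1_continuous[of "\<lambda>y. \<phi> y * b y $ i"] X[of i]
      by (auto simp: C1_supported_def intro: borel_measurable_continuous_onI)
    have pU_meas [measurable]: "partial i ?U \<in> borel_measurable borel" "partial i ?V \<in> borel_measurable borel" for i
      using C1U C1V by (auto intro: borel_measurable_continuous_onI)
    let ?W = "\<lambda>x. max (?U x) (?V x)" and ?w = "\<lambda>x. max (u x) (v x)"
    let ?I1 = "\<lambda>x. \<phi> x * (\<theta> x * ?A r u x + (1 - \<theta> x) * ?A r v x)"
    let ?I2 = "\<lambda>x. \<Sum>i\<in>UNIV. (\<theta> x * partial i ?U x + (1 - \<theta> x) * partial i ?V x) * (\<phi> x * b x $ i)"
    let ?I3 = "\<lambda>x. (\<theta> x * u x + (1 - \<theta> x) * v x) * (c x * \<phi> x)"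
    let ?J = "\<lambda>x. \<phi> x * (\<theta> x * f' x + (1 - \<theta> x) * g' x)"
    have mix: "weighted_integrable p (\<lambda>x. \<theta> x * h1 x + (1 - \<theta> x) * h2 x)"
      if "weighted_integrable p h1" "weighted_integrable p h2" for h1 h2
    proof (rule weighted_integrable_add)
      have [measurable]: "h1 \<in> borel_measurable borel" "h2 \<in> borel_measurable borel"
        using that by (simp_all add: weighted_integrable_def)
      show "weighted_integrable p (\<lambda>x. \<theta> x * h1 x)"
        by (rule weighted_integrable_bound[OF that(1)]) (use \<theta>01 in \<open>auto simp: abs_mult intro!: mult_left_le_one_le\<close>)
      show "weighted_integrable p (\<lambda>x. (1 - \<theta> x) * h2 x)"
        by (rule weighted_integrable_bound[OF that(2)]) (use \<theta>01 in \<open>auto simp: abs_mult intro!: mult_left_le_one_le\<close>)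
    qed
    have pointwise: "\<kappa> * ?I1 x + ?I2 x + ?I3 x \<le> ?J x + Cp * (E x * \<phi> x)" for x
    proof (cases "\<phi> x = 0")
      case False
      let ?bu = "\<Sum>i\<in>UNIV. b x $ i * partial i ?U x" and ?bv = "\<Sum>i\<in>UNIV. b x $ i * partial i ?V x"
      have a: "\<kappa> * ?A r u x + ?bu + c x * u x \<le> f' x + Cp * total_oscillation r u f' x"
        unfolding total_oscillation_def by (rule Cp(2)[OF su u f' r]) (use ball ff False in auto)
      have b: "\<kappa> * ?A r v x + ?bv + c x * v x \<le> g' x + Cp * total_oscillation r v g' x"
        unfolding total_oscillation_def by (rule Cp(2)[OF sv v g' r]) (use ball ff False in auto)
      have o: "0 \<le> total_oscillation r u f' x" "0 \<le> total_oscillation r v g' x"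
        using r by (simp_all add: total_oscillation_def oscillation_nonneg)
      have "\<theta> x * (\<kappa> * ?A r u x + ?bu + c x * u x) + (1 - \<theta> x) * (\<kappa> * ?A r v x + ?bv + c x * v x)
          \<le> \<theta> x * (f' x + Cp * total_oscillation r u f' x) + (1 - \<theta> x) * (g' x + Cp * total_oscillation r v g' x)"
        using \<theta>01[of x] by (intro add_mono[OF mult_left_mono[OF a] mult_left_mono[OF b]]) auto
      also have "\<dots> = \<theta> x * f' x + (1 - \<theta> x) * g' x
          + Cp * (\<theta> x * total_oscillation r u f' x + (1 - \<theta> x) * total_oscillation r v g' x)" by (simp add: algebra_simps)
      also have "\<dots> \<le> \<theta> x * f' x + (1 - \<theta> x) * g' x + Cp * E x"
      proof -
        have "\<theta> x * total_oscillation r u f' x + (1 - \<theta> x) * total_oscillation r v g' x \<le> E x"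
          unfolding Edef using \<theta>01[of x] o by (intro add_mono mult_left_le_one_le) auto
        then show ?thesis using Cp(1) by simp
      qed
      finally have "\<phi> x * (\<theta> x * (\<kappa> * ?A r u x + ?bu + c x * u x) + (1 - \<theta> x) * (\<kappa> * ?A r v x + ?bv + c x * v x))
          \<le> \<phi> x * (\<theta> x * f' x + (1 - \<theta> x) * g' x + Cp * E x)"
        by (rule mult_left_mono[OF _ \<phi>0])
      moreover have "?I2 x = \<phi> x * (\<theta> x * ?bu + (1 - \<theta> x) * ?bv)"
        by (simp add: sum_distrib_left sum.distrib[symmetric] algebra_simps)
      ultimately show ?thesis by (simp add: algebra_simps)
    qed simp
    have i1: "integrable lborel ?I1" and I1: "(\<integral>x. ?W x * ?N x \<partial>lborel) \<le> integral\<^sup>L lborel ?I1"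
      using nonlocal_Kato[OF u v r wU wV order_bounds test_function_support(4)[OF \<phi>] T(2) \<phi>0 _ \<theta>01 \<theta>max] by simp_all
    have parts: "integrable lborel (\<lambda>x. (\<theta> x * partial i ?U x + (1 - \<theta> x) * partial i ?V x) * (\<phi> x * b x $ i))" for i
    proof (rule Bochner_Integration.integrable_bound)
      show "integrable lborel (\<lambda>x. \<bar>partial i ?U x * (\<phi> x * b x $ i)\<bar> + \<bar>partial i ?V x * (\<phi> x * b x $ i)\<bar>)"
        by (intro Bochner_Integration.integrable_add integrable_abs C1_integrable_products(2)[OF C1U X] C1_integrable_products(2)[OF C1V X])
      note [measurable] = X_meas
      show "(\<lambda>x. (\<theta> x * partial i ?U x + (1 - \<theta> x) * partial i ?V x) * (\<phi> x * b x $ i)) \<in> borel_measurable lborel"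
        by measurable
      have "\<bar>(\<theta> x * a + (1 - \<theta> x) * a') * z\<bar> \<le> \<bar>a * z\<bar> + \<bar>a' * z\<bar>" for x a a' z
      proof -
        have "(\<theta> x * a + (1 - \<theta> x) * a') * z = \<theta> x * (a * z) + (1 - \<theta> x) * (a' * z)"
          by (simp add: algebra_simps)
        then have "\<bar>(\<theta> x * a + (1 - \<theta> x) * a') * z\<bar> \<le> \<theta> x * \<bar>a * z\<bar> + (1 - \<theta> x) * \<bar>a' * z\<bar>"
          by (simp only: conv)
        also have "\<dots> \<le> \<bar>a * z\<bar> + \<bar>a' * z\<bar>" using \<theta>01[of x] by (intro add_mono mult_left_le_one_le) auto
        finally show ?thesis .
      qed
      then show "AE x in lborel. norm ((\<theta> x * partial i ?U x + (1 - \<theta> x) * partial i ?V x) * (\<phi> x * b x $ i))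
          \<le> norm (\<bar>partial i ?U x * (\<phi> x * b x $ i)\<bar> + \<bar>partial i ?V x * (\<phi> x * b x $ i)\<bar>)"
        by (intro AE_I2) simp
    qed
    have wW: "weighted_integrable p ?W" and ww: "weighted_integrable p ?w"
      by (rule weighted_integrable_max[OF wU wV], rule weighted_integrable_max[OF u v])
    have iWD: "integrable lborel (\<lambda>x. ?W x * ?D x)" by (rule weighted_integrable_mult[OF wW T(9,5)])
    have iWN: "integrable lborel (\<lambda>x. ?W x * ?N x)" by (rule weighted_integrable_mult[OF wW T(8,4)])
    have I2: "integral\<^sup>L lborel ?I2 = - (\<integral>x. ?W x * ?D x \<partial>lborel)"
    proof -
      have iWp: "integrable lborel (\<lambda>x. ?W x * partial i (\<lambda>y. \<phi> y * b y $ i) x)" for i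
      proof -
        have c1: "continuous_on UNIV (partial i (\<lambda>y. \<phi> y * b y $ i))" using X[of i] by (simp add: C1_supported_def)
        have z: "partial i (\<lambda>y. \<phi> y * b y $ i) x = 0" if "R < norm x" for x
          by (rule partial_eq_0_outside[OF _ that]) (simp add: T(2))
        obtain M where M: "\<And>x. norm (partial i (\<lambda>y. \<phi> y * b y $ i) x) \<le> M"
          by (rule continuous_compact_support_bounded[OF c1, of R]) (auto intro: z that)
        show ?thesis
          by (rule weighted_integrable_mult_bounded_support[OF wW p_nonneg borel_measurable_continuous_onI[OF c1], of M R])
            (use M z in auto)
      qed
      have "integral\<^sup>L lborel ?I2 = (\<Sum>i\<in>UNIV. - (\<integral>x. ?W x * partial i (\<lambda>y. \<phi> y * b y $ i) x \<partial>lborel))"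
        unfolding \<theta>_def
        by (subst Bochner_Integration.integral_sum) (use parts integration_by_parts_max[OF C1U C1V X] in \<open>auto simp: \<theta>_def\<close>)
      also have "\<dots> = - (\<integral>x. (\<Sum>i\<in>UNIV. ?W x * partial i (\<lambda>y. \<phi> y * b y $ i) x) \<partial>lborel)"
        using iWp by (simp add: sum_negf Bochner_Integration.integral_sum)
      also have "\<dots> = - (\<integral>x. ?W x * ?D x \<partial>lborel)" by (simp add: divergence_def sum_distrib_left)
      finally show ?thesis .
    qed
    have c\<phi>: "(\<lambda>x. c x * \<phi> x) \<in> borel_measurable borel" "\<bar>c x * \<phi> x\<bar> \<le> (B * C\<phi>) * weight p x" for x
      using mult_mono[OF potential_bound[of x] T(6)[of x]] B_nonneg by (auto simp: abs_mult mult.assoc)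
    have i3: "integrable lborel ?I3" by (rule weighted_integrable_mult[OF mix[OF u v] c\<phi>])
    have iJ: "integrable lborel ?J"
      using weighted_integrable_mult[OF mix[OF f' g'] T(7,6)] by (simp add: mult.commute)
    have iE\<phi>: "integrable lborel (\<lambda>x. E x * \<phi> x)" by (rule weighted_integrable_mult[OF iE T(7,6)])
    have i2: "integrable lborel ?I2" by (intro Bochner_Integration.integrable_sum parts)
    have iEW: "integrable lborel (\<lambda>x. E x * weight p x)" using iE by (simp add: weighted_integrable_def)
    have "(\<integral>x. \<kappa> * ?I1 x + ?I2 x + ?I3 x \<partial>lborel) \<le> (\<integral>x. ?J x + Cp * (E x * \<phi> x) \<partial>lborel)"
      by (intro integral_mono pointwise Bochner_Integration.integrable_add integrable_mult_right i1 i2 i3 iJ iE\<phi>)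
    then have main: "\<kappa> * integral\<^sup>L lborel ?I1 + integral\<^sup>L lborel ?I2 + integral\<^sup>L lborel ?I3
        \<le> integral\<^sup>L lborel ?J + Cp * (\<integral>x. E x * \<phi> x \<partial>lborel)"
      using i1 i2 i3 iJ iE\<phi> by simp
    have \<kappa>1: "\<kappa> * (\<integral>x. ?W x * ?N x \<partial>lborel) \<le> \<kappa> * integral\<^sup>L lborel ?I1"
      by (rule mult_left_mono[OF I1 constant_nonneg])
    have "(\<integral>x. E x * \<phi> x \<partial>lborel) \<le> (\<integral>x. C\<phi> * (E x * weight p x) \<partial>lborel)"
    proof (rule integral_mono[OF iE\<phi> integrable_mult_right[OF iEW]])
      fix x show "E x * \<phi> x \<le> C\<phi> * (E x * weight p x)"
        using mult_left_mono[OF order_trans[OF abs_ge_self T(6)] E0[of x], of x] by (simp add: mult_ac)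
    qed
    then have Eb: "Cp * (\<integral>x. E x * \<phi> x \<partial>lborel) \<le> Cp * C\<phi> * (\<integral>x. E x * weight p x \<partial>lborel)"
      using Cp(1) iEW by (simp add: mult.assoc)
    \<comment> \<open>what is lost when the mollified maximum is replaced by the maximum itself\<close>
    let ?L = "\<lambda>x. (?w x - ?W x) * (\<kappa> * ?N x - ?D x) + (?w x - (\<theta> x * u x + (1 - \<theta> x) * v x)) * (c x * \<phi> x)"
    have iwN: "integrable lborel (\<lambda>x. ?w x * ?N x)" by (rule weighted_integrable_mult[OF ww T(8,4)])
    have iwD: "integrable lborel (\<lambda>x. ?w x * ?D x)" by (rule weighted_integrable_mult[OF ww T(9,5)])
    have iwc: "integrable lborel (\<lambda>x. ?w x * (c x * \<phi> x))" by (rule weighted_integrable_mult[OF ww c\<phi>])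
    have eqL: "?L x = (\<kappa> * (?w x * ?N x) - ?w x * ?D x + ?w x * (c x * \<phi> x)) - (\<kappa> * (?W x * ?N x) - ?W x * ?D x + ?I3 x)" for x
      by (simp add: algebra_simps)
    have iL: "integrable lborel ?L"
      unfolding eqL by (intro Bochner_Integration.integrable_diff Bochner_Integration.integrable_add integrable_mult_right iwN iwD iwc iWN iWD i3)
    have Lint: "integral\<^sup>L lborel ?L = (\<integral>x. ?w x * adjoint_op \<phi> x \<partial>lborel)
        - (\<kappa> * (\<integral>x. ?W x * ?N x \<partial>lborel) - (\<integral>x. ?W x * ?D x \<partial>lborel) + integral\<^sup>L lborel ?I3)"
    proof -
      have "?w x * adjoint_op \<phi> x = \<kappa> * (?w x * ?N x) - ?w x * ?D x + ?w x * (c x * \<phi> x)" for x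
        by (simp add: adjoint_op_def algebra_simps)
      then show ?thesis unfolding eqL using iwN iwD iwc iWN iWD i3 by simp
    qed
    have "integral\<^sup>L lborel ?L \<le> (\<integral>x. ((\<kappa> * C\<phi> + C\<phi>) * Cm + B * C\<phi> * (2 * Cm)) * (E x * weight p x) \<partial>lborel)"
    proof (rule integral_mono[OF iL integrable_mult_right[OF iEW]])
      fix x
      have wW: "\<bar>?w x - ?W x\<bar> \<le> Cm * E x" using nearE[of x] by (auto simp: max_def abs_if split: if_splits)
      have "\<theta> x * \<bar>?U x - u x\<bar> \<le> \<bar>?U x - u x\<bar>" "(1 - \<theta> x) * \<bar>?V x - v x\<bar> \<le> \<bar>?V x - v x\<bar>"
        using \<theta>01[of x] by (auto intro!: mult_left_le_one_le)
      moreover have "\<bar>?W x - (\<theta> x * u x + (1 - \<theta> x) * v x)\<bar> \<le> \<theta> x * \<bar>?U x - u x\<bar> + (1 - \<theta> x) * \<bar>?V x - v x\<bar>"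
      proof -
        have "?W x - (\<theta> x * u x + (1 - \<theta> x) * v x) = \<theta> x * (?U x - u x) + (1 - \<theta> x) * (?V x - v x)"
          unfolding \<theta>max[symmetric] by (simp add: algebra_simps)
        then show ?thesis by (simp only: conv)
      qed
      ultimately have "\<bar>?W x - (\<theta> x * u x + (1 - \<theta> x) * v x)\<bar> \<le> Cm * E x" using nearE[of x] by linarith
      then have wt: "\<bar>?w x - (\<theta> x * u x + (1 - \<theta> x) * v x)\<bar> \<le> 2 * Cm * E x" using wW by linarith
      have "\<bar>\<kappa> * ?N x - ?D x\<bar> \<le> \<kappa> * (C\<phi> * weight p x) + C\<phi> * weight p x"
        using abs_triangle_ineq4[of "\<kappa> * ?N x" "?D x"] mult_left_mono[OF T(4)[of x] constant_nonneg] T(5)[of x] constant_nonneg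
        by (simp add: abs_mult)
      then have "\<bar>(?w x - ?W x) * (\<kappa> * ?N x - ?D x)\<bar> \<le> (Cm * E x) * (\<kappa> * (C\<phi> * weight p x) + C\<phi> * weight p x)"
        unfolding abs_mult using wW Cm(1) E0[of x] by (intro mult_mono) auto
      moreover have "\<bar>(?w x - (\<theta> x * u x + (1 - \<theta> x) * v x)) * (c x * \<phi> x)\<bar> \<le> (2 * Cm * E x) * ((B * C\<phi>) * weight p x)"
        using mult_mono[OF wt c\<phi>(2)[of x]] Cm(1) E0[of x] by (simp add: abs_mult)
      ultimately have "?L x \<le> (Cm * E x) * (\<kappa> * (C\<phi> * weight p x) + C\<phi> * weight p x) + (2 * Cm * E x) * ((B * C\<phi>) * weight p x)"
        by linarith
      then show "?L x \<le> ((\<kappa> * C\<phi> + C\<phi>) * Cm + B * C\<phi> * (2 * Cm)) * (E x * weight p x)"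
        by (simp add: algebra_simps)
    qed
    then have Lb: "integral\<^sup>L lborel ?L \<le> ((\<kappa> * C\<phi> + C\<phi>) * Cm + B * C\<phi> * (2 * Cm)) * (\<integral>x. E x * weight p x \<partial>lborel)"
      using iEW by simp
    have "0 \<le> Cm * (\<integral>x. E x * weight p x \<partial>lborel)"
      using Cm(1) E0 less_imp_le[OF weight_pos[of p]] by (intro mult_nonneg_nonneg integral_nonneg_AE AE_I2) auto
    then have "(Cp * C\<phi>) * (\<integral>x. E x * weight p x \<partial>lborel)
        + ((\<kappa> * C\<phi> + C\<phi>) * Cm + B * C\<phi> * (2 * Cm)) * (\<integral>x. E x * weight p x \<partial>lborel) \<le> C * (\<integral>x. E x * weight p x \<partial>lborel)"
      unfolding C_def distrib_right by linarith
    then have "(\<integral>x. ?w x * adjoint_op \<phi> x \<partial>lborel) \<le> integral\<^sup>L lborel ?J + C * (\<integral>x. E x * weight p x \<partial>lborel)"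
      using main \<kappa>1 I2 Eb Lint Lb by linarith
    then show "(\<integral>x. ?w x * adjoint_op \<phi> x \<partial>lborel)
      \<le> (\<integral>x. \<phi> x * ((1 + sgn (mollify r u x - mollify r v x)) / 2 * f' x
          + (1 - (1 + sgn (mollify r u x - mollify r v x)) / 2) * g' x) \<partial>lborel)
        + C * (\<integral>x. E x * weight p x \<partial>lborel)" by (simp only: \<theta>_def)
  next
    fix u v f' g' :: "real ^ 'n \<Rightarrow> real" and r :: real and x :: "real ^ 'n" assume *: "0 < r" "weighted_integrable p u" "weighted_integrable p v"
    have "Cm \<le> C" using Cp(1) Cm(1) T(3) constant_nonneg B_nonneg by (simp add: C_def)
    moreover have "0 \<le> total_oscillation r u f' x + total_oscillation r v g' x"
      using *(1) by (simp add: total_oscillation_def oscillation_nonneg)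
    ultimately show "\<bar>mollify r u x - u x\<bar> + \<bar>mollify r v x - v x\<bar> \<le> C * (total_oscillation r u f' x + total_oscillation r v g' x)"
      using near[OF *, of x f' g'] mult_right_mono order_trans by blast
  qed
qed

end

context nonlocal_drift
begin

definition locally_integrable :: "(real ^ 'n \<Rightarrow> real) \<Rightarrow> bool"
  where "locally_integrable f \<longleftrightarrow> f \<in> borel_measurable borel \<and>
    (\<forall>K. compact K \<longrightarrow> K \<subseteq> \<Omega> \<longrightarrow> integrable lborel (\<lambda>x. indicator K x * f x))"

lemma weighted_integrable_localized:
  assumes f: "locally_integrable f" and K: "compact K" "K \<subseteq> \<Omega>"
  shows "weighted_integrable p (\<lambda>x. indicator K x * f x)"
proof -
  have [measurable]: "f \<in> borel_measurable borel" "K \<in> sets borel"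
    using f K by (auto simp: locally_integrable_def compact_imp_closed borel_closed)
  have i: "integrable lborel (\<lambda>x. indicator K x * f x)" using f K by (simp add: locally_integrable_def)
  have "weight p x \<le> 1" for x :: "real ^ 'n"
    using powr_mono[of "- p" 0 "1 + norm x"] p_nonneg by (simp add: weight_def split: if_splits)
  then have "\<bar>indicator K x * f x * weight p x\<bar> \<le> \<bar>indicator K x * f x\<bar>" for x
    using less_imp_le[OF weight_pos[of p x]] by (simp add: abs_mult mult_right_le_one_le)
  then have "integrable lborel (\<lambda>x. indicator K x * f x * weight p x)"
    by (intro Bochner_Integration.integrable_bound[OF i]) auto
  then show ?thesis by (simp add: weighted_integrable_def)
qed

lemma total_oscillation_small:
  assumes u: "weighted_integrable p u" and f: "weighted_integrable p f" and e: "0 < e"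
  obtains \<delta> where "0 < \<delta>" "\<And>r. 0 < r \<Longrightarrow> r < \<delta> \<Longrightarrow> weighted_integrable p (total_oscillation r u f)
    \<and> (\<integral>x. total_oscillation r u f x * weight p x \<partial>lborel) \<le> e"
proof -
  note cu = weighted_integrable_potential[OF u]
  have e3: "0 < e / 3" using e by simp
  obtain d1 where d1: "0 < d1" "\<And>r. 0 < r \<Longrightarrow> r < d1 \<Longrightarrow> weighted_integrable p (oscillation r u)"
    "\<And>r. 0 < r \<Longrightarrow> r < d1 \<Longrightarrow> (\<integral>x. oscillation r u x * weight p x \<partial>lborel) \<le> e / 3"
    by (rule oscillation_weighted_small[OF u p_nonneg e3]) blast
  obtain d2 where d2: "0 < d2" "\<And>r. 0 < r \<Longrightarrow> r < d2 \<Longrightarrow> weighted_integrable p (oscillation r (\<lambda>y. c y * u y))"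
    "\<And>r. 0 < r \<Longrightarrow> r < d2 \<Longrightarrow> (\<integral>x. oscillation r (\<lambda>y. c y * u y) x * weight p x \<partial>lborel) \<le> e / 3"
    by (rule oscillation_weighted_small[OF cu p_nonneg e3]) blast
  obtain d3 where d3: "0 < d3" "\<And>r. 0 < r \<Longrightarrow> r < d3 \<Longrightarrow> weighted_integrable p (oscillation r f)"
    "\<And>r. 0 < r \<Longrightarrow> r < d3 \<Longrightarrow> (\<integral>x. oscillation r f x * weight p x \<partial>lborel) \<le> e / 3"
    by (rule oscillation_weighted_small[OF f p_nonneg e3]) blast
  show thesis
  proof (rule that[of "min d1 (min d2 d3)"])
    show "0 < min d1 (min d2 d3)" using d1(1) d2(1) d3(1) by simp
    fix r :: real assume r: "0 < r" "r < min d1 (min d2 d3)"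
    have w: "weighted_integrable p (oscillation r u)" "weighted_integrable p (oscillation r (\<lambda>y. c y * u y))"
      "weighted_integrable p (oscillation r f)"
      using d1(2)[of r] d2(2)[of r] d3(2)[of r] r by auto
    have "weighted_integrable p (total_oscillation r u f)"
      unfolding total_oscillation_def by (intro weighted_integrable_add w)
    moreover have "(\<integral>x. total_oscillation r u f x * weight p x \<partial>lborel)
        = (\<integral>x. oscillation r u x * weight p x \<partial>lborel) + (\<integral>x. oscillation r (\<lambda>y. c y * u y) x * weight p x \<partial>lborel)
          + (\<integral>x. oscillation r f x * weight p x \<partial>lborel)"
      using w by (simp add: total_oscillation_def weighted_integrable_def distrib_right)
    then have "(\<integral>x. total_oscillation r u f x * weight p x \<partial>lborel) \<le> e"
      using d1(3)[of r] d2(3)[of r] d3(3)[of r] r by simp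
    ultimately show "weighted_integrable p (total_oscillation r u f)
      \<and> (\<integral>x. total_oscillation r u f x * weight p x \<partial>lborel) \<le> e" by blast
  qed
qed

text \<open>Along a sequence of radii for which the oscillations tend to \<open>0\<close> almost everywhere, the weights
  \<open>\<theta>\<close> converge to the indicators off \<open>{u = v}\<close>, and on \<open>{u = v}\<close> any convex combination of \<open>f\<close> and
  \<open>g\<close> is at most their maximum.\<close>

lemma subsolution_max:
  assumes su: "subsolution u f" and sv: "subsolution v g"
    and u: "weighted_integrable p u" and v: "weighted_integrable p v"
    and f: "locally_integrable f" and g: "locally_integrable g"
  shows "subsolution (\<lambda>x. max (u x) (v x))
    (\<lambda>x. if v x < u x then f x else if u x < v x then g x else max (f x) (g x))"
  unfolding subsolution_def
proof (intro ballI impI)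
  fix \<phi> assume \<phi>: "\<phi> \<in> test_functions \<Omega>" and \<phi>0: "\<forall>x. 0 \<le> \<phi> x"
  let ?F = "\<lambda>x. if v x < u x then f x else if u x < v x then g x else max (f x) (g x)"
  let ?K = "closure {x. \<phi> x \<noteq> 0}"
  note K = test_function_support[OF \<phi>]
  have [measurable]: "u \<in> borel_measurable borel" "v \<in> borel_measurable borel" "f \<in> borel_measurable borel" "g \<in> borel_measurable borel"
    using u v f g by (simp_all add: weighted_integrable_def locally_integrable_def)
  obtain \<rho> where \<rho>: "0 < \<rho>" "(\<Union>x\<in>?K. cball x \<rho>) \<subseteq> \<Omega>"
    using compact_subset_open_imp_cball_epsilon_subset[OF K(1) open_domain K(2)] by blast
  define K' where "K' = (\<Union>x\<in>?K. cball x \<rho>)"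
  have K': "compact K'" "K' \<subseteq> \<Omega>" unfolding K'_def using compact_minkowski_sum_cball[OF K(1)] \<rho>(2) by auto
  define f' where "f' x = indicator K' x * f x" for x
  define g' where "g' x = indicator K' x * g x" for x
  have f': "weighted_integrable p f'" and g': "weighted_integrable p g'"
    unfolding f'_def g'_def using weighted_integrable_localized f g K' by blast+
  have [measurable]: "f' \<in> borel_measurable borel" "g' \<in> borel_measurable borel"
    using f' g' by (simp_all add: weighted_integrable_def)
  have supp: "x \<in> ?K" if "\<phi> x \<noteq> 0" for x using K(3)[of x] that by blast
  have fK: "f' x = f x" "g' x = g x" if "x \<in> K'" for x using that by (simp_all add: f'_def g'_def)
  obtain C where C: "0 < C" and "(\<forall>u v f g f' g' r E. subsolution u f \<longrightarrow> subsolution v g \<longrightarrow> weighted_integrable p u \<longrightarrow> weighted_integrable p v \<longrightarrow>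
      weighted_integrable p f' \<longrightarrow> weighted_integrable p g' \<longrightarrow> 0 < r \<longrightarrow>
      (\<forall>x. \<phi> x \<noteq> 0 \<longrightarrow> cball x r \<subseteq> \<Omega>) \<longrightarrow>
      (\<forall>x. \<phi> x \<noteq> 0 \<longrightarrow> (\<forall>y\<in>cball x r. f' y = f y \<and> g' y = g y)) \<longrightarrow>
      E = (\<lambda>x. total_oscillation r u f' x + total_oscillation r v g' x) \<longrightarrow> weighted_integrable p E \<longrightarrow>
      (\<integral>x. max (u x) (v x) * adjoint_op \<phi> x \<partial>lborel)
      \<le> (\<integral>x. \<phi> x * ((1 + sgn (mollify r u x - mollify r v x)) / 2 * f' x
            + (1 - (1 + sgn (mollify r u x - mollify r v x)) / 2) * g' x) \<partial>lborel)
        + C * (\<integral>x. E x * weight p x \<partial>lborel)) \<and>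
    (\<forall>u v f' g' r x. 0 < r \<longrightarrow> weighted_integrable p u \<longrightarrow> weighted_integrable p v \<longrightarrow>
      \<bar>mollify r u x - u x\<bar> + \<bar>mollify r v x - v x\<bar> \<le> C * (total_oscillation r u f' x + total_oscillation r v g' x))"
    using mollified_Kato[OF \<phi> \<phi>0[rule_format]] by blast
  note Kato = this(2)[THEN conjunct1, rule_format] and near = this(2)[THEN conjunct2, rule_format]
  define E where "E r x = total_oscillation r u f' x + total_oscillation r v g' x" for r x
  have "\<exists>r. 0 < r \<and> r < \<rho> \<and> weighted_integrable p (E r) \<and> (\<integral>x. E r x * weight p x \<partial>lborel) \<le> 1 / real (Suc k)" for k
  proof -
    have e: "0 < 1 / real (Suc k) / 2" by simp
    obtain d1 where d1: "0 < d1" "\<And>r. 0 < r \<Longrightarrow> r < d1 \<Longrightarrow> weighted_integrable p (total_oscillation r u f')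
      \<and> (\<integral>x. total_oscillation r u f' x * weight p x \<partial>lborel) \<le> 1 / real (Suc k) / 2"
      by (rule total_oscillation_small[OF u f' e]) blast
    obtain d2 where d2: "0 < d2" "\<And>r. 0 < r \<Longrightarrow> r < d2 \<Longrightarrow> weighted_integrable p (total_oscillation r v g')
      \<and> (\<integral>x. total_oscillation r v g' x * weight p x \<partial>lborel) \<le> 1 / real (Suc k) / 2"
      by (rule total_oscillation_small[OF v g' e]) blast
    define r where "r = min \<rho> (min d1 d2) / 2"
    have r: "0 < r" "r < \<rho>" "r < d1" "r < d2" using \<rho>(1) d1(1) d2(1) by (auto simp: r_def)
    note w1 = d1(2)[OF r(1,3)] and w2 = d2(2)[OF r(1,4)]
    have "weighted_integrable p (E r)"
      unfolding E_def[abs_def] using w1 w2 by (intro weighted_integrable_add) auto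
    moreover have "(\<integral>x. E r x * weight p x \<partial>lborel) = (\<integral>x. total_oscillation r u f' x * weight p x \<partial>lborel)
        + (\<integral>x. total_oscillation r v g' x * weight p x \<partial>lborel)"
      using w1 w2 by (simp add: E_def weighted_integrable_def distrib_right)
    then have "(\<integral>x. E r x * weight p x \<partial>lborel) \<le> 1 / real (Suc k)" using w1 w2 by linarith
    ultimately show ?thesis using r by blast
  qed
  then obtain r where r: "\<And>k. 0 < r k" "\<And>k. r k < \<rho>" "\<And>k. weighted_integrable p (E (r k))"
    "\<And>k. (\<integral>x. E (r k) x * weight p x \<partial>lborel) \<le> 1 / real (Suc k)" by metis
  have E0: "0 \<le> E (r k) x * weight p x" for k x
    using r(1)[of k] less_imp_le[OF weight_pos[of p x]]
    by (simp add: E_def total_oscillation_def oscillation_nonneg less_imp_le)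
  have iE: "integrable lborel (\<lambda>x. E (r k) x * weight p x)" for k using r(3)[of k] by (simp add: weighted_integrable_def)
  have inv0: "(\<lambda>k. 1 / real (Suc k)) \<longlonglongrightarrow> 0" using LIMSEQ_inverse_real_of_nat by (simp add: inverse_eq_divide)
  have E_lim: "(\<lambda>k. \<integral>x. E (r k) x * weight p x \<partial>lborel) \<longlonglongrightarrow> 0"
  proof (rule tendsto_sandwich[OF always_eventually always_eventually tendsto_const inv0])
    show "\<forall>k. 0 \<le> (\<integral>x. E (r k) x * weight p x \<partial>lborel)" using E0 by (auto intro!: integral_nonneg_AE AE_I2)
  qed (use r(4) in blast)
  then have "(\<lambda>k. \<integral>x. norm (E (r k) x * weight p x) \<partial>lborel) \<longlonglongrightarrow> 0" using E0 by simp
  from tendsto_L1_AE_subseq[OF iE this]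
  obtain s where s: "strict_mono s" "AE x in lborel. (\<lambda>k. E (r (s k)) x * weight p x) \<longlonglongrightarrow> 0" by blast
  define \<theta> where "\<theta> k x = (1 + sgn (mollify (r (s k)) u x - mollify (r (s k)) v x)) / 2" for k x
  have \<theta>01: "0 \<le> \<theta> k x" "\<theta> k x \<le> 1" for k x by (auto simp: \<theta>_def sgn_if)
  have [measurable]: "\<theta> k \<in> borel_measurable borel" for k unfolding \<theta>_def[abs_def] sgn_if by measurable
  have [measurable]: "\<phi> \<in> borel_measurable borel" using K(4)[of 0] by (intro borel_measurable_continuous_onI) simp
  let ?J = "\<lambda>k x. \<phi> x * (\<theta> k x * f' x + (1 - \<theta> k x) * g' x)"
  let ?w = "\<lambda>x. max (u x) (v x)"
  have step: "(\<integral>x. ?w x * adjoint_op \<phi> x \<partial>lborel) \<le> integral\<^sup>L lborel (?J k) + C * (\<integral>x. E (r (s k)) x * weight p x \<partial>lborel)" for k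
    unfolding \<theta>_def
  proof (rule Kato[OF su sv u v f' g' r(1)])
    show "cball x (r (s k)) \<subseteq> \<Omega>" if "\<phi> x \<noteq> 0" for x
      using supp[OF that] K'(2) r(2)[of "s k"] by (force simp: K'_def)
    show "f' y = f y \<and> g' y = g y" if "\<phi> x \<noteq> 0" "y \<in> cball x (r (s k))" for x y
    proof -
      have "y \<in> K'" using supp[OF that(1)] that(2) r(2)[of "s k"] by (force simp: K'_def)
      then show ?thesis using fK by simp
    qed
    show "E (r (s k)) = (\<lambda>x. total_oscillation (r (s k)) u f' x + total_oscillation (r (s k)) v g' x)"
      by (simp add: E_def fun_eq_iff)
  qed (rule r(3))
  let ?h = "\<lambda>x. \<bar>f' x * \<phi> x\<bar> + \<bar>g' x * \<phi> x\<bar>"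
  obtain R C\<phi> where T: "\<And>x. \<bar>\<phi> x\<bar> \<le> C\<phi> * weight p x"
    by (rule test_function_data[OF \<phi>]) blast
  have if\<phi>: "integrable lborel (\<lambda>x. f' x * \<phi> x)" "integrable lborel (\<lambda>x. g' x * \<phi> x)"
    using f' g' T by (auto intro!: weighted_integrable_mult)
  have conv: "\<bar>\<theta> k x * a + (1 - \<theta> k x) * a'\<bar> \<le> \<bar>a\<bar> + \<bar>a'\<bar>" for k x a a'
  proof -
    have "\<bar>\<theta> k x * a + (1 - \<theta> k x) * a'\<bar> \<le> \<theta> k x * \<bar>a\<bar> + (1 - \<theta> k x) * \<bar>a'\<bar>"
      using abs_triangle_ineq[of "\<theta> k x * a" "(1 - \<theta> k x) * a'"] \<theta>01[of k x] by (simp add: abs_mult)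
    also have "\<dots> \<le> \<bar>a\<bar> + \<bar>a'\<bar>" using \<theta>01[of k x] by (intro add_mono mult_left_le_one_le) auto
    finally show ?thesis .
  qed
  have J_le: "\<bar>?J k x\<bar> \<le> ?h x" for k x
  proof -
    have "?J k x = \<theta> k x * (f' x * \<phi> x) + (1 - \<theta> k x) * (g' x * \<phi> x)" by (simp add: algebra_simps)
    then show ?thesis by (simp only: conv)
  qed
  have ih: "integrable lborel ?h" using if\<phi> by simp
  have iJ: "integrable lborel (?J k)" for k
    by (rule Bochner_Integration.integrable_bound[OF ih]) (measurable, use J_le in auto)
  have F_eq: "?F x * \<phi> x = (if v x < u x then f' x else if u x < v x then g' x else max (f' x) (g' x)) * \<phi> x" for x
  proof (cases "\<phi> x = 0")
    case False
    then have "x \<in> K'" using supp[OF False] \<rho>(1) by (force simp: K'_def)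
    then show ?thesis using fK by simp
  qed simp
  have F_le: "\<bar>?F x * \<phi> x\<bar> \<le> ?h x" for x
    unfolding F_eq by (auto simp: abs_mult max_def)
  have iF: "integrable lborel (\<lambda>x. ?F x * \<phi> x)"
    by (rule Bochner_Integration.integrable_bound[OF ih]) (measurable, use F_le in auto)
  \<comment> \<open>the excess over the claimed right-hand side vanishes almost everywhere in the limit\<close>
  let ?P = "\<lambda>k x. max 0 (?J k x - ?F x * \<phi> x)"
  have iP: "integrable lborel (?P k)" for k using iJ iF by (intro Bochner_Integration.integrable_max) auto
  have P_lim: "(\<lambda>k. integral\<^sup>L lborel (?P k)) \<longlonglongrightarrow> (\<integral>x. 0 \<partial>(lborel :: (real ^ 'n) measure))"
  proof (rule integral_dominated_convergence[where w = "\<lambda>x. 2 * ?h x"])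
    show "integrable lborel (\<lambda>x. 2 * ?h x)" by (rule integrable_mult_right[OF ih])
    show "AE x in lborel. norm (?P k x) \<le> 2 * ?h x" for k
    proof (rule AE_I2)
      fix x
      have "\<bar>?J k x\<bar> \<le> ?h x" by (rule J_le)
      then show "norm (?P k x) \<le> 2 * ?h x" using F_le[of x] by (simp add: max_def abs_le_iff)
    qed
    show "AE x in lborel. (\<lambda>k. ?P k x) \<longlonglongrightarrow> 0"
      using s(2)
    proof eventually_elim
      fix x assume "(\<lambda>k. E (r (s k)) x * weight p x) \<longlonglongrightarrow> 0"
      from tendsto_mult_left[OF this, of "C / weight p x"] have CE: "(\<lambda>k. C * E (r (s k)) x) \<longlonglongrightarrow> 0"
        using weight_pos[of p x] by (simp add: mult.commute)
      have nearE: "\<bar>mollify (r (s k)) u x - u x\<bar> + \<bar>mollify (r (s k)) v x - v x\<bar> \<le> C * E (r (s k)) x" for k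
        unfolding E_def by (rule near[OF r(1) u v])
      have "\<forall>\<^sub>F k in sequentially. ?P k x = 0"
      proof (cases "u x = v x")
        case True
        have "?P k x = 0" for k
        proof -
          have "\<theta> k x * f' x \<le> \<theta> k x * max (f' x) (g' x)" "(1 - \<theta> k x) * g' x \<le> (1 - \<theta> k x) * max (f' x) (g' x)"
            using \<theta>01[of k x] by (auto intro!: mult_left_mono)
          then have "\<theta> k x * f' x + (1 - \<theta> k x) * g' x \<le> max (f' x) (g' x)" by (simp add: algebra_simps)
          from mult_left_mono[OF this, of "\<phi> x"] show ?thesis
            unfolding F_eq using \<phi>0 True by (simp add: mult.commute)
        qed
        then show ?thesis by simp
      next
        case False
        then have "0 < \<bar>u x - v x\<bar>" by simp
        from order_tendstoD(2)[OF CE this] show ?thesis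
        proof eventually_elim
          fix k assume "C * E (r (s k)) x < \<bar>u x - v x\<bar>"
          then have lt: "\<bar>mollify (r (s k)) u x - u x\<bar> + \<bar>mollify (r (s k)) v x - v x\<bar> < \<bar>u x - v x\<bar>"
            using nearE[of k] by linarith
          show "?P k x = 0"
          proof (cases "v x < u x")
            case True
            then have "mollify (r (s k)) v x < mollify (r (s k)) u x" using lt by linarith
            then have "\<theta> k x = 1" by (simp add: \<theta>_def sgn_if)
            then show ?thesis unfolding F_eq using True by (simp add: mult.commute)
          next
            case False
            with \<open>u x \<noteq> v x\<close> have uv: "u x < v x" by simp
            then have "mollify (r (s k)) u x < mollify (r (s k)) v x" using lt by linarith
            then have "\<theta> k x = 0" by (simp add: \<theta>_def sgn_if)
            then show ?thesis unfolding F_eq using uv by (simp add: mult.commute)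
          qed
        qed
      qed
      then show "(\<lambda>k. ?P k x) \<longlonglongrightarrow> 0" by (rule tendsto_eventually)
    qed
  qed measurable
  have le: "(\<integral>x. ?w x * adjoint_op \<phi> x \<partial>lborel)
      \<le> (\<integral>x. ?F x * \<phi> x \<partial>lborel) + integral\<^sup>L lborel (?P k) + C * (\<integral>x. E (r (s k)) x * weight p x \<partial>lborel)" for k
  proof -
    have "integral\<^sup>L lborel (?J k) \<le> (\<integral>x. ?F x * \<phi> x + ?P k x \<partial>lborel)"
      by (intro integral_mono iJ Bochner_Integration.integrable_add iF iP) simp
    also have "\<dots> = (\<integral>x. ?F x * \<phi> x \<partial>lborel) + integral\<^sup>L lborel (?P k)"
      by (intro Bochner_Integration.integral_add iF iP)
    finally show ?thesis using step[of k] by linarith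
  qed
  have "(\<lambda>k. (\<integral>x. ?F x * \<phi> x \<partial>lborel) + integral\<^sup>L lborel (?P k) + C * (\<integral>x. E (r (s k)) x * weight p x \<partial>lborel))
      \<longlonglongrightarrow> (\<integral>x. ?F x * \<phi> x \<partial>lborel) + (\<integral>x. 0 \<partial>(lborel :: (real ^ 'n) measure)) + C * 0"
    by (intro tendsto_add tendsto_const P_lim tendsto_mult LIMSEQ_subseq_LIMSEQ[OF E_lim s(1), unfolded o_def])
  from LIMSEQ_le_const[OF this] le
  show "(\<integral>x. ?w x * adjoint_op \<phi> x \<partial>lborel) \<le> (\<integral>x. ?F x * \<phi> x \<partial>lborel)" by simp
qed

end

section \<open>From Lebesgue measurable to Borel functions\<close>

lemma lebesgue_Borel_version:
  fixes f :: "'a::euclidean_space \<Rightarrow> real"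
  assumes "f \<in> borel_measurable lebesgue"
  obtains f' where "f' \<in> borel_measurable borel" "AE x in lebesgue. f x = f' x"
proof -
  obtain f' where "f' \<in> borel_measurable lborel" "AE x in lborel. f x = f' x"
    using completion_ex_borel_measurable_real[OF assms] by blast
  then show thesis using that by (auto intro: AE_completion)
qed

lemma
  fixes h h' :: "'a::euclidean_space \<Rightarrow> real"
  assumes h': "h' \<in> borel_measurable borel" and ae: "AE x in lebesgue. h x = h' x"
  shows integral_lebesgue_Borel: "integral\<^sup>L lebesgue h = integral\<^sup>L lborel h'"
    and integrable_lebesgue_Borel: "integrable lebesgue h \<longleftrightarrow> integrable lborel h'"
    and measurable_lebesgue_Borel: "h \<in> borel_measurable lebesgue"
proof -
  have h'l: "h' \<in> borel_measurable lborel" using h' by simp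
  have m': "h' \<in> borel_measurable lebesgue" by (rule measurable_completion[OF h'l])
  have "AE x in lebesgue. h' x = h x" using ae by (auto elim: eventually_mono)
  from borel_measurable_AE[OF m' this] show m: "h \<in> borel_measurable lebesgue" .
  show "integral\<^sup>L lebesgue h = integral\<^sup>L lborel h'"
    using integral_cong_AE[OF m m' ae] integral_completion[OF h'l] by simp
  show "integrable lebesgue h \<longleftrightarrow> integrable lborel h'"
    using integrable_cong_AE[OF m m' ae] integrable_completion[OF h'l] by simp
qed

lemma frac_laplacian_eq_nonlocal_op:
  fixes \<phi> :: "real ^ 'n::finite \<Rightarrow> real"
  assumes \<phi>: "Ck_on 2 UNIV \<phi>" "\<And>x. R < norm x \<Longrightarrow> \<phi> x = 0" and s: "0 < s" "s < 1"
  shows "frac_laplacian s \<phi> x = frac_const CARD('n) s * nonlocal_op (real CARD('n) + 2 * s) \<phi> x"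
proof -
  let ?p = "real CARD('n) + 2 * s"
  have cont: "continuous_on UNIV \<phi>"
    by (rule Ck_on_2_continuous[OF \<phi>(1)])
  then have [measurable]: "\<phi> \<in> borel_measurable borel" by (rule borel_measurable_continuous_onI)
  have "set_lebesgue_integral lebesgue {y. e < norm (x - y)} (\<lambda>y. (\<phi> x - \<phi> y) / norm (x - y) powr ?p) = trunc_op ?p e \<phi> x" for e
  proof -
    have eq: "indicator {y. e < norm (x - y)} y *\<^sub>R ((\<phi> x - \<phi> y) / norm (x - y) powr ?p)
        = (\<phi> x - \<phi> y) * trunc_kernel ?p e (x - y)" for y
      by (simp add: trunc_kernel_def indicator_def)
    show ?thesis unfolding set_lebesgue_integral_def eq trunc_op_def
      by (rule integral_completion) measurable
  qed
  then have "((\<lambda>e. set_lebesgue_integral lebesgue {y. e < norm (x - y)} (\<lambda>y. (\<phi> x - \<phi> y) / norm (x - y) powr ?p))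
      \<longlongrightarrow> nonlocal_op ?p \<phi> x) (at_right 0)"
    using trunc_op_limit(1)[OF \<phi>, where p = ?p and x = x] s by simp
  from tendsto_Lim[OF _ this] show ?thesis unfolding frac_laplacian_def by simp
qed

lemma weighted_L1_iff:
  fixes u u' :: "real ^ 'n::finite \<Rightarrow> real"
  assumes u': "u' \<in> borel_measurable borel" and ae: "AE x in lebesgue. u x = u' x" and a: "0 \<le> real CARD('n) + a"
  shows "u \<in> weighted_L1 a \<longleftrightarrow> weighted_integrable (real CARD('n) + a) u'"
proof -
  let ?p = "real CARD('n) + a"
  let ?g = "\<lambda>y :: real ^ 'n. \<bar>u' y\<bar> / (1 + norm y powr ?p)"
  note [measurable] = u'
  have m: "?g \<in> borel_measurable borel" by measurable
  have "AE y in lebesgue. \<bar>u y\<bar> / (1 + norm y powr ?p) = ?g y" using ae by (auto elim: eventually_mono)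
  from integrable_lebesgue_Borel[OF m this] measurable_lebesgue_Borel[OF u' ae]
  have "u \<in> weighted_L1 a \<longleftrightarrow> integrable lborel ?g" by (simp add: weighted_L1_def)
  also have "\<dots> \<longleftrightarrow> integrable lborel (\<lambda>x. u' x * weight ?p x)"
  proof
    have pos: "0 < 1 + norm y powr ?p" "0 < (1 + norm y) powr ?p" for y :: "real ^ 'n"
      by (simp_all add: add_pos_nonneg) (smt (verit) norm_ge_zero)
    have w: "weight ?p y = 1 / (1 + norm y) powr ?p" for y :: "real ^ 'n"
      unfolding weight_def by (rule powr_minus_divide)
    have 1: "weight ?p y \<le> 2 / (1 + norm y powr ?p)" for y :: "real ^ 'n"
    proof -
      have "norm y powr ?p \<le> (1 + norm y) powr ?p" "1 powr ?p \<le> (1 + norm y) powr ?p"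
        using a by (intro powr_mono2; simp)+
      then have "1 + norm y powr ?p \<le> 2 * (1 + norm y) powr ?p" by simp
      moreover have "1 / X \<le> 2 / Y" if "Y \<le> 2 * X" "0 < Y" "0 < X" for X Y :: real
        using that by (simp add: field_simps)
      ultimately show ?thesis unfolding w using pos[of y] by blast
    qed
    have 2: "1 / (1 + norm y powr ?p) \<le> 2 powr ?p * weight ?p y" for y :: "real ^ 'n"
    proof -
      have "(1 + norm y) powr ?p \<le> (2 * max 1 (norm y)) powr ?p" using a by (intro powr_mono2) auto
      also have "\<dots> = 2 powr ?p * (max 1 (norm y)) powr ?p" by (simp add: powr_mult)
      also have "\<dots> \<le> 2 powr ?p * (1 + norm y powr ?p)" by (intro mult_left_mono) (auto simp: max_def)
      finally have "(1 + norm y) powr ?p \<le> 2 powr ?p * (1 + norm y powr ?p)" .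
      moreover have "1 / Y \<le> q * (1 / X)" if "X \<le> q * Y" "0 < Y" "0 < X" for X Y q :: real
        using that by (simp add: field_simps)
      ultimately show ?thesis unfolding w using pos[of y] by blast
    qed
    {
      assume i: "integrable lborel ?g"
      show "integrable lborel (\<lambda>x. u' x * weight ?p x)"
      proof (rule Bochner_Integration.integrable_bound[OF integrable_mult_right[OF i, of 2]])
        show "AE x in lborel. norm (u' x * weight ?p x) \<le> norm (2 * ?g x)"
        proof (rule AE_I2)
          fix x
          show "norm (u' x * weight ?p x) \<le> norm (2 * ?g x)"
            using mult_left_mono[OF 1[of x] abs_ge_zero[of "u' x"]] less_imp_le[OF weight_pos[of ?p x]] pos(1)[of x]
            by (simp add: abs_mult mult.commute)
        qed
      qed measurable
    next
      assume i: "integrable lborel (\<lambda>x. u' x * weight ?p x)"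
      show "integrable lborel ?g"
      proof (rule Bochner_Integration.integrable_bound[OF integrable_mult_right[OF i, of "2 powr ?p"]])
        show "AE x in lborel. norm (?g x) \<le> norm (2 powr ?p * (u' x * weight ?p x))"
        proof (rule AE_I2)
          fix x
          show "norm (?g x) \<le> norm (2 powr ?p * (u' x * weight ?p x))"
            using mult_left_mono[OF 2[of x] abs_ge_zero[of "u' x"]] less_imp_le[OF weight_pos[of ?p x]] pos(1)[of x]
            by (simp add: abs_mult mult_ac)
        qed
      qed measurable
    }
  qed
  finally show ?thesis using u' by (simp add: weighted_integrable_def)
qed

text \<open>Measurability of \<open>f\<close> on \<open>\<Omega>\<close> comes from an exhaustion of \<open>\<Omega>\<close> by compact sets.\<close>

lemma L1_loc_Borel_version:
  fixes f :: "real ^ 'n::finite \<Rightarrow> real"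
  assumes \<Omega>: "open \<Omega>" and f: "f \<in> L1_loc \<Omega>"
  obtains f' where "f' \<in> borel_measurable borel" "AE x in lebesgue. x \<in> \<Omega> \<longrightarrow> f x = f' x"
    "\<forall>K. compact K \<longrightarrow> K \<subseteq> \<Omega> \<longrightarrow> integrable lborel (\<lambda>x. indicator K x * f' x)"
proof -
  obtain C :: "nat \<Rightarrow> (real ^ 'n) set" where C: "\<And>n. compact (C n)" "\<And>n. C n \<subseteq> \<Omega>"
    "\<forall>K. compact K \<longrightarrow> K \<subseteq> \<Omega> \<longrightarrow> (\<exists>N. \<forall>n\<ge>N. K \<subseteq> C n)"
  proof (rule open_Union_compact_subsets[OF \<Omega>])
    fix C :: "nat \<Rightarrow> (real ^ 'n) set"
    assume "\<And>n. compact (C n)" "\<And>n. C n \<subseteq> \<Omega>" "\<And>K. compact K \<Longrightarrow> K \<subseteq> \<Omega> \<Longrightarrow> \<exists>N. \<forall>n\<ge>N. K \<subseteq> C n"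
    then show thesis by (intro that[of C]) auto
  qed
  define g where "g x = (if x \<in> \<Omega> then f x else 0)" for x
  have "g \<in> borel_measurable lebesgue"
  proof (rule borel_measurable_LIMSEQ_real)
    show "(\<lambda>x. indicator (C n) x *\<^sub>R f x) \<in> borel_measurable lebesgue" for n
      using f C(1,2)[of n] by (auto simp: L1_loc_def set_integrable_def dest: borel_measurable_integrable)
    show "(\<lambda>n. indicator (C n) x *\<^sub>R f x) \<longlonglongrightarrow> g x" for x
    proof (cases "x \<in> \<Omega>")
      case True
      then obtain N where N: "\<forall>n\<ge>N. x \<in> C n" using C(3)[rule_format, of "{x}"] by auto
      then have "\<forall>\<^sub>F n in sequentially. indicator (C n) x *\<^sub>R f x = g x"
        using True by (auto simp: eventually_sequentially g_def intro!: exI[of _ N])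
      then show ?thesis by (rule tendsto_eventually)
    next
      case False
      then have "x \<notin> C n" for n using C(2) by blast
      then show ?thesis using False by (simp add: g_def)
    qed
  qed
  then obtain f' where f': "f' \<in> borel_measurable borel" "AE x in lebesgue. g x = f' x"
    by (rule lebesgue_Borel_version)
  show thesis
  proof (rule that[OF f'(1)]; (intro allI impI)?)
    show "AE x in lebesgue. x \<in> \<Omega> \<longrightarrow> f x = f' x" using f'(2) by (auto simp: g_def elim: eventually_mono)
    fix K assume K: "compact K" "K \<subseteq> \<Omega>"
    have [measurable]: "K \<in> sets borel" using K(1) by (simp add: compact_imp_closed borel_closed)
    note [measurable] = f'(1)
    have "(\<lambda>x. indicator K x * f' x) \<in> borel_measurable borel" by measurable
    moreover have "AE x in lebesgue. indicator K x *\<^sub>R f x = indicator K x * f' x"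
      using f'(2) by eventually_elim (use K(2) in \<open>auto simp: g_def indicator_def\<close>)
    ultimately have "integrable lebesgue (\<lambda>x. indicator K x *\<^sub>R f x) \<longleftrightarrow> integrable lborel (\<lambda>x. indicator K x * f' x)"
      by (rule integrable_lebesgue_Borel)
    then show "integrable lborel (\<lambda>x. indicator K x * f' x)"
      using f K by (simp add: L1_loc_def set_integrable_def)
  qed
qed

lemma frac_const_nonneg: "0 < s \<Longrightarrow> s < 1 \<Longrightarrow> 0 \<le> frac_const d s"
  unfolding frac_const_def
  by (intro divide_nonneg_nonneg mult_nonneg_nonneg less_imp_le[OF Gamma_real_pos]) (auto intro: add_nonneg_pos)

lemma C1_norm_bound:
  fixes b :: "real ^ 'n::finite \<Rightarrow> real ^ 'n"
  assumes "C1_norm \<Omega> b < \<infinity>" "x \<in> \<Omega>"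
  shows "norm (partial i b x) \<le> enn2real (C1_norm \<Omega> b)"
proof -
  have "ennreal (norm (partial i b x)) \<le> (SUP x\<in>\<Omega>. ennreal (norm (partial i b x)))"
    by (rule SUP_upper[OF assms(2)])
  also have "\<dots> \<le> (\<Sum>i\<in>UNIV. SUP x\<in>\<Omega>. ennreal (norm (partial i b x)))"
    by (rule member_le_sum[of i UNIV "\<lambda>i. SUP x\<in>\<Omega>. ennreal (norm (partial i b x))"]) auto
  also have "\<dots> \<le> C1_norm \<Omega> b" by (simp add: C1_norm_def)
  also have "\<dots> = ennreal (enn2real (C1_norm \<Omega> b))" using assms(1) by (simp add: less_top)
  finally show ?thesis by (simp add: ennreal_le_iff)
qed

text \<open>Clamping the Borel representative turns the essential bound into a pointwise one.\<close>

lemma Linfty_norm_Borel_version: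
  assumes \<Omega>: "open (\<Omega> :: (real ^ 'n::finite) set)" and c: "c \<in> borel_measurable (lebesgue_on \<Omega>)" and fin: "Linfty_norm \<Omega> c < \<infinity>"
  obtains c' where "c' \<in> borel_measurable borel" "AE x in lebesgue. x \<in> \<Omega> \<longrightarrow> c x = c' x" "\<And>x. \<bar>c' x\<bar> \<le> enn2real (Linfty_norm \<Omega> c)"
proof -
  let ?B = "enn2real (Linfty_norm \<Omega> c)"
  have \<Omega>l: "\<Omega> \<inter> space lebesgue \<in> sets lebesgue" using \<Omega> by (simp add: borel_open)
  have "AE x in lebesgue_on \<Omega>. ennreal \<bar>c x\<bar> \<le> Linfty_norm \<Omega> c"
    unfolding Linfty_norm_def by (rule esssup_AE)
  then have ae: "AE x in lebesgue. x \<in> \<Omega> \<longrightarrow> ennreal \<bar>c x\<bar> \<le> Linfty_norm \<Omega> c"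
    by (simp only: AE_restrict_space_iff[OF \<Omega>l])
  have "(\<lambda>x. indicator \<Omega> x *\<^sub>R c x) \<in> borel_measurable lebesgue"
    using c borel_measurable_restrict_space_iff[OF \<Omega>l, of c] by simp
  then obtain c2 where c2: "c2 \<in> borel_measurable borel" "AE x in lebesgue. indicator \<Omega> x *\<^sub>R c x = c2 x"
    by (rule lebesgue_Borel_version)
  note [measurable] = c2(1)
  show thesis
  proof (rule that[of "\<lambda>x. max (- ?B) (min ?B (c2 x))"])
    show "AE x in lebesgue. x \<in> \<Omega> \<longrightarrow> c x = max (- ?B) (min ?B (c2 x))"
      using ae c2(2)
    proof eventually_elim
      fix x assume 1: "x \<in> \<Omega> \<longrightarrow> ennreal \<bar>c x\<bar> \<le> Linfty_norm \<Omega> c" and 2: "indicator \<Omega> x *\<^sub>R c x = c2 x"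
      show "x \<in> \<Omega> \<longrightarrow> c x = max (- ?B) (min ?B (c2 x))"
      proof
        assume x: "x \<in> \<Omega>"
        have "ennreal \<bar>c x\<bar> \<le> ennreal ?B" using 1 x fin by (simp add: less_top)
        then have "\<bar>c x\<bar> \<le> ?B" by (simp add: ennreal_le_iff)
        then show "c x = max (- ?B) (min ?B (c2 x))" using 2 x by auto
      qed
    qed
    show "\<bar>max (- ?B) (min ?B (c2 x))\<bar> \<le> ?B" for x by (auto simp: abs_le_iff)
  qed measurable
qed

text \<open>Both \<open>\<phi>\<close> and the divergence vanish off \<open>\<Omega>\<close>, so the integrals over \<open>\<Omega>\<close> are integrals over the whole
  space and do not see the values of the coefficients off \<open>\<Omega>\<close>.\<close>

lemma (in nonlocal_drift) distributional_integrals: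
  fixes s :: real
  assumes s: "0 < s" "s < 1" and p: "p = real CARD('n) + 2 * s" and \<kappa>: "\<kappa> = frac_const CARD('n) s"
    and c': "AE x in lebesgue. x \<in> \<Omega> \<longrightarrow> c0 x = c x"
    and u': "weighted_integrable p u'" "AE x in lebesgue. u x = u' x"
    and f': "f' \<in> borel_measurable borel" "AE x in lebesgue. x \<in> \<Omega> \<longrightarrow> f x = f' x"
    and \<phi>: "\<phi> \<in> test_functions \<Omega>"
  shows "integral\<^sup>L lebesgue (\<lambda>x. u x * frac_laplacian s \<phi> x)
       + set_lebesgue_integral lebesgue \<Omega> (\<lambda>x. u x * (- divergence (\<lambda>y. \<phi> y *\<^sub>R b y) x + c0 x * \<phi> x))
      = (\<integral>y. u' y * adjoint_op \<phi> y \<partial>lborel)"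
    and "set_lebesgue_integral lebesgue \<Omega> (\<lambda>x. f x * \<phi> x) = (\<integral>y. f' y * \<phi> y \<partial>lborel)"
proof -
  obtain R C where T: "closure {x. \<phi> x \<noteq> 0} \<subseteq> cball 0 R" "\<And>x. R < norm x \<Longrightarrow> \<phi> x = 0" "0 < C"
    "\<And>x. \<bar>nonlocal_op p \<phi> x\<bar> \<le> C * weight p x"
    "\<And>x. \<bar>divergence (\<lambda>y. \<phi> y *\<^sub>R b y) x\<bar> \<le> C * weight p x" "\<And>x. \<bar>\<phi> x\<bar> \<le> C * weight p x"
    "\<phi> \<in> borel_measurable borel" "nonlocal_op p \<phi> \<in> borel_measurable borel"
    "divergence (\<lambda>y. \<phi> y *\<^sub>R b y) \<in> borel_measurable borel"
    by (rule test_function_data[OF \<phi>]) (rule that; assumption)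
  note [measurable] = T(7,8,9) f'(1)
  have [measurable]: "u' \<in> borel_measurable borel" using u'(1) by (simp add: weighted_integrable_def)
  let ?N = "nonlocal_op p \<phi>" and ?D = "divergence (\<lambda>y. \<phi> y *\<^sub>R b y)"
  note K = test_function_support[OF \<phi>] and Dv = divergence_test_function_times_field(2)[OF \<phi> open_domain drift_C1]
  have off: "\<phi> x = 0" "?D x = 0" if "x \<notin> \<Omega>" for x using K(2,3) Dv that by blast+
  have m1: "(\<lambda>x. u' x * (\<kappa> * ?N x)) \<in> borel_measurable borel" by measurable
  have m2: "(\<lambda>x. u' x * (- ?D x + c x * \<phi> x)) \<in> borel_measurable borel" by measurable
  have m3: "(\<lambda>x. f' x * \<phi> x) \<in> borel_measurable borel" by measurable
  have "AE x in lebesgue. u x * frac_laplacian s \<phi> x = u' x * (\<kappa> * ?N x)"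
    using u'(2) by eventually_elim (simp add: frac_laplacian_eq_nonlocal_op[OF K(4) T(2) s] p \<kappa>)
  from integral_lebesgue_Borel[OF m1 this]
  have 1: "integral\<^sup>L lebesgue (\<lambda>x. u x * frac_laplacian s \<phi> x) = (\<integral>x. u' x * (\<kappa> * ?N x) \<partial>lborel)" .
  have "AE x in lebesgue. indicator \<Omega> x *\<^sub>R (u x * (- ?D x + c0 x * \<phi> x)) = u' x * (- ?D x + c x * \<phi> x)"
    using u'(2) c' by eventually_elim (auto simp: indicator_def off)
  from integral_lebesgue_Borel[OF m2 this]
  have 2: "set_lebesgue_integral lebesgue \<Omega> (\<lambda>x. u x * (- ?D x + c0 x * \<phi> x)) = (\<integral>x. u' x * (- ?D x + c x * \<phi> x) \<partial>lborel)"
    by (simp add: set_lebesgue_integral_def)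
  have i1: "integrable lborel (\<lambda>x. u' x * (\<kappa> * ?N x))"
    using integrable_mult_right[OF weighted_integrable_mult[OF u'(1) T(8,4)], of \<kappa>] by (simp add: mult_ac)
  have i2: "integrable lborel (\<lambda>x. u' x * (- ?D x + c x * \<phi> x))"
  proof -
    have "integrable lborel (\<lambda>x. (c x * u' x) * \<phi> x - u' x * ?D x)"
      by (intro Bochner_Integration.integrable_diff weighted_integrable_mult[OF u'(1) T(9,5)]
        weighted_integrable_mult[OF weighted_integrable_potential[OF u'(1)] T(7,6)])
    then show ?thesis by (simp add: algebra_simps)
  qed
  have "u' y * adjoint_op \<phi> y = u' y * (\<kappa> * ?N y) + u' y * (- ?D y + c y * \<phi> y)" for y
    by (simp add: adjoint_op_def algebra_simps)
  then show "integral\<^sup>L lebesgue (\<lambda>x. u x * frac_laplacian s \<phi> x)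
       + set_lebesgue_integral lebesgue \<Omega> (\<lambda>x. u x * (- divergence (\<lambda>y. \<phi> y *\<^sub>R b y) x + c0 x * \<phi> x))
      = (\<integral>y. u' y * adjoint_op \<phi> y \<partial>lborel)"
    unfolding 1 2 using i1 i2 by simp
  have "AE x in lebesgue. indicator \<Omega> x *\<^sub>R (f x * \<phi> x) = f' x * \<phi> x"
    using f'(2) by eventually_elim (auto simp: indicator_def off)
  from integral_lebesgue_Borel[OF m3 this]
  show "set_lebesgue_integral lebesgue \<Omega> (\<lambda>x. f x * \<phi> x) = (\<integral>y. f' y * \<phi> y \<partial>lborel)"
    by (simp add: set_lebesgue_integral_def)
qed

section \<open>The maximum of two distributional subsolutions\<close>

theorem theorem1p7:
  fixes s :: real
    and \<Omega> :: "(real ^ 'n::finite) set"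
    and b :: "real ^ 'n \<Rightarrow> real ^ 'n"
    and c u v f g :: "real ^ 'n \<Rightarrow> real"
  assumes "0 < s" and "s < 1"
    and "open \<Omega>" and "connected \<Omega>" and "\<Omega> \<noteq> {}"
    and "Ck_on 1 \<Omega> b" and "c \<in> borel_measurable (lebesgue_on \<Omega>)"
    and "C1_norm \<Omega> b + Linfty_norm \<Omega> c < \<infinity>"
    and "u \<in> weighted_L1 (2 * s)" and "v \<in> weighted_L1 (2 * s)"
    and "f \<in> L1_loc \<Omega>" and "g \<in> L1_loc \<Omega>"
    and "distr_le \<Omega> s b c u f"
    and "distr_le \<Omega> s b c v g"
  shows "distr_le \<Omega> s b c (\<lambda>x. max (u x) (v x))
    (\<lambda>x. f x * indicator {y. u y > v y} x + g x * indicator {y. u y < v y} x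
       + max (f x) (g x) * indicator {y. u y = v y} x)"
proof -
  let ?F = "\<lambda>x. f x * indicator {y. u y > v y} x + g x * indicator {y. u y < v y} x
       + max (f x) (g x) * indicator {y. u y = v y} x"
  let ?p = "real CARD('n) + 2 * s" and ?\<kappa> = "frac_const CARD('n) s"
  have fin: "C1_norm \<Omega> b < \<infinity>" "Linfty_norm \<Omega> c < \<infinity>"
    using assms(8) by (auto simp: less_top[symmetric] ennreal_add_eq_top)
  obtain c' where c': "c' \<in> borel_measurable borel" "AE x in lebesgue. x \<in> \<Omega> \<longrightarrow> c x = c' x"
    "\<And>x. \<bar>c' x\<bar> \<le> enn2real (Linfty_norm \<Omega> c)"
    by (rule Linfty_norm_Borel_version[OF assms(3,7) fin(2)]) (rule that; assumption)
  define B where "B = enn2real (C1_norm \<Omega> b) + enn2real (Linfty_norm \<Omega> c)"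
  have "norm (partial i b x) \<le> B" if "x \<in> \<Omega>" for x i
    using C1_norm_bound[OF fin(1) that, of i] by (simp add: B_def add_increasing2)
  moreover have "\<bar>c' x\<bar> \<le> B" for x using c'(3)[of x] by (simp add: B_def add_increasing)
  ultimately interpret D: nonlocal_drift \<Omega> b c' ?p ?\<kappa> B
    using assms(1-3,6) c'(1) frac_const_nonneg[OF assms(1,2)] by unfold_locales auto
  have p0: "0 \<le> real CARD('n) + 2 * s" using assms(1) by simp
  obtain u' where u': "u' \<in> borel_measurable borel" "AE x in lebesgue. u x = u' x"
    using lebesgue_Borel_version[of u] assms(9) by (auto simp: weighted_L1_def)
  obtain v' where v': "v' \<in> borel_measurable borel" "AE x in lebesgue. v x = v' x"
    using lebesgue_Borel_version[of v] assms(10) by (auto simp: weighted_L1_def)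
  have wu: "weighted_integrable ?p u'" and wv: "weighted_integrable ?p v'"
    using weighted_L1_iff[OF u' p0] weighted_L1_iff[OF v' p0] assms(9,10) by simp_all
  obtain f' where f': "f' \<in> borel_measurable borel" "AE x in lebesgue. x \<in> \<Omega> \<longrightarrow> f x = f' x"
    "\<forall>K. compact K \<longrightarrow> K \<subseteq> \<Omega> \<longrightarrow> integrable lborel (\<lambda>x. indicator K x * f' x)"
    by (rule L1_loc_Borel_version[OF assms(3,11)])
  obtain g' where g': "g' \<in> borel_measurable borel" "AE x in lebesgue. x \<in> \<Omega> \<longrightarrow> g x = g' x"
    "\<forall>K. compact K \<longrightarrow> K \<subseteq> \<Omega> \<longrightarrow> integrable lborel (\<lambda>x. indicator K x * g' x)"
    by (rule L1_loc_Borel_version[OF assms(3,12)])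
  note [measurable] = u'(1) v'(1) f'(1) g'(1)
  let ?F' = "\<lambda>x. if v' x < u' x then f' x else if u' x < v' x then g' x else max (f' x) (g' x)"
  note ints = D.distributional_integrals[OF assms(1,2) refl refl c'(2)]
  have su: "D.subsolution u' f'" and sv: "D.subsolution v' g'"
    using assms(13,14) ints[OF wu u'(2) f'(1,2)] ints[OF wv v'(2) g'(1,2)]
    by (simp_all add: D.subsolution_def distr_le_def)
  have li: "D.locally_integrable f'" "D.locally_integrable g'"
    using f' g' by (auto simp: D.locally_integrable_def)
  note sub = D.subsolution_max[OF su sv wu wv li]
  have mF: "?F' \<in> borel_measurable borel" by measurable
  have aeF: "AE x in lebesgue. x \<in> \<Omega> \<longrightarrow> ?F x = ?F' x"
    using u'(2) v'(2) f'(2) g'(2) by eventually_elim (auto simp: indicator_def)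
  have aew: "AE x in lebesgue. max (u x) (v x) = max (u' x) (v' x)"
    using u'(2) v'(2) by eventually_elim simp
  have ww: "weighted_integrable ?p (\<lambda>x. max (u' x) (v' x))" by (rule weighted_integrable_max[OF wu wv])
  have "(\<lambda>x. max (u x) (v x)) \<in> weighted_L1 (2 * s)"
    using weighted_L1_iff[OF _ aew p0] ww by (simp add: weighted_integrable_def)
  moreover have "?F \<in> L1_loc \<Omega>"
    unfolding L1_loc_def set_integrable_def
  proof (intro CollectI allI impI)
    fix K assume K: "compact K" "K \<subseteq> \<Omega>"
    have [measurable]: "K \<in> sets borel" using K(1) by (simp add: compact_imp_closed borel_closed)
    have m: "(\<lambda>x. indicator K x * ?F' x) \<in> borel_measurable borel" by measurable
    have ae: "AE x in lebesgue. indicator K x *\<^sub>R ?F x = indicator K x * ?F' x"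
      using aeF by eventually_elim (use K(2) in \<open>auto simp: indicator_def split: if_splits\<close>)
    have "integrable lborel (\<lambda>x. \<bar>indicator K x * f' x\<bar> + \<bar>indicator K x * g' x\<bar>)"
      using f'(3) g'(3) K by simp
    then have "integrable lborel (\<lambda>x. indicator K x * ?F' x)"
      by (rule Bochner_Integration.integrable_bound) (measurable, auto simp: abs_mult indicator_def max_def)
    then show "integrable lebesgue (\<lambda>x. indicator K x *\<^sub>R ?F x)"
      using integrable_lebesgue_Borel[OF m ae] by simp
  qed
  ultimately show ?thesis
    unfolding distr_le_def using sub ints[OF ww aew mF aeF] by (simp add: D.subsolution_def)
qed

end
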